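(* Let $D>1$ be a squarefree integer, let $u=A+B\sqrt{D}\in\mathcal{S}_D$, let $C=C(u)$, and let $[a,2b,c]\in H$ (so $a>0$, $\gcd(a,2b,c)=1$, $b^2-ac=-27C^2D$). Let $p\equiv 1 \pmod 3$ be a prime with $p=ax^2+2bxy+cy^2$ for some integers $x,y$, and assume that $$\gcd(ap,\,3N(u)Dy)=1.$$ Then $u$ is a cubic residue modulo $p$ (i.e. $u^{(p-1)/3}\equiv 1 \pmod p$, where $\sqrt{D}$ is interpreted as a square root of $D$ modulo $p$, which exists) if and only if $$\left(\frac{9A-(B/C)\,b\,(1+2\omega)}{a}\right)_3=1.$$
   Context: For squarefree $D>1$, let $\mathcal{O}$ be the ring of integers of $\mathbb{Q}(\sqrt{D})$. The set $\mathcal{S}_D$ consists of those $u=A+B\sqrt{D}$ with $A,B\in\mathbb{Z}$ such that the norm $N(u)=A^2-B^2D$ is the cube of an integer, $u$ is not a cube in $\mathcal{O}$, and $\gcd(A,B)$ is not divisible by the cube of any prime. For $u\in\mathcal{S}_D$, $C(u)$ is the product of the distinct odd primes that divide $\gcd(A,B)$ but do not divide $D$ (so $C\mid B$). With $d=-27C^2D$, $H=H(4d)$ denotes the form class group of discriminant $4d$, consisting of the (proper equivalence) classes of primitive binary quadratic forms $[a,2b,c]=ax^2+2bxy+cy^2$ with $a>0$ and $b^2-ac=d$. Let $\omega=(-1+i\sqrt{3})/2$. For $\alpha\in\mathbb{Z}[\omega]$ and a prime $\pi$ of $\mathbb{Z}[\omega]$ not dividing $3$, $(\alpha/\pi)_3\in\{0,1,\omega,\omega^2\}$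 is the cubic residue symbol, defined by $(\alpha/\pi)_3\equiv \alpha^{(N\pi-1)/3}\pmod{\pi}$; for a nonzero element (in particular a positive rational integer) $n$ of $\mathbb{Z}[\omega]$ coprime to $3$, $(\alpha/n)_3$ is defined multiplicatively via the factorization of $n$ into primes of $\mathbb{Z}[\omega]$. *)

theory Defs
  imports
    Complex_Main
    "HOL-Computational_Algebra.Computational_Algebra"
    "HOL-Number_Theory.Cong"
begin

section \<open>The Eisenstein integers\<close>

text \<open>
  \<open>Eis x y\<close> stands for \<open>x + y\<omega>\<close> with \<open>\<omega> = (-1 + i\<surd>3)/2\<close>, so that \<open>\<omega>\<^sup>2 = -1 - \<omega>\<close>;
  see \<open>complex_of_eis\<close> below for the embedding into the complex numbers.
\<close>

datatype eisenstein = Eis (eis_fst: int) (eis_snd: int)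

lemma eis_eq_iff: "a = b \<longleftrightarrow> eis_fst a = eis_fst b \<and> eis_snd a = eis_snd b"
  by (cases a; cases b) auto

instantiation eisenstein :: comm_ring_1
begin

definition "0 = Eis 0 0"
definition "1 = Eis 1 0"
definition "a + b = Eis (eis_fst a + eis_fst b) (eis_snd a + eis_snd b)"
definition "- a = Eis (- eis_fst a) (- eis_snd a)"
definition "a - b = Eis (eis_fst a - eis_fst b) (eis_snd a - eis_snd b)"
definition "a * b = Eis (eis_fst a * eis_fst b - eis_snd a * eis_snd b)
  (eis_fst a * eis_snd b + eis_snd a * eis_fst b - eis_snd a * eis_snd b)"

lemmas eis_defs = zero_eisenstein_def one_eisenstein_def plus_eisenstein_def
  uminus_eisenstein_def minus_eisenstein_def times_eisenstein_def

instance
  by standard (auto simp: eis_defs algebra_simps split: eisenstein.splits)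

end

lemma eis_sel [simp]:
  "eis_fst 0 = 0" "eis_snd 0 = 0" "eis_fst 1 = 1" "eis_snd 1 = 0"
  "eis_fst (a + b) = eis_fst a + eis_fst b" "eis_snd (a + b) = eis_snd a + eis_snd b"
  "eis_fst (- a) = - eis_fst a" "eis_snd (- a) = - eis_snd a"
  "eis_fst (a - b) = eis_fst a - eis_fst b" "eis_snd (a - b) = eis_snd a - eis_snd b"
  "eis_fst (a * b) = eis_fst a * eis_fst b - eis_snd a * eis_snd b"
  "eis_snd (a * b) = eis_fst a * eis_snd b + eis_snd a * eis_fst b - eis_snd a * eis_snd b"
  by (simp_all add: eis_defs)

lemma eis_of_nat: "of_nat n = Eis (int n) 0"
  by (induction n) (auto simp: eis_eq_iff)

lemma eis_of_int: "of_int n = Eis n 0"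
  by (cases n rule: int_diff_cases) (simp add: eis_of_nat eis_eq_iff)

lemma eis_numeral: "numeral k = Eis (numeral k) 0"
  using eis_of_int[of "numeral k"] by simp

definition eis_omega :: eisenstein where
  "eis_omega = Eis 0 1"

definition complex_of_eis :: "eisenstein \<Rightarrow> complex" where
  "complex_of_eis a = of_int (eis_fst a) + of_int (eis_snd a) * ((-1 + \<i> * of_real (sqrt 3)) / 2)"

lemma complex_of_eis_hom:
  "complex_of_eis 1 = 1"
  "complex_of_eis (a + b) = complex_of_eis a + complex_of_eis b"
  "complex_of_eis (a * b) = complex_of_eis a * complex_of_eis b"
  by (simp_all add: complex_of_eis_def complex_eq_iff field_simps)

lemma inj_complex_of_eis: "inj complex_of_eis"
  by (rule injI) (auto simp: complex_of_eis_def complex_eq_iff eis_eq_iff)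

lemma complex_of_eis_omega: "complex_of_eis eis_omega = (-1 + \<i> * of_real (sqrt 3)) / 2"
  by (simp add: complex_of_eis_def eis_omega_def)

definition eis_norm :: "eisenstein \<Rightarrow> int" where
  "eis_norm a = (eis_fst a)\<^sup>2 - eis_fst a * eis_snd a + (eis_snd a)\<^sup>2"

lemma eis_norm_complex: "of_int (eis_norm a) = (cmod (complex_of_eis a))\<^sup>2"
  unfolding cmod_power2
  by (simp add: eis_norm_def complex_of_eis_def power2_eq_square field_simps)

lemma eis_norm_mult: "eis_norm (a * b) = eis_norm a * eis_norm b"
  by (simp add: eis_norm_def power2_eq_square algebra_simps)

lemma eis_norm_nonneg: "eis_norm a \<ge> 0"
  using eis_norm_complex[of a] by (metis of_int_0_le_iff zero_le_power2)

lemma eis_norm_0 [simp]: "eis_norm 0 = 0"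
  by (simp add: eis_norm_def)

lemma complex_of_eis_0_iff: "complex_of_eis a = 0 \<longleftrightarrow> a = 0"
  using injD[OF inj_complex_of_eis, of a 0] by (auto simp: complex_of_eis_def)

lemma eis_norm_eq_0_iff [simp]: "eis_norm a = 0 \<longleftrightarrow> a = 0"
  using eis_norm_complex[of a] complex_of_eis_0_iff[of a] by auto

lemma eis_norm_pos: "a \<noteq> 0 \<Longrightarrow> eis_norm a > 0"
  using eis_norm_nonneg[of a] eis_norm_eq_0_iff[of a] by linarith

instance eisenstein :: idom
proof
  fix a b :: eisenstein
  assume "a \<noteq> 0" "b \<noteq> 0"
  then show "a * b \<noteq> 0"
    by (metis eis_norm_eq_0_iff eis_norm_mult mult_eq_0_iff)
qed

definition eis_cnj :: "eisenstein \<Rightarrow> eisenstein" where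
  "eis_cnj a = Eis (eis_fst a - eis_snd a) (- eis_snd a)"

lemma eis_mult_cnj: "a * eis_cnj a = of_int (eis_norm a)"
  by (simp add: eis_eq_iff eis_cnj_def eis_of_int eis_norm_def power2_eq_square algebra_simps)

lemma eis_norm_cnj: "eis_norm (eis_cnj a) = eis_norm a"
  by (simp add: eis_norm_def eis_cnj_def power2_eq_square algebra_simps)

text \<open>Nearest-integer division; the rounding is coordinatewise in \<open>(x * eis_cnj y) / eis_norm y\<close>.\<close>

definition round_div :: "int \<Rightarrow> int \<Rightarrow> int" where
  "round_div m n = (2 * m + n) div (2 * n)"

lemma round_div_mult: "n > 0 \<Longrightarrow> round_div (m * n) n = m"
proof -
  assume n: "n > 0"
  have "(n + m * (2 * n)) div (2 * n) = m"
    using n by simp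
  moreover have "n + m * (2 * n) = 2 * (m * n) + n"
    by simp
  ultimately show ?thesis
    unfolding round_div_def by simp
qed

lemma round_div_bound:
  assumes "n > 0"
  shows "\<bar>2 * (m - round_div m n * n)\<bar> \<le> n"
proof -
  have "(2 * m + n) = (2 * n) * round_div m n + (2 * m + n) mod (2 * n)"
    unfolding round_div_def by simp
  moreover have "0 \<le> (2 * m + n) mod (2 * n)" "(2 * m + n) mod (2 * n) < 2 * n"
    using assms by simp_all
  ultimately have "0 \<le> 2 * m + n - 2 * n * round_div m n" "2 * m + n - 2 * n * round_div m n < 2 * n"
    by linarith+
  then show ?thesis
    by (simp add: abs_le_iff algebra_simps)
qed

text \<open>
  The library's \<open>prime_factorization\<close> asks for a choice of representatives modulo units.
  The choice made here is arbitrary; the residue symbol below does not depend on it.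
\<close>

instantiation eisenstein :: "{normalization_semidom, euclidean_ring}"
begin

definition "x div y = (if y = 0 then 0 else
  Eis (round_div (eis_fst (x * eis_cnj y)) (eis_norm y))
      (round_div (eis_snd (x * eis_cnj y)) (eis_norm y)))" for x y :: eisenstein

definition "x mod y = x - x div y * y" for x y :: eisenstein

definition "euclidean_size x = nat (eis_norm x)" for x :: eisenstein

definition "normalize x = (if x dvd 1 then 1 else SOME y. y dvd x \<and> x dvd y)" for x :: eisenstein

definition "unit_factor x = x div normalize x" for x :: eisenstein

lemma eis_mult_div: "b \<noteq> 0 \<Longrightarrow> a * b div b = a" for a b :: eisenstein
proof -
  assume b: "b \<noteq> 0"
  then have "eis_norm b > 0"
    by (rule eis_norm_pos)
  moreover have "a * b * eis_cnj b = a * of_int (eis_norm b)"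
    by (simp add: mult.assoc eis_mult_cnj)
  then have "eis_fst (a * b * eis_cnj b) = eis_fst a * eis_norm b"
    "eis_snd (a * b * eis_cnj b) = eis_snd a * eis_norm b"
    by (simp_all only:) (simp_all add: eis_of_int)
  ultimately show ?thesis
    using b by (simp only: divide_eisenstein_def round_div_mult if_False eisenstein.collapse)
qed

lemma eis_mod_norm_less:
  fixes a b :: eisenstein
  assumes b: "b \<noteq> 0"
  shows "eis_norm (a mod b) < eis_norm b"
proof -
  define n where "n = eis_norm b"
  have n: "n > 0"
    unfolding n_def using b by (rule eis_norm_pos)
  define z where "z = a mod b * eis_cnj b"
  have "z = a * eis_cnj b - a div b * of_int n"
    by (simp add: z_def modulo_eisenstein_def left_diff_distrib mult.assoc eis_mult_cnj n_def)
  then have z1: "\<bar>2 * eis_fst z\<bar> \<le> n" and z2: "\<bar>2 * eis_snd z\<bar> \<le> n"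
    using b n round_div_bound[OF n, of "eis_fst (a * eis_cnj b)"]
      round_div_bound[OF n, of "eis_snd (a * eis_cnj b)"]
    by (simp_all only: divide_eisenstein_def eis_of_int eis_sel eisenstein.sel n_def if_False
        mult_zero_right diff_0_right add_0_left)
  have "(2 * eis_fst z)\<^sup>2 \<le> n\<^sup>2" "(2 * eis_snd z)\<^sup>2 \<le> n\<^sup>2"
    using z1 z2 by (auto simp only: power2_abs[of "2 * _", symmetric] intro!: power_mono)
  moreover have "\<bar>2 * eis_fst z\<bar> * \<bar>2 * eis_snd z\<bar> \<le> n * n"
    using z1 z2 n by (intro mult_mono) auto
  then have "- (2 * eis_fst z * (2 * eis_snd z)) \<le> n\<^sup>2"
    unfolding power2_eq_square abs_mult[symmetric] by linarith
  ultimately have "4 * eis_norm z \<le> 3 * n\<^sup>2"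
    unfolding eis_norm_def power_mult_distrib by simp
  moreover have "eis_norm z = eis_norm (a mod b) * n"
    by (simp add: z_def eis_norm_mult eis_norm_cnj n_def)
  ultimately have "(4 * eis_norm (a mod b)) * n \<le> (3 * n) * n"
    by (simp add: power2_eq_square)
  then have "4 * eis_norm (a mod b) \<le> 3 * n"
    using n by (simp only: mult_le_cancel_right)
  then show ?thesis
    using n unfolding n_def by linarith
qed

lemma eis_unit_factor_normalize: "\<exists>u. u dvd 1 \<and> x = u * normalize x" for x :: eisenstein
proof (cases "x dvd 1")
  case True
  then show ?thesis
    by (auto simp: normalize_eisenstein_def)
next
  case False
  have "normalize x = (SOME y. y dvd x \<and> x dvd y)"
    using False by (simp add: normalize_eisenstein_def)
  moreover have "(SOME y. y dvd x \<and> x dvd y) dvd x \<and> x dvd (SOME y. y dvd x \<and> x dvd y)"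
    by (rule someI[of "\<lambda>y. y dvd x \<and> x dvd y" x]) simp
  ultimately have "normalize x dvd x" "x dvd normalize x"
    by simp_all
  then obtain u v where u: "x = normalize x * u" and v: "normalize x = x * v"
    unfolding dvd_def by blast
  have "x \<noteq> 0 \<Longrightarrow> u * v = 1"
  proof -
    assume "x \<noteq> 0"
    moreover have "x * (u * v) = x * v * u"
      by (simp only: mult.assoc mult.commute[of u v])
    then have "x * (u * v) = x * 1"
      by (simp only: v[symmetric] u[symmetric] mult_1_right)
    ultimately show "u * v = 1"
      using mult_left_cancel[of x "u * v" 1] by simp
  qed
  then show ?thesis
  proof (cases "x = 0")
    case True
    then have "1 dvd (1 :: eisenstein) \<and> x = 1 * normalize x"
      using v by simp
    then show ?thesis ..
  next
    case False
    then have "1 = u * v"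
      using \<open>x \<noteq> 0 \<Longrightarrow> u * v = 1\<close> by simp
    then have "u dvd 1"
      by (rule dvdI)
    moreover have "x = u * normalize x"
      by (subst mult.commute) (rule u)
    ultimately show ?thesis
      by blast
  qed
qed

lemma eis_normalize_unit_mult:
  fixes u x :: eisenstein
  assumes "u dvd 1"
  shows "normalize (u * x) = normalize x"
proof -
  obtain v where v: "1 = u * v"
    using assms by (elim dvdE)
  have "x = (u * v) * x"
    by (simp only: v[symmetric] mult_1_left)
  also have "\<dots> = u * x * v"
    by (simp only: mult.assoc mult.commute[of v x])
  finally have "u * x dvd x"
    by (rule dvdI)
  moreover have "x dvd u * x"
    by (rule dvd_triv_right)
  ultimately have "u * x dvd y \<longleftrightarrow> x dvd y" "y dvd u * x \<longleftrightarrow> y dvd x" for y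
    by (blast intro: dvd_trans)+
  moreover from this(2) have "u * x dvd 1 \<longleftrightarrow> x dvd 1"
    using \<open>u * x dvd x\<close> \<open>x dvd u * x\<close> by (blast intro: dvd_trans)
  ultimately have "(u * x dvd 1) = (x dvd 1)" "(\<lambda>y. y dvd u * x \<and> u * x dvd y) = (\<lambda>y. y dvd x \<and> x dvd y)"
    by simp_all
  then show ?thesis
    unfolding normalize_eisenstein_def by simp
qed

instance
proof
  fix a b :: eisenstein
  show "b \<noteq> 0 \<Longrightarrow> a * b div b = a"
    by (rule eis_mult_div)
  show "a div 0 = 0"
    by (simp add: divide_eisenstein_def)
  show "a div b * b + a mod b = a"
    by (simp add: modulo_eisenstein_def)
  show "euclidean_size (0 :: eisenstein) = 0"
    by (simp add: euclidean_size_eisenstein_def)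
  show "b \<noteq> 0 \<Longrightarrow> euclidean_size (a mod b) < euclidean_size b"
    using eis_mod_norm_less[of b a] eis_norm_nonneg[of "a mod b"]
    by (simp add: euclidean_size_eisenstein_def)
  show "b \<noteq> 0 \<Longrightarrow> euclidean_size a \<le> euclidean_size (a * b)"
  proof -
    assume "b \<noteq> 0"
    then have "1 \<le> eis_norm b"
      using eis_norm_nonneg[of b] eis_norm_eq_0_iff[of b] by linarith
    then have "eis_norm a * 1 \<le> eis_norm a * eis_norm b"
      by (intro mult_left_mono eis_norm_nonneg)
    then show ?thesis
      by (simp add: euclidean_size_eisenstein_def eis_norm_mult nat_mono)
  qed
  have norm_unit: "normalize x = 1" if "x dvd 1" for x :: eisenstein
    using that by (simp add: normalize_eisenstein_def)
  have div1: "x div 1 = x" for x :: eisenstein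
    using eis_mult_div[of 1 x] by simp
  have uf: "unit_factor x * normalize x = x" for x :: eisenstein
  proof (cases "normalize x = 0")
    case True
    then show ?thesis
      using eis_unit_factor_normalize[of x] by auto
  next
    case False
    obtain u where u: "x = u * normalize x"
      using eis_unit_factor_normalize by blast
    then have "unit_factor x = u"
      unfolding unit_factor_eisenstein_def using eis_mult_div[OF False, of u] by simp
    then show ?thesis
      using u by simp
  qed
  show "unit_factor a * normalize a = a"
    by (rule uf)
  show norm0: "normalize (0 :: eisenstein) = 0"
    using eis_unit_factor_normalize[of 0] by auto
  show "unit_factor (0 :: eisenstein) = 0"
    by (simp add: unit_factor_eisenstein_def norm0 divide_eisenstein_def)
  show "a dvd 1 \<Longrightarrow> unit_factor a = a"
    by (simp add: unit_factor_eisenstein_def norm_unit div1)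
  show "unit_factor a dvd 1" if "a \<noteq> 0"
  proof -
    obtain u where u: "u dvd 1" "a = u * normalize a"
      using eis_unit_factor_normalize by blast
    then have "unit_factor a = u"
      unfolding unit_factor_eisenstein_def using that eis_mult_div[of "normalize a" u] by (cases "normalize a = 0") simp_all
    then show ?thesis
      using u by simp
  qed
  show "unit_factor (a * b) = a * unit_factor b" if a: "a dvd 1"
  proof (cases "b = 0")
    case True
    then show ?thesis
      by (simp add: unit_factor_eisenstein_def norm0 divide_eisenstein_def)
  next
    case False
    then have "normalize b \<noteq> 0"
      using uf[of b] by auto
    moreover have "a * b = (a * unit_factor b) * normalize b"
      using uf[of b] by (simp add: mult.assoc)
    ultimately show ?thesis
      unfolding unit_factor_eisenstein_def[of "a * b"] eis_normalize_unit_mult[OF a]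
      by (metis eis_mult_div)
  qed
qed

end

instance eisenstein :: normalization_euclidean_semiring ..

section \<open>The cubic residue symbol\<close>

text \<open>Only meaningful when the prime \<open>\<pi>\<close> does not divide 3; then \<open>N\<pi> \<equiv> 1 (mod 3)\<close>.\<close>

definition cubic_residue_prime :: "eisenstein \<Rightarrow> eisenstein \<Rightarrow> eisenstein" where
  "cubic_residue_prime \<alpha> \<pi> = (THE s. s \<in> {0, 1, eis_omega, eis_omega\<^sup>2} \<and>
     \<pi> dvd \<alpha> ^ (nat (eis_norm \<pi> - 1) div 3) - s)"

lemma cubic_residue_prime_unique:
  assumes "\<not> \<pi> dvd 3" "s \<in> {0, 1, eis_omega, eis_omega\<^sup>2}" "t \<in> {0, 1, eis_omega, eis_omega\<^sup>2}"
    and "\<pi> dvd z - s" "\<pi> dvd z - t"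
  shows "s = t"
proof (rule ccontr)
  assume "s \<noteq> t"
  then have "eis_norm (s - t) \<in> {1, 3}"
    using assms(2,3) by (auto simp: eis_norm_def eis_omega_def power2_eq_square)
  moreover have "s - t dvd of_int (eis_norm (s - t))"
    by (subst eis_mult_cnj[symmetric]) simp
  ultimately have "s - t dvd 3"
    using dvd_trans[of "s - t" 1 3] by auto
  moreover have "\<pi> dvd s - t"
    using dvd_diff[OF assms(5,4)] by simp
  ultimately show False
    using assms(1) dvd_trans by blast
qed

definition cubic_residue_symbol :: "eisenstein \<Rightarrow> eisenstein \<Rightarrow> eisenstein" where
  "cubic_residue_symbol \<alpha> n = (\<Prod>\<pi>\<in>#prime_factorization n. cubic_residue_prime \<alpha> \<pi>)"

section \<open>The set S and the number C\<close>

definition quadratic_ring_of_integers :: "int \<Rightarrow> real set" where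
  "quadratic_ring_of_integers D =
     {z. algebraic_int z \<and> (\<exists>r\<in>\<rat>. \<exists>s\<in>\<rat>. z = r + s * sqrt (of_int D))}"

definition quad_norm :: "int \<Rightarrow> int \<Rightarrow> int \<Rightarrow> int" where
  "quad_norm D A B = A\<^sup>2 - B\<^sup>2 * D"

text \<open>The element \<open>u = A + B \<surd>D\<close> is represented by the pair \<open>(A, B)\<close>.\<close>

definition S_set :: "int \<Rightarrow> (int \<times> int) set" where
  "S_set D = {(A, B).
     (\<exists>m::int. quad_norm D A B = m ^ 3) \<and>
     \<not> (\<exists>v\<in>quadratic_ring_of_integers D. of_int A + of_int B * sqrt (of_int D) = v ^ 3) \<and>
     \<not> (\<exists>q::int. prime q \<and> q ^ 3 dvd gcd A B)}"

definition C_of :: "int \<Rightarrow> int \<Rightarrow> int \<Rightarrow> int" where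
  "C_of D A B = \<Prod>{q::int. prime q \<and> odd q \<and> q dvd gcd A B \<and> \<not> q dvd D}"

section \<open>Binary quadratic forms\<close>

text \<open>
  The triple \<open>(a, b, c)\<close> stands for the form \<open>[a, 2b, c]\<close>. The set consists of the forms
  whose proper equivalence classes make up the form class group \<open>H(4d)\<close>.
\<close>

definition primitive_forms :: "int \<Rightarrow> (int \<times> int \<times> int) set" where
  "primitive_forms d = {(a, b, c). a > 0 \<and> gcd a (gcd (2 * b) c) = 1 \<and> b\<^sup>2 - a * c = d}"

end

theory Submission
  imports Defs "HOL-Number_Theory.Residue_Primitive_Roots"
begin

text \<open>
  Write \<open>\<theta> = 1 + 2\<omega>\<close>, \<open>X = ax + by\<close>, \<open>\<beta> = B/C\<close>, \<open>n = ap = X\<^sup>2 + 27C\<^sup>2Dy\<^sup>2\<close> and \<open>\<tau> = 9Ay - \<beta>X\<theta>\<close>.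
  For a prime \<open>\<pi>\<close> above \<open>p\<close> and a suitable choice of \<open>\<surd>D\<close> modulo \<open>p\<close>, \<open>\<tau> \<equiv> 9yu\<close> modulo \<open>\<pi>\<close>, and
  since \<open>N(u)\<close> is a cube, \<open>(\<tau>/p)\<close> is the square of \<open>(u/\<pi>)\<close>. As \<open>\<tau> \<equiv> y(9A - \<beta>b\<theta>)\<close> modulo \<open>a\<close>, the claim
  becomes \<open>(\<tau>/n) = 1\<close>. Writing \<open>N(u) = m\<^sup>3\<close>, we have \<open>N(\<tau>) = 81y\<^sup>2m\<^sup>3 + 3\<beta>\<^sup>2n\<close>, so modulo \<open>\<tau>\<close> the integer \<open>n\<close>
  agrees with \<open>y\<^sup>2\<beta>\<close> up to cubes. By cubic reciprocity with a rational modulus \<open>(\<tau>/n)\<close> is thus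
  expressed by \<open>(\<tau>/y)\<close> and \<open>(\<tau>/\<beta>)\<close>, which are trivial because every prime dividing \<open>y\<close> or \<open>\<beta>\<close> divides
  one of the two coordinates of \<open>\<tau>\<close> once common factors are removed; the prime 3 is handled by the
  supplementary law. Reciprocity is proved with Gauss sums in the group ring \<open>\<int>[\<omega>][\<int>/l]\<close>, and
  the supplementary law for 3 follows from it through the congruence \<open>3h\<omega> \<equiv> -e\<close> modulo \<open>e + 3h\<omega>\<close>.
\<close>

section \<open>Arithmetic of the Eisenstein integers\<close>

text \<open>Dividing B by C is what makes the argument close. If a prime r of \<beta> divided
  neither coordinate of \<tau> after common factors are removed, those coordinates would have equal
  valuation at r. The conditions defining S leave so few valuations of A and B that the factor C, or
  the fact that r does not divide n, refutes this; the prime 2, which never divides C, is excluded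
  by the parity of n. The other obstacle is 3. Reciprocity is applied only to elements prime to 3
  whose \<omega>-coordinate is divisible by 3, whereas \<tau> may contain \<theta> or need a factor
  \<omega>^s, and the powers of 3 in y and \<beta> bring in the symbol of 3. All these powers of
  \<omega> must cancel; 3-adic valuations leave only a few shapes in which cancellation is not
  immediate. Since n, y and \<beta> are rational, only the exchange of an Eisenstein integer with a
  rational integer is needed, never reciprocity between two general primes.\<close>

abbreviation eis_theta :: eisenstein ("\<theta>") where "\<theta> \<equiv> 1 + 2 * eis_omega"

lemma eis_omega_sel [simp]: "eis_fst eis_omega = 0" "eis_snd eis_omega = 1"
  by (simp_all add: eis_omega_def)

lemma eis_of_int_sel [simp]: "eis_fst (of_int k) = k" "eis_snd (of_int k) = 0"
  by (simp_all add: eis_of_int)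

lemma eis_of_nat_sel [simp]: "eis_fst (of_nat k) = int k" "eis_snd (of_nat k) = 0"
  by (simp_all add: eis_of_nat)

lemma eis_numeral_sel [simp]: "eis_fst (numeral k) = numeral k" "eis_snd (numeral k) = 0"
  by (simp_all add: eis_numeral)

lemma eis_omega_square: "eis_omega ^ 2 = - 1 - eis_omega"
  by (simp add: eis_eq_iff power2_eq_square)

lemma eis_omega_cube: "eis_omega ^ 3 = 1"
  by (simp add: eis_eq_iff power3_eq_cube)

lemma eis_theta_square: "\<theta> ^ 2 = - 3"
  by (simp add: eis_eq_iff power2_eq_square)

lemma eis_of_int_add_theta: "of_int e + of_int f * \<theta> = Eis (e + f) (2 * f)"
  by (simp add: eis_eq_iff)

lemma eis_cnj_simps [simp]:
  "eis_cnj 0 = 0" "eis_cnj 1 = 1" "eis_cnj (a + b) = eis_cnj a + eis_cnj b"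
  "eis_cnj (a - b) = eis_cnj a - eis_cnj b" "eis_cnj (- a) = - eis_cnj a"
  "eis_cnj (a * b) = eis_cnj a * eis_cnj b" "eis_cnj (of_int k) = of_int k"
  "eis_cnj (of_nat n) = of_nat n" "eis_cnj (numeral m) = numeral m"
  "eis_cnj (eis_cnj a) = a" "eis_cnj eis_omega = eis_omega ^ 2"
  by (auto simp: eis_eq_iff eis_cnj_def algebra_simps power2_eq_square)

lemma eis_cnj_power [simp]: "eis_cnj (a ^ n) = eis_cnj a ^ n"
  by (induction n) auto

lemma eis_cnj_sum [simp]: "eis_cnj (\<Sum>x\<in>A. f x) = (\<Sum>x\<in>A. eis_cnj (f x))"
  by (induction A rule: infinite_finite_induct) auto

lemma eis_cnj_dvd_iff [simp]: "eis_cnj a dvd eis_cnj b \<longleftrightarrow> a dvd b"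
proof -
  have "eis_cnj a dvd eis_cnj b" if "a dvd b" for a b
    using that by (auto simp: dvd_def)
  from this[of a b] this[of "eis_cnj a" "eis_cnj b"] show ?thesis by auto
qed

lemma eis_norm_1 [simp]: "eis_norm 1 = 1"
  by (simp add: eis_norm_def)

lemma eis_norm_of_int [simp]: "eis_norm (of_int k) = k ^ 2"
  by (simp add: eis_norm_def)

lemma eis_norm_of_nat [simp]: "eis_norm (of_nat k) = int k ^ 2"
  by (simp add: eis_norm_def)

lemma eis_norm_omega [simp]: "eis_norm eis_omega = 1"
  by (simp add: eis_norm_def)

lemma eis_norm_uminus [simp]: "eis_norm (- a) = eis_norm a"
  by (simp add: eis_norm_def)

lemma eis_norm_power: "eis_norm (a ^ n) = eis_norm a ^ n"
  by (induction n) (auto simp: eis_norm_mult)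

lemma eis_norm_dvd: "a dvd b \<Longrightarrow> eis_norm a dvd eis_norm b"
  by (auto simp: eis_norm_mult elim!: dvdE)

lemma eis_unit_iff_norm: "a dvd 1 \<longleftrightarrow> eis_norm a = 1"
proof
  assume "a dvd 1"
  then have "eis_norm a dvd 1"
    using eis_norm_dvd[of a 1] by simp
  then show "eis_norm a = 1"
    using eis_norm_nonneg[of a] by (simp add: zdvd1_eq)
next
  assume "eis_norm a = 1"
  then show "a dvd 1"
    using eis_mult_cnj[of a] by (metis dvd_triv_left of_int_1)
qed

lemma eis_of_int_dvd_iff: "of_int k dvd a \<longleftrightarrow> k dvd eis_fst a \<and> k dvd eis_snd a"
proof
  assume "k dvd eis_fst a \<and> k dvd eis_snd a"
  then obtain x y where "eis_fst a = k * x" "eis_snd a = k * y"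
    by (auto elim!: dvdE)
  then have "a = of_int k * Eis x y"
    by (simp add: eis_eq_iff)
  then show "of_int k dvd a" by simp
qed (auto simp: dvd_def)

lemma eis_of_int_dvd_of_int_iff [simp]:
  "(of_int k :: eisenstein) dvd of_int m \<longleftrightarrow> k dvd m"
  by (simp add: eis_of_int_dvd_iff)

lemma eis_norm_mod_3: "eis_norm a mod 3 = (eis_fst a + eis_snd a) ^ 2 mod 3"
proof -
  have "eis_norm a = (eis_fst a + eis_snd a) ^ 2 - 3 * (eis_fst a * eis_snd a)"
    by (simp add: eis_norm_def power2_eq_square algebra_simps)
  then show ?thesis
    by (simp add: mod_diff_eq[symmetric])
qed

lemma int_square_mod_3: "\<not> 3 dvd (k::int) \<Longrightarrow> k ^ 2 mod 3 = 1"
proof -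
  assume "\<not> 3 dvd k"
  then have "k mod 3 = 1 \<or> k mod 3 = 2" by presburger
  then show ?thesis
    by (auto simp: power2_eq_square mod_mult_eq[of k 3 k, symmetric])
qed

lemma eis_norm_mod_3_cases:
  assumes "\<not> 3 dvd eis_norm a"
  shows "eis_norm a mod 3 = 1"
proof -
  have "\<not> 3 dvd (eis_fst a + eis_snd a)"
  proof
    assume "3 dvd (eis_fst a + eis_snd a)"
    then have "3 dvd (eis_fst a + eis_snd a) ^ 2"
      unfolding power2_eq_square by (rule dvd_mult)
    then show False
      using assms eis_norm_mod_3[of a] by (metis dvd_eq_mod_eq_0)
  qed
  then show ?thesis
    using eis_norm_mod_3[of a] int_square_mod_3 by simp
qed

text \<open>An element prime to 3 is primary here when it is congruent to a rational integer modulo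
  3, that is, when 3 divides its \<omega>-coordinate. The sign is left free because -1 is a cube.
  Modulo 3 the \<omega>-coordinate of the product is \<open>eis_fst a * eis_snd b\<close>, and
  \<open>eis_fst a\<close> is invertible.\<close>

lemma eis_primary_cancel:
  assumes "3 dvd eis_snd (a * b)" "3 dvd eis_snd a" "\<not> 3 dvd eis_norm a"
  shows "3 dvd eis_snd b"
proof -
  have "\<not> 3 dvd eis_fst a"
  proof
    assume "3 dvd eis_fst a"
    then have "3 dvd eis_norm a"
      using assms(2) unfolding eis_norm_def power2_eq_square by (intro dvd_add dvd_diff dvd_mult) auto
    then show False using assms(3) by blast
  qed
  moreover have "eis_fst a * eis_snd b = eis_snd (a * b) - eis_snd a * (eis_fst b - eis_snd b)"
    by (simp add: algebra_simps)
  then have "3 dvd eis_fst a * eis_snd b"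
    using assms(1,2) by (metis dvd_diff dvd_mult2)
  ultimately show ?thesis by (simp add: prime_dvd_mult_iff)
qed

text \<open>For a = x + y\<omega> the \<omega>-coordinates of a, a\<omega>, a\<omega>^2 are y, x -
  y, -x; one of them is divisible by 3 as soon as x + y is not.\<close>

lemma ex_unit_primary:
  assumes "\<not> 3 dvd eis_norm a"
  shows "\<exists>u. u dvd 1 \<and> 3 dvd eis_snd (a * u)"
proof -
  have "\<not> 3 dvd eis_fst a + eis_snd a"
  proof
    assume "3 dvd eis_fst a + eis_snd a"
    then have "3 dvd (eis_fst a + eis_snd a) ^ 2" unfolding power2_eq_square by (rule dvd_mult)
    then show False using assms eis_norm_mod_3[of a] by (metis dvd_eq_mod_eq_0)
  qed
  then have "3 dvd eis_snd a \<or> 3 dvd eis_fst a - eis_snd a \<or> 3 dvd - eis_fst a" by presburger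
  moreover have "eis_snd (a * 1) = eis_snd a" "eis_snd (a * eis_omega) = eis_fst a - eis_snd a"
    "eis_snd (a * eis_omega ^ 2) = - eis_fst a"
    by (simp_all add: eis_omega_square)
  moreover have "(1 :: eisenstein) dvd 1" "eis_omega dvd 1" "eis_omega ^ 2 dvd 1"
    by (simp_all add: eis_unit_iff_norm eis_norm_power)
  ultimately show ?thesis by metis
qed

text \<open>This makes the primary associate unique up to sign: norm 1 bounds the
  \<omega>-coordinate by 1 in absolute value.\<close>

lemma eis_unit_rational:
  assumes "u dvd 1" "3 dvd eis_snd u"
  shows "u = 1 \<or> u = - 1"
proof -
  define a b where "a = eis_fst u" and "b = eis_snd u"
  have ab: "a ^ 2 - a * b + b ^ 2 = 1"
    using assms(1) by (simp add: eis_unit_iff_norm eis_norm_def a_def b_def)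
  have "b ^ 2 \<le> 1"
  proof -
    have "4 * (a ^ 2 - a * b + b ^ 2) = (2 * a - b) ^ 2 + 3 * b ^ 2"
      by (simp add: power2_eq_square algebra_simps)
    then have "4 = (2 * a - b) ^ 2 + 3 * b ^ 2" unfolding ab by simp
    then show ?thesis using zero_le_power2[of "2 * a - b"] by linarith
  qed
  then have "\<bar>b\<bar> \<le> 1" by (simp add: abs_square_le_1)
  then have "b = 0" using assms(2) unfolding b_def by presburger
  with ab have "a = 1 \<or> a = - 1" by (simp add: power2_eq_1_iff)
  then show ?thesis using \<open>b = 0\<close> by (auto simp: eis_eq_iff a_def b_def)
qed

lemma eis_dvd_coprime_int_unit:
  assumes "\<pi> dvd of_int a" "\<pi> dvd of_int b" "coprime a b"
  shows "\<pi> dvd (1 :: eisenstein)"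
proof -
  obtain u v where "u * a + v * b = 1"
    using assms(3) by (metis bezout_int coprime_iff_gcd_eq_1)
  then have "(1 :: eisenstein) = of_int u * of_int a + of_int v * of_int b"
    by (metis of_int_1 of_int_add of_int_mult)
  then show ?thesis
    using assms(1,2) by (metis dvd_add dvd_mult)
qed

section \<open>Split and inert rational primes\<close>

lemma eis_prime_dvd_not_coprime:
  assumes "prime_elem \<pi>" "\<pi> dvd of_int a" "\<pi> dvd (of_int b :: eisenstein)"
  shows "\<not> coprime a b"
  using eis_dvd_coprime_int_unit assms prime_elem_not_unit by blast

lemma eis_prime_dvd_prime:
  fixes \<pi> :: eisenstein
  assumes "prime_elem \<pi>" "\<pi> dvd of_nat n" "n > 0"
  shows "\<exists>q. prime q \<and> q dvd n \<and> \<pi> dvd of_nat q"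
  using assms(2,3)
proof (induction n rule: less_induct)
  case (less n)
  have "n \<noteq> 1"
    using less assms(1) prime_elem_not_unit by auto
  then obtain q where q: "prime q" "q dvd n"
    using prime_factor_nat by blast
  then obtain m where m: "n = q * m" by auto
  then have "m < n" "m > 0"
    using less.prems(2) q prime_gt_1_nat[of q] by auto
  moreover have "\<pi> dvd of_nat q \<or> \<pi> dvd of_nat m"
    using assms(1) less.prems(1) unfolding m by (simp add: prime_elem_dvd_mult_iff)
  ultimately show ?case
    using q m less.IH by (metis dvd_mult)
qed

lemma eis_prime_over:
  fixes \<pi> :: eisenstein
  assumes "prime_elem \<pi>"
  obtains q where "prime q" "\<pi> dvd of_nat q" "int q dvd eis_norm \<pi>"
proof -
  have "\<pi> \<noteq> 0" using assms by auto
  then have pos: "eis_norm \<pi> > 0" by (rule eis_norm_pos)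
  have "\<pi> dvd of_nat (nat (eis_norm \<pi>))"
    using pos eis_mult_cnj[of \<pi>] by (metis dvd_triv_left int_nat_eq of_int_of_nat_eq order.strict_implies_order)
  from eis_prime_dvd_prime[OF assms this] pos show ?thesis
    using that by (metis int_dvd_int_iff int_nat_eq nat_0_less_mult_iff order.strict_implies_order zero_less_nat_eq)
qed

lemma ex_cube_root_of_unity_mod:
  assumes "prime q" "[q = 1] (mod 3)"
  obtains z :: int where "int q dvd z ^ 2 + z + 1"
proof -
  obtain g where g: "residue_primroot q g"
    using prime_primitive_root_exists assms(1) prime_gt_1_nat by blast
  have o: "ord q g = q - 1" "coprime q g"
    using g assms(1) by (auto simp: residue_primroot_def totient_prime)
  have "q mod 3 = 1" using assms(2) by (simp add: cong_def)
  define k where "k = (q - 1) div 3"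
  have k: "q - 1 = 3 * k" "k > 0"
    using \<open>q mod 3 = 1\<close> prime_gt_1_nat[OF assms(1)] unfolding k_def by presburger+
  \<comment> \<open>The primitive root raised to (q - 1)/3 is a nontrivial cube root of unity modulo
    q.\<close>
  define h where "h = int g ^ k"
  have "[g ^ (3 * k) = 1] (mod q)"
    using o(1) k(1) ord by metis
  then have "[h ^ 3 = 1] (mod int q)"
    unfolding h_def by (metis cong_int_iff mult.commute of_nat_1 of_nat_power power_mult)
  then have "int q dvd (h - 1) * (h ^ 2 + h + 1)"
    by (simp add: cong_iff_dvd_diff power2_eq_square power3_eq_cube algebra_simps)
  moreover have "\<not> int q dvd h - 1"
  proof
    assume "int q dvd h - 1"
    then have "[g ^ k = 1] (mod q)"
      unfolding h_def by (metis cong_iff_dvd_diff cong_int_iff of_nat_1 of_nat_power)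
    then have "ord q g dvd k"
      using ord_divides by blast
    then show False
      using k o(1) by (auto dest!: dvd_imp_le)
  qed
  ultimately have "int q dvd h ^ 2 + h + 1"
    using assms(1) by (simp add: prime_dvd_mult_iff)
  then show ?thesis using that by blast
qed

lemma prime_nat_3: "prime (3 :: nat)" by simp

lemma prime_coprime_3:
  assumes "prime (q :: nat)" "q mod 3 \<noteq> 0"
  shows "coprime 3 (int q)"
proof -
  have "coprime 3 q"
    using prime_nat_3 assms(2) by (intro prime_imp_coprime) (auto simp: dvd_eq_mod_eq_0)
  then show ?thesis
    by (metis coprime_int_iff of_nat_numeral)
qed

lemma eis_prime_factor_not_dvd_3:
  assumes "prime_elem \<pi>" "\<pi> dvd n" "\<not> 3 dvd eis_norm n"
  shows "\<not> \<pi> dvd 3"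
proof
  assume p3: "\<pi> dvd 3"
  obtain q where q: "prime q" "\<pi> dvd of_nat q" "int q dvd eis_norm \<pi>"
    using eis_prime_over[OF assms(1)] by blast
  have "\<not> coprime 3 (int q)"
    using eis_prime_dvd_not_coprime[OF assms(1), of 3 "int q"] p3 q(2) by simp
  then have "q mod 3 = 0" using prime_coprime_3[OF q(1)] by blast
  then have "3 dvd int q" by presburger
  then have "3 dvd eis_norm \<pi>" using q(3) dvd_trans by blast
  then show False using assms(3) eis_norm_dvd[OF assms(2)] dvd_trans by blast
qed

lemma eis_root_factor: "of_int (z ^ 2 + z + 1) = (of_int z - eis_omega) * (of_int z - eis_omega ^ 2)"
  by (simp add: eis_eq_iff power2_eq_square algebra_simps)

text \<open>For a root z of z^2 + z + 1 modulo q, q divides (z - \<omega>)(z - \<omega>^2) but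
  neither factor, because their \<omega>-coordinates are -1 and 1.\<close>

lemma eis_split_not_prime:
  assumes "prime q" "[q = 1] (mod 3)"
  shows "\<not> prime_elem (of_nat q :: eisenstein)"
proof
  assume *: "prime_elem (of_nat q :: eisenstein)"
  obtain z where z: "int q dvd z ^ 2 + z + 1"
    using ex_cube_root_of_unity_mod assms by blast
  have q: "(of_nat q :: eisenstein) = of_int (int q)" by simp
  have "(of_int (int q) :: eisenstein) dvd of_int (z ^ 2 + z + 1)"
    using z by (simp only: eis_of_int_dvd_of_int_iff)
  then have "of_int (int q) dvd (of_int z - eis_omega) \<or> of_int (int q) dvd (of_int z - eis_omega ^ 2)"
    unfolding eis_root_factor using * by (simp add: prime_elem_dvd_mult_iff)
  then have "int q dvd 1"
    unfolding eis_of_int_dvd_iff by (auto simp: power2_eq_square)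
  then show False
    using prime_gt_1_nat[OF assms(1)] by simp
qed

lemma prime_elem_mult_unit:
  fixes a b :: eisenstein
  assumes "prime_elem a" "b dvd 1"
  shows "prime_elem (a * b)"
proof -
  have "b \<noteq> 0" using assms(2) by auto
  then show ?thesis
    using assms by (auto simp: prime_elem_def mult_unit_dvd_iff is_unit_mult_iff)
qed

text \<open>From q = \<pi>u the norm of \<pi> is q or q^2. A norm prime to 3 is 1 modulo 3, which
  settles the first case; in the second u is a unit, so q itself is prime and
  \<open>eis_split_not_prime\<close> rules out q = 1 modulo 3.\<close>

lemma eis_prime_cases:
  assumes "prime_elem \<pi>" "\<not> \<pi> dvd 3"
  obtains (split) q where "prime q" "[q = 1] (mod 3)" "eis_norm \<pi> = int q" "\<pi> dvd of_nat q"
  | (inert) q u where "prime q" "q mod 3 = 2" "eis_norm \<pi> = int q ^ 2" "of_nat q = \<pi> * u" "u dvd 1"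
proof -
  obtain q where q: "prime q" "\<pi> dvd of_nat q" "int q dvd eis_norm \<pi>"
    using eis_prime_over[OF assms(1)] by blast
  have q3: "q \<noteq> 3" using assms(2) q(2) by auto
  have nq3: "\<not> 3 dvd q"
    using q3 q(1) prime_nat_3 primes_dvd_imp_eq by blast
  obtain u where u: "of_nat q = \<pi> * u" using q(2) by auto
  then have nn: "eis_norm \<pi> * eis_norm u = int q ^ 2"
    by (metis eis_norm_mult eis_norm_of_nat)
  obtain m where m: "eis_norm \<pi> = int q * m" using q(3) by auto
  have q0: "int q > 0" using q(1) prime_gt_0_nat by simp
  have mn: "m * eis_norm u = int q"
    using nn q0 unfolding m by (simp add: power2_eq_square)
  then have "m dvd int q" by (metis dvd_triv_left)
  moreover have "m > 0"
    using m q0 eis_norm_pos[of \<pi>] assms(1) by (metis prime_elem_not_zeroI zero_less_mult_pos prime_elem_def)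
  ultimately have "m = 1 \<or> m = int q"
    using q(1) by (metis int_dvd_int_iff of_nat_1 pos_int_cases prime_nat_iff)
  then show ?thesis
  proof
    assume m1: "m = 1"
    have "int q mod 3 = 1"
      using eis_norm_mod_3_cases[of \<pi>] nq3 m m1 by (simp add: int_dvd_int_iff[of 3, simplified])
    then have "[q = 1] (mod 3)"
      unfolding cong_def by presburger
    then show ?thesis using split q(1,2) m m1 by simp
  next
    assume mq: "m = int q"
    then have "eis_norm u = 1" using mn q0 by simp
    then have un: "u dvd 1" by (simp add: eis_unit_iff_norm)
    then have "prime_elem (of_nat q :: eisenstein)"
      unfolding u by (rule prime_elem_mult_unit[OF assms(1)])
    then have "\<not> [q = 1] (mod 3)" using eis_split_not_prime q(1) by blast
    then have "q mod 3 = 2" using nq3 unfolding cong_def by presburger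
    then show ?thesis using inert[of q u] q(1) m mq u un by (simp add: power2_eq_square)
  qed
qed

lemma eis_inert_prime:
  assumes "prime q" "q mod 3 = 2"
  shows "prime_elem (of_nat q :: eisenstein)"
proof -
  have q1: "q > 1" using assms(1) prime_gt_1_nat by simp
  have "\<not> (of_nat q :: eisenstein) dvd 1"
    using q1 by (simp add: eis_unit_iff_norm power2_eq_1_iff)
  moreover have "(of_nat q :: eisenstein) \<noteq> 0"
    using q1 by (simp add: eis_eq_iff)
  ultimately obtain \<pi> :: eisenstein where p: "prime \<pi>" "\<pi> dvd of_nat q"
    using prime_divisor_exists by blast
  have nd: "\<not> \<pi> dvd 3"
  proof
    assume "\<pi> dvd 3"
    then have "\<not> coprime 3 (int q)"
      using eis_prime_dvd_not_coprime[of \<pi> 3 "int q"] p by simp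
    moreover have "coprime 3 (int q)"
      using assms prime_coprime_3 by simp
    ultimately show False by blast
  qed
  from p(1) have pe: "prime_elem \<pi>" by simp
  from pe nd show ?thesis
  proof (cases rule: eis_prime_cases)
    case (split r)
    have "\<not> coprime (int r) (int q)"
      using eis_prime_dvd_not_coprime[OF pe, of "int r" "int q"] split p by simp
    then have "r = q" using split(1) assms(1) primes_coprime by (metis coprime_int_iff)
    then show ?thesis using split assms by (simp add: cong_def)
  next
    case (inert r u)
    have "\<pi> dvd of_nat r" using inert by simp
    then have "\<not> coprime (int r) (int q)"
      using eis_prime_dvd_not_coprime[OF pe, of "int r" "int q"] inert p by simp
    then have "r = q" using inert(1) assms(1) primes_coprime by (metis coprime_int_iff)
    then have "of_nat q = \<pi> * u" using inert by simp
    then show ?thesis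
      using pe inert(5) by (simp add: prime_elem_mult_unit)
  qed
qed

lemma eis_ex_split_prime:
  assumes "prime q" "[q = 1] (mod 3)"
  obtains \<pi> where "prime_elem \<pi>" "eis_norm \<pi> = int q" "\<pi> * eis_cnj \<pi> = of_nat q" "\<not> \<pi> dvd 3"
proof -
  have q1: "q > 1" using assms(1) prime_gt_1_nat by simp
  have "\<not> (of_nat q :: eisenstein) dvd 1"
    using q1 by (simp add: eis_unit_iff_norm power2_eq_1_iff)
  moreover have "(of_nat q :: eisenstein) \<noteq> 0"
    using q1 by (simp add: eis_eq_iff)
  ultimately obtain \<pi> :: eisenstein where p: "prime \<pi>" "\<pi> dvd of_nat q"
    using prime_divisor_exists by blast
  have q3: "q mod 3 = 1" using assms(2) by (simp add: cong_def)
  have nd: "\<not> \<pi> dvd 3"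
  proof
    assume "\<pi> dvd 3"
    then have "\<not> coprime 3 (int q)"
      using eis_prime_dvd_not_coprime[of \<pi> 3 "int q"] p by simp
    moreover have "coprime 3 (int q)"
      using assms(1) q3 prime_coprime_3 by simp
    ultimately show False by blast
  qed
  from p(1) have pe: "prime_elem \<pi>" by simp
  from pe nd have "eis_norm \<pi> = int q"
  proof (cases rule: eis_prime_cases)
    case (split r)
    have "\<not> coprime (int r) (int q)"
      using eis_prime_dvd_not_coprime[OF pe, of "int r" "int q"] split p by simp
    then have "r = q" using split(1) assms(1) primes_coprime by (metis coprime_int_iff)
    then show ?thesis using split by simp
  next
    case (inert r u)
    have "\<pi> dvd of_nat r" using inert by simp
    then have "\<not> coprime (int r) (int q)"
      using eis_prime_dvd_not_coprime[OF pe, of "int r" "int q"] inert p by simp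
    then have "r = q" using inert(1) assms(1) primes_coprime by (metis coprime_int_iff)
    then show ?thesis using inert(2) q3 by simp
  qed
  moreover from this have "\<pi> * eis_cnj \<pi> = of_nat q"
    by (simp add: eis_mult_cnj)
  ultimately show ?thesis using that pe nd by blast
qed

text \<open>The residue field of a split prime is the prime field, so \<omega> has a rational
  representative z; then 1 + 2z is a square root of -3, from which the square root of D modulo p is
  built at the end.\<close>

lemma eis_split_omega:
  assumes "prime_elem \<pi>" "prime q" "[q = 1] (mod 3)" "\<pi> dvd of_nat q"
  obtains z where "\<pi> dvd eis_omega - of_int z"
proof -
  obtain z where z: "int q dvd z ^ 2 + z + 1"
    using ex_cube_root_of_unity_mod assms(2,3) by blast
  then have "(of_int (int q) :: eisenstein) dvd of_int (z ^ 2 + z + 1)"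
    by (simp only: eis_of_int_dvd_of_int_iff)
  then have "\<pi> dvd (of_int z - eis_omega) * (of_int z - eis_omega ^ 2)"
    unfolding eis_root_factor using assms(4) dvd_trans by fastforce
  then have "\<pi> dvd of_int z - eis_omega \<or> \<pi> dvd of_int z - eis_omega ^ 2"
    using assms(1) by (simp add: prime_elem_dvd_mult_iff)
  moreover have "of_int z - eis_omega = - (eis_omega - of_int z)"
    "of_int z - eis_omega ^ 2 = eis_omega - of_int (- z - 1)"
    by (simp_all add: eis_omega_square)
  ultimately show ?thesis
    using that dvd_minus_iff by metis
qed

section \<open>The cubic residue symbol\<close>

text \<open>Integer exponents, read modulo 3, so that exponents can be subtracted and compared by
  congruences.\<close>

definition omega_pow :: "int \<Rightarrow> eisenstein" where
  "omega_pow k = eis_omega ^ nat (k mod 3)"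

lemma omega_power_cong: "m mod 3 = n mod 3 \<Longrightarrow> eis_omega ^ m = eis_omega ^ n"
proof -
  have "eis_omega ^ m = eis_omega ^ (m mod 3)" for m
  proof -
    have "eis_omega ^ m = (eis_omega ^ 3) ^ (m div 3) * eis_omega ^ (m mod 3)"
      by (metis mult_div_mod_eq power_add power_mult)
    then show ?thesis by (simp add: eis_omega_cube)
  qed
  then show "m mod 3 = n mod 3 \<Longrightarrow> eis_omega ^ m = eis_omega ^ n"
    by metis
qed

lemma omega_pow_of_nat: "omega_pow (int n) = eis_omega ^ n"
  unfolding omega_pow_def by (rule omega_power_cong) (simp add: nat_mod_distrib)

lemma omega_pow_cong: "[a = b] (mod 3) \<Longrightarrow> omega_pow a = omega_pow b"
  by (simp add: omega_pow_def cong_def)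

lemma omega_pow_0 [simp]: "omega_pow 0 = 1"
  by (simp add: omega_pow_def)

lemma omega_pow_add: "omega_pow (a + b) = omega_pow a * omega_pow b"
proof -
  have "(nat (a mod 3) + nat (b mod 3)) mod 3 = nat ((a mod 3 + b mod 3) mod 3)"
    by (simp add: nat_add_distrib[symmetric] nat_mod_distrib)
  also have "\<dots> = nat ((a + b) mod 3) mod 3"
    by (simp add: mod_add_eq nat_mod_distrib)
  finally show ?thesis
    unfolding omega_pow_def power_add[symmetric] by (intro omega_power_cong) simp
qed

definition cube_units :: "eisenstein set" where
  "cube_units = {1, eis_omega, eis_omega ^ 2}"

lemma omega_pow_in [simp]: "omega_pow a \<in> cube_units"
proof -
  have "a mod 3 = 0 \<or> a mod 3 = 1 \<or> a mod 3 = 2" by presburger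
  then show ?thesis by (auto simp: omega_pow_def cube_units_def)
qed

lemma cube_units_1 [simp]: "1 \<in> cube_units"
  by (simp add: cube_units_def)

lemma cube_units_mult [simp]: "a \<in> cube_units \<Longrightarrow> b \<in> cube_units \<Longrightarrow> a * b \<in> cube_units"
  unfolding cube_units_def by (auto simp: eis_eq_iff power2_eq_square)

lemma cube_units_power [simp]: "a \<in> cube_units \<Longrightarrow> a ^ n \<in> cube_units"
  by (induction n) auto

lemma cube_units_cube: "a \<in> cube_units \<Longrightarrow> a ^ 3 = 1"
  unfolding cube_units_def by (auto simp: eis_eq_iff power2_eq_square power3_eq_cube)

lemma cube_units_mult_cnj: "a \<in> cube_units \<Longrightarrow> a * eis_cnj a = 1"
  unfolding cube_units_def by (elim insertE emptyE) (simp_all add: eis_eq_iff eis_cnj_def power2_eq_square)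

lemma cube_units_cnj: "a \<in> cube_units \<Longrightarrow> eis_cnj a = a ^ 2"
  unfolding cube_units_def by (elim insertE emptyE) (simp_all add: eis_eq_iff eis_cnj_def power2_eq_square)

lemma cube_units_cnj_in [simp]: "a \<in> cube_units \<Longrightarrow> eis_cnj a \<in> cube_units"
  by (simp add: cube_units_cnj)

lemma cube_units_nonzero: "a \<in> cube_units \<Longrightarrow> a \<noteq> 0"
  unfolding cube_units_def by (auto simp: eis_eq_iff power2_eq_square)

lemma cube_units_square_eq_1_iff: "a \<in> cube_units \<Longrightarrow> a ^ 2 = 1 \<longleftrightarrow> a = 1"
  unfolding cube_units_def by (elim insertE emptyE) (simp_all add: eis_eq_iff power2_eq_square)

lemma cube_units_mult_eq_1_iff: "a \<in> cube_units \<Longrightarrow> b \<in> cube_units \<Longrightarrow> a * b = 1 \<longleftrightarrow> b = a ^ 2"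
  unfolding cube_units_def by (elim insertE emptyE) (simp_all add: eis_eq_iff power2_eq_square)

section \<open>Congruences as divisibility of differences, and Frobenius\<close>

lemma dvd_mult_diff:
  fixes n :: "'a :: comm_ring_1"
  assumes "n dvd a - b" "n dvd c - d"
  shows "n dvd a * c - b * d"
proof -
  have "a * c - b * d = (a - b) * c + b * (c - d)" by (simp add: algebra_simps)
  then show ?thesis using assms by simp
qed

lemma dvd_power_diff:
  fixes n :: "'a :: comm_ring_1"
  assumes "n dvd a - b"
  shows "n dvd a ^ k - b ^ k"
  by (induction k) (auto intro: dvd_mult_diff assms)

lemma dvd_diff_trans:
  fixes n :: "'a :: comm_ring_1"
  assumes "n dvd a - b" "n dvd b - c"
  shows "n dvd a - c"
  using dvd_add[OF assms] by simp

lemma dvd_diff_sym: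
  fixes n :: "'a :: comm_ring_1"
  assumes "n dvd a - b"
  shows "n dvd b - a"
  using assms by (metis dvd_minus_iff minus_diff_eq)

lemma dvd_diff_imp_dvd:
  fixes n :: "'a :: comm_ring_1"
  assumes "n dvd a - b" "n dvd a"
  shows "n dvd b"
  using dvd_diff[OF assms(2,1)] by simp

lemma dvd_add_power_prime:
  fixes x y :: "'a :: comm_ring_1"
  assumes "prime q"
  shows "of_nat q dvd (x + y) ^ q - (x ^ q + y ^ q)"
proof -
  have q: "q \<ge> 1" using assms prime_ge_1_nat by simp
  have "(x + y) ^ q = (\<Sum>k\<le>q. of_nat (q choose k) * x ^ k * y ^ (q - k))"
    by (rule binomial_ring)
  also have "{..q} = insert 0 (insert q {1..<q})" using q by auto
  also have "(\<Sum>k\<in>\<dots>. of_nat (q choose k) * x ^ k * y ^ (q - k)) =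
      y ^ q + (x ^ q + (\<Sum>k=1..<q. of_nat (q choose k) * x ^ k * y ^ (q - k)))"
    using q by (subst sum.insert) auto
  finally have "(x + y) ^ q - (x ^ q + y ^ q) = (\<Sum>k=1..<q. of_nat (q choose k) * x ^ k * y ^ (q - k))"
    by (simp add: algebra_simps)
  also have "of_nat q dvd \<dots>"
  proof (rule dvd_sum)
    fix k assume "k \<in> {1..<q}"
    then have "q dvd (q choose k)"
      using assms by (intro dvd_choose_prime) auto
    then show "of_nat q dvd (of_nat (q choose k) * x ^ k * y ^ (q - k) :: 'a)"
      by (auto elim!: dvdE)
  qed
  finally show ?thesis .
qed

lemma dvd_sum_power_prime:
  fixes f :: "'b \<Rightarrow> 'a :: comm_ring_1"
  assumes "prime q"
  shows "of_nat q dvd (\<Sum>i\<in>A. f i) ^ q - (\<Sum>i\<in>A. f i ^ q)"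
proof (induction A rule: infinite_finite_induct)
  case (insert i A)
  have "of_nat q dvd (f i + sum f A) ^ q - (f i ^ q + sum f A ^ q)"
    by (rule dvd_add_power_prime[OF assms])
  moreover have "of_nat q dvd (f i ^ q + sum f A ^ q) - (f i ^ q + (\<Sum>i\<in>A. f i ^ q))"
    using insert by simp
  ultimately show ?case
    using insert by (simp add: dvd_diff_trans)
qed (use assms prime_gt_0_nat in \<open>auto simp: zero_power\<close>)

lemma int_fermat_little:
  assumes "prime q"
  shows "int q dvd a ^ q - a"
proof -
  have *: "int q dvd int n ^ q - int n" for n
  proof (cases "q dvd n")
    case True
    then show ?thesis
      using assms prime_gt_0_nat[of q]
      by (auto intro!: dvd_diff simp: dvd_power_iff_le elim!: dvdE simp: power_mult_distrib)
  next
    case False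
    then have "[n ^ (q - 1) = 1] (mod q)"
      using fermat_theorem assms by blast
    then have "[n ^ (q - 1) * n = 1 * n] (mod q)"
      by (rule cong_scalar_right)
    then have "[n ^ q = n] (mod q)"
      using assms prime_gt_0_nat[of q] by (simp add: power_eq_if mult.commute)
    then show ?thesis
      by (metis cong_iff_dvd_diff cong_int_iff of_nat_power)
  qed
  have "int q > 0" using assms prime_gt_0_nat by simp
  define n where "n = nat (a mod int q)"
  have n: "int n = a mod int q" using \<open>int q > 0\<close> unfolding n_def by simp
  have d: "int q dvd a - int n" unfolding n by (metis dvd_minus_mod)
  have "int q dvd a ^ q - int n ^ q" using d by (rule dvd_power_diff)
  from dvd_diff_trans[OF dvd_diff_trans[OF this *] dvd_diff_sym[OF d]] show ?thesis .
qed

text \<open>Frobenius modulo q fixes the rational coordinates and acts only on \<omega>: as the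
  identity for q = 1 modulo 3, as conjugation for q = 2 modulo 3.\<close>

lemma eis_frobenius:
  assumes "prime q"
  shows "of_nat q dvd a ^ q - (of_int (eis_fst a) + of_int (eis_snd a) * eis_omega ^ q)"
proof -
  have a: "a = of_int (eis_fst a) + of_int (eis_snd a) * eis_omega" by (simp add: eis_eq_iff)
  define x y where "x = eis_fst a" and "y = eis_snd a"
  have i: "of_nat q dvd (of_int b ^ q - of_int b :: eisenstein)" for b
    using int_fermat_little[OF assms, of b]
    by (metis eis_of_int_dvd_of_int_iff of_int_diff of_int_of_nat_eq of_int_power)
  have "of_nat q dvd (of_int x + of_int y * eis_omega) ^ q - (of_int x ^ q + (of_int y * eis_omega) ^ q)"
    by (rule dvd_add_power_prime[OF assms])
  moreover have "of_nat q dvd (of_int x ^ q + (of_int y * eis_omega) ^ q) - (of_int x + of_int y * eis_omega ^ q)"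
  proof -
    have "(of_int x ^ q + (of_int y * eis_omega) ^ q) - (of_int x + of_int y * eis_omega ^ q) =
      (of_int x ^ q - of_int x) + (of_int y ^ q - of_int y) * eis_omega ^ q"
      by (simp add: power_mult_distrib algebra_simps)
    then show ?thesis using i by (metis dvd_add dvd_mult2)
  qed
  ultimately show ?thesis
    using a dvd_diff_trans unfolding x_def y_def by metis
qed

lemma eis_fermat:
  assumes "prime_elem \<pi>" "\<not> \<pi> dvd 3"
  shows "\<pi> dvd a ^ nat (eis_norm \<pi>) - a"
  using assms
proof (cases rule: eis_prime_cases)
  case (split q)
  have "q mod 3 = 1 mod 3" using split(2) by (simp add: cong_def)
  then have "eis_omega ^ q = eis_omega ^ 1" by (rule omega_power_cong)
  moreover have "of_int (eis_fst a) + of_int (eis_snd a) * eis_omega = a"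
    by (simp add: eis_eq_iff)
  ultimately have "of_nat q dvd a ^ q - a"
    using eis_frobenius[OF split(1), of a] by simp
  then show ?thesis using split dvd_trans by auto
next
  case (inert q u)
  have "q mod 3 = 2 mod 3" using inert(2) by simp
  then have "eis_omega ^ q = eis_omega ^ 2" by (rule omega_power_cong)
  moreover have "of_int (eis_fst a) + of_int (eis_snd a) * eis_omega ^ 2 = eis_cnj a" for a
    by (simp add: eis_eq_iff eis_cnj_def eis_omega_square)
  ultimately have *: "of_nat q dvd a ^ q - eis_cnj a" for a
    using eis_frobenius[OF inert(1), of a] by simp
  \<comment> \<open>Raising to the power q^2, the norm of \<pi>, is conjugation applied
    twice.\<close>
  have "of_nat q dvd (a ^ q) ^ q - eis_cnj a ^ q"
    by (rule dvd_power_diff[OF *])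
  then have "of_nat q dvd (a ^ q) ^ q - eis_cnj (eis_cnj a)"
    using *[of "eis_cnj a"] by (rule dvd_diff_trans)
  then have "of_nat q dvd (a ^ q) ^ q - a" by simp
  moreover have "nat (eis_norm \<pi>) = q * q"
    unfolding inert(3) by (simp add: power2_eq_square nat_mult_distrib)
  then have "(a ^ q) ^ q = a ^ nat (eis_norm \<pi>)"
    by (simp only: power_mult)
  moreover have "\<pi> dvd of_nat q"
    using inert(4) by simp
  ultimately show ?thesis
    using dvd_trans by metis
qed

lemma eis_prime_norm_mod_3:
  assumes "prime_elem \<pi>" "\<not> \<pi> dvd 3"
  shows "\<not> 3 dvd eis_norm \<pi>" "eis_norm \<pi> mod 3 = 1"
proof -
  show "eis_norm \<pi> mod 3 = 1" using assms
  proof (cases rule: eis_prime_cases)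
    case (split q)
    have "q mod 3 = 1" using split(2) by (simp add: cong_def)
    then have "int q mod 3 = 1" by presburger
    then show ?thesis using split(3) by simp
  next
    case (inert q u)
    have "\<not> 3 dvd int q" using inert(2) by presburger
    then show ?thesis using inert(3) int_square_mod_3 by simp
  qed
  then show "\<not> 3 dvd eis_norm \<pi>" by presburger
qed

section \<open>The symbol at a single prime\<close>

abbreviation crp_exp :: "eisenstein \<Rightarrow> nat" where
  "crp_exp \<pi> \<equiv> nat (eis_norm \<pi> - 1) div 3"

lemma crp_exp_nat:
  assumes "prime_elem \<pi>" "\<not> \<pi> dvd 3"
  shows "eis_norm \<pi> = 3 * int (crp_exp \<pi>) + 1" "crp_exp \<pi> > 0" "nat (eis_norm \<pi>) = 3 * crp_exp \<pi> + 1"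
proof -
  have "eis_norm \<pi> > 1"
    using eis_norm_pos[of \<pi>] eis_unit_iff_norm[of \<pi>] assms by (auto simp: prime_elem_def)
  moreover obtain r where "eis_norm \<pi> = 3 * r + 1"
    using eis_prime_norm_mod_3(2)[OF assms] by (metis mult_div_mod_eq)
  ultimately show "eis_norm \<pi> = 3 * int (crp_exp \<pi>) + 1" "crp_exp \<pi> > 0" "nat (eis_norm \<pi>) = 3 * crp_exp \<pi> + 1"
    by (auto simp: nat_mult_distrib nat_add_distrib)
qed

text \<open>Unless \<pi> divides a, the power b in question satisfies b^3 = 1 modulo \<pi>, and b^3
  - 1 splits into linear factors over the cube roots of unity.\<close>

lemma crp_value_exists:
  assumes "prime_elem \<pi>" "\<not> \<pi> dvd 3"
  shows "\<exists>s \<in> {0, 1, eis_omega, eis_omega ^ 2}. \<pi> dvd a ^ crp_exp \<pi> - s"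
proof (cases "\<pi> dvd a")
  case True
  then have "\<pi> dvd a ^ crp_exp \<pi>"
    using crp_exp_nat(2)[OF assms] by (metis dvd_power dvd_trans dvd_power_same power_one_right dvd_def Suc_pred power_Suc dvd_mult2)
  then show ?thesis by auto
next
  case False
  define b where "b = a ^ crp_exp \<pi>"
  have "b ^ 3 * a = a ^ nat (eis_norm \<pi>)"
    unfolding b_def crp_exp_nat(3)[OF assms] by (simp add: power_mult[symmetric] mult.commute)
  then have "\<pi> dvd b ^ 3 * a - a"
    using eis_fermat[OF assms, of a] by simp
  moreover have "b ^ 3 * a - a = ((b - 1) * ((b - eis_omega) * (b - eis_omega ^ 2))) * a"
  proof -
    have "(b - 1) * ((b - eis_omega) * (b - eis_omega ^ 2)) = b ^ 3 - 1"
      by (simp add: eis_eq_iff power3_eq_cube power2_eq_square algebra_simps)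
    then show ?thesis by (simp only: left_diff_distrib mult_1_left)
  qed
  ultimately have "\<pi> dvd (b - 1) \<or> \<pi> dvd (b - eis_omega) \<or> \<pi> dvd (b - eis_omega ^ 2)"
    using assms(1) False by (simp add: prime_elem_dvd_mult_iff)
  then show ?thesis unfolding b_def by auto
qed

lemma crp_props:
  assumes "prime_elem \<pi>" "\<not> \<pi> dvd 3"
  shows "cubic_residue_prime a \<pi> \<in> {0, 1, eis_omega, eis_omega ^ 2}"
    and "\<pi> dvd a ^ crp_exp \<pi> - cubic_residue_prime a \<pi>"
proof -
  have "\<exists>!s. s \<in> {0, 1, eis_omega, eis_omega\<^sup>2} \<and> \<pi> dvd a ^ crp_exp \<pi> - s"
    using crp_value_exists[OF assms, of a] cubic_residue_prime_unique[OF assms(2)] by blast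
  from theI'[OF this] show "cubic_residue_prime a \<pi> \<in> {0, 1, eis_omega, eis_omega ^ 2}"
    "\<pi> dvd a ^ crp_exp \<pi> - cubic_residue_prime a \<pi>"
    unfolding cubic_residue_prime_def by blast+
qed

lemma crp_eqI:
  assumes "prime_elem \<pi>" "\<not> \<pi> dvd 3"
    and "s \<in> {0, 1, eis_omega, eis_omega ^ 2}" "\<pi> dvd a ^ crp_exp \<pi> - s"
  shows "cubic_residue_prime a \<pi> = s"
  using cubic_residue_prime_unique[OF assms(2) crp_props(1)[OF assms(1,2)] assms(3) crp_props(2)[OF assms(1,2)] assms(4)] .

lemma cube_unitsI: "s \<in> {0, 1, eis_omega, eis_omega ^ 2} \<Longrightarrow> s \<noteq> 0 \<Longrightarrow> s \<in> cube_units"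
  by (auto simp: cube_units_def)

lemma cube_units_or_0_iff: "s \<in> {0, 1, eis_omega, eis_omega ^ 2} \<longleftrightarrow> s = 0 \<or> s \<in> cube_units"
  by (auto simp: cube_units_def)

lemma crp_eq_0_iff:
  assumes "prime_elem \<pi>" "\<not> \<pi> dvd 3"
  shows "cubic_residue_prime a \<pi> = 0 \<longleftrightarrow> \<pi> dvd a"
proof
  assume "cubic_residue_prime a \<pi> = 0"
  then have "\<pi> dvd a ^ crp_exp \<pi>" using crp_props(2)[OF assms, of a] by simp
  then show "\<pi> dvd a" using assms(1) prime_elem_dvd_power by blast
next
  assume *: "\<pi> dvd a"
  show "cubic_residue_prime a \<pi> = 0"
    by (rule crp_eqI[OF assms])
       (use * crp_exp_nat(2)[OF assms] in \<open>auto intro: dvd_trans[OF _ dvd_power]\<close>)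
qed

lemma crp_in_cube_units:
  assumes "prime_elem \<pi>" "\<not> \<pi> dvd 3" "\<not> \<pi> dvd a"
  shows "cubic_residue_prime a \<pi> \<in> cube_units"
  using crp_props(1)[OF assms(1,2)] crp_eq_0_iff[OF assms(1,2)] assms(3) cube_unitsI by blast

lemma crp_mult:
  assumes "prime_elem \<pi>" "\<not> \<pi> dvd 3"
  shows "cubic_residue_prime (a * b) \<pi> = cubic_residue_prime a \<pi> * cubic_residue_prime b \<pi>"
proof (rule crp_eqI[OF assms])
  show "cubic_residue_prime a \<pi> * cubic_residue_prime b \<pi> \<in> {0, 1, eis_omega, eis_omega\<^sup>2}"
    using crp_props(1)[OF assms, of a] crp_props(1)[OF assms, of b]
    unfolding cube_units_or_0_iff by auto
  show "\<pi> dvd (a * b) ^ crp_exp \<pi> - cubic_residue_prime a \<pi> * cubic_residue_prime b \<pi>"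
    unfolding power_mult_distrib by (intro dvd_mult_diff crp_props(2)[OF assms])
qed

lemma crp_cong:
  assumes "prime_elem \<pi>" "\<not> \<pi> dvd 3" "\<pi> dvd a - b"
  shows "cubic_residue_prime a \<pi> = cubic_residue_prime b \<pi>"
proof (rule crp_eqI[OF assms(1,2) crp_props(1)[OF assms(1,2)]])
  show "\<pi> dvd a ^ crp_exp \<pi> - cubic_residue_prime b \<pi>"
    by (rule dvd_diff_trans[OF dvd_power_diff[OF assms(3)] crp_props(2)[OF assms(1,2)]])
qed

text \<open>Needed because \<open>prime_factorization\<close> consists of normalized primes, which
  are arbitrary associates of the primes met in practice.\<close>

lemma crp_assoc:
  assumes "\<pi> dvd \<rho>" "\<rho> dvd \<pi>"
  shows "cubic_residue_prime a \<pi> = cubic_residue_prime a \<rho>"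
proof -
  have "eis_norm \<pi> = eis_norm \<rho>"
    by (rule zdvd_antisym_nonneg) (auto intro: eis_norm_nonneg eis_norm_dvd assms)
  moreover have "\<pi> dvd x \<longleftrightarrow> \<rho> dvd x" for x using assms dvd_trans by blast
  ultimately show ?thesis by (simp add: cubic_residue_prime_def)
qed

lemma crp_1 [simp]:
  assumes "prime_elem \<pi>" "\<not> \<pi> dvd 3"
  shows "cubic_residue_prime 1 \<pi> = 1"
  by (rule crp_eqI[OF assms]) auto

lemma prime_elem_cnj: "prime_elem a \<Longrightarrow> prime_elem (eis_cnj a)"
proof -
  assume a: "prime_elem a"
  have "eis_cnj a dvd x * y \<Longrightarrow> eis_cnj a dvd x \<or> eis_cnj a dvd y" for x y
  proof -
    assume "eis_cnj a dvd x * y"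
    then have "a dvd eis_cnj x * eis_cnj y"
      by (metis eis_cnj_dvd_iff eis_cnj_simps(10) eis_cnj_simps(6))
    then show ?thesis
      using a by (metis eis_cnj_dvd_iff eis_cnj_simps(10) prime_elem_dvd_mult_iff)
  qed
  moreover have "eis_cnj a \<noteq> 0" using a by (metis eis_cnj_simps(1) eis_cnj_simps(10) not_prime_elem_zero)
  moreover have "\<not> eis_cnj a dvd 1"
    using a by (simp add: eis_unit_iff_norm eis_norm_cnj prime_elem_def)
  ultimately show ?thesis unfolding prime_elem_def by blast
qed

lemma crp_cnj:
  assumes "prime_elem \<pi>" "\<not> \<pi> dvd 3"
  shows "cubic_residue_prime (eis_cnj a) (eis_cnj \<pi>) = eis_cnj (cubic_residue_prime a \<pi>)"
proof (rule crp_eqI)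
  show "prime_elem (eis_cnj \<pi>)" by (rule prime_elem_cnj[OF assms(1)])
  show "\<not> eis_cnj \<pi> dvd 3" using assms(2) by (metis eis_cnj_dvd_iff eis_cnj_simps(9))
  show "eis_cnj (cubic_residue_prime a \<pi>) \<in> {0, 1, eis_omega, eis_omega\<^sup>2}"
    using crp_props(1)[OF assms, of a] unfolding cube_units_or_0_iff by auto
  have "eis_cnj \<pi> dvd eis_cnj (a ^ crp_exp \<pi> - cubic_residue_prime a \<pi>)"
    unfolding eis_cnj_dvd_iff by (rule crp_props(2)[OF assms])
  then show "eis_cnj \<pi> dvd eis_cnj a ^ crp_exp (eis_cnj \<pi>) - eis_cnj (cubic_residue_prime a \<pi>)"
    by (simp add: eis_norm_cnj)
qed

lemma crp_minus_1 [simp]: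
  assumes "prime_elem \<pi>" "\<not> \<pi> dvd 3"
  shows "cubic_residue_prime (- 1) \<pi> = 1"
proof -
  have "cubic_residue_prime (- 1 * (- 1 * - 1)) \<pi> = cubic_residue_prime (- 1) \<pi> ^ 3"
    unfolding crp_mult[OF assms] by (simp add: power3_eq_cube)
  moreover have "\<not> \<pi> dvd - 1" using assms(1) by (auto simp: prime_elem_def)
  ultimately show ?thesis
    using cube_units_cube[OF crp_in_cube_units[OF assms, of "- 1"]] by simp
qed

lemma crp_omega:
  assumes "prime_elem \<pi>" "\<not> \<pi> dvd 3"
  shows "cubic_residue_prime eis_omega \<pi> = omega_pow ((eis_norm \<pi> - 1) div 3)"
proof (rule crp_eqI[OF assms])
  show "omega_pow ((eis_norm \<pi> - 1) div 3) \<in> {0, 1, eis_omega, eis_omega\<^sup>2}"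
    unfolding cube_units_or_0_iff by simp
  have "(eis_norm \<pi> - 1) div 3 = int (crp_exp \<pi>)"
    using crp_exp_nat(1)[OF assms] by linarith
  then show "\<pi> dvd eis_omega ^ crp_exp \<pi> - omega_pow ((eis_norm \<pi> - 1) div 3)"
    by (simp add: omega_pow_of_nat)
qed

section \<open>The multiplicative symbol\<close>

lemma symbol_mult_right:
  assumes "m \<noteq> 0" "n \<noteq> 0"
  shows "cubic_residue_symbol a (m * n) = cubic_residue_symbol a m * cubic_residue_symbol a n"
  unfolding cubic_residue_symbol_def by (simp add: prime_factorization_mult assms)

lemma symbol_unit_right [simp]: "n dvd 1 \<Longrightarrow> cubic_residue_symbol a n = 1"
  unfolding cubic_residue_symbol_def by (simp add: prime_factorization_unit)

lemma symbol_prime_right: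
  assumes "prime_elem \<pi>"
  shows "cubic_residue_symbol a \<pi> = cubic_residue_prime a \<pi>"
proof -
  have "prime (normalize \<pi>)" using assms by (simp add: prime_def)
  then have "prime_factorization \<pi> = {#normalize \<pi>#}"
    by (metis prime_factorization_normalize prime_factorization_prime)
  then show ?thesis
    unfolding cubic_residue_symbol_def by (simp add: crp_assoc[of "normalize \<pi>" \<pi>])
qed

lemma symbol_assoc_right:
  assumes "m dvd n" "n dvd m"
  shows "cubic_residue_symbol a m = cubic_residue_symbol a n"
proof -
  have "normalize m = normalize n" using assms associatedI by blast
  then show ?thesis
    unfolding cubic_residue_symbol_def by (metis prime_factorization_normalize)
qed

text \<open>Coprimality to 3 is stated through the norm throughout; this also excludes 0.\<close>

lemma eis_induct [consumes 1, case_names unit prime]: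
  assumes "\<not> 3 dvd eis_norm n"
    and unit: "\<And>u. u dvd 1 \<Longrightarrow> P u"
    and prime: "\<And>\<pi> n. prime_elem \<pi> \<Longrightarrow> \<not> \<pi> dvd 3 \<Longrightarrow> \<not> 3 dvd eis_norm n \<Longrightarrow> P n \<Longrightarrow> P (\<pi> * n)"
  shows "P n"
  using assms(1)
proof (induction n rule: prime_divisors_induct)
  case (factor \<pi> n)
  have n: "\<not> 3 dvd eis_norm \<pi>" "\<not> 3 dvd eis_norm n"
    using factor.prems by (auto simp: eis_norm_mult)
  have "\<not> \<pi> dvd 3"
    using eis_prime_factor_not_dvd_3[of \<pi> \<pi>] factor(1) n(1) by (simp add: prime_imp_prime_elem)
  then show ?case using factor n prime by (simp add: prime_imp_prime_elem)
qed (use unit in auto)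

lemma symbol_values:
  assumes "\<not> 3 dvd eis_norm n"
  shows "cubic_residue_symbol a n \<in> {0, 1, eis_omega, eis_omega ^ 2}"
  using assms
proof (induction n rule: eis_induct)
  case (prime \<pi> n)
  then have "n \<noteq> 0" "\<pi> \<noteq> 0" by auto
  then have "cubic_residue_symbol a (\<pi> * n) = cubic_residue_prime a \<pi> * cubic_residue_symbol a n"
    by (simp add: symbol_mult_right symbol_prime_right prime)
  then show ?case
    using prime(4) crp_props(1)[OF prime(1,2), of a] unfolding cube_units_or_0_iff by auto
qed auto

lemma symbol_in_cube_units:
  assumes "\<not> 3 dvd eis_norm n" "\<And>\<pi>. prime_elem \<pi> \<Longrightarrow> \<pi> dvd n \<Longrightarrow> \<not> \<pi> dvd a"
  shows "cubic_residue_symbol a n \<in> cube_units"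
  using assms
proof (induction n rule: eis_induct)
  case (prime \<pi> n)
  then have "n \<noteq> 0" "\<pi> \<noteq> 0" by auto
  then have "cubic_residue_symbol a (\<pi> * n) = cubic_residue_prime a \<pi> * cubic_residue_symbol a n"
    by (simp add: symbol_mult_right symbol_prime_right prime)
  moreover have "cubic_residue_symbol a n \<in> cube_units"
    using prime by simp
  moreover have "cubic_residue_prime a \<pi> \<in> cube_units"
    using prime by (intro crp_in_cube_units) auto
  ultimately show ?case by simp
qed auto

lemma symbol_mult_left:
  assumes "\<not> 3 dvd eis_norm n"
  shows "cubic_residue_symbol (a * b) n = cubic_residue_symbol a n * cubic_residue_symbol b n"
  using assms
proof (induction n rule: eis_induct)
  case (prime \<pi> n)
  then have "n \<noteq> 0" "\<pi> \<noteq> 0" by auto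
  then show ?case
    using prime by (simp add: symbol_mult_right symbol_prime_right crp_mult)
qed auto

lemma symbol_cong:
  assumes "\<not> 3 dvd eis_norm n" "n dvd a - b"
  shows "cubic_residue_symbol a n = cubic_residue_symbol b n"
  using assms
proof (induction n rule: eis_induct)
  case (prime \<pi> n)
  then have "n \<noteq> 0" "\<pi> \<noteq> 0" by auto
  moreover have "\<pi> dvd a - b" "n dvd a - b" using prime(5) by (auto dest: dvd_mult_left dvd_mult_right)
  ultimately show ?case
    using prime crp_cong[OF prime(1,2)] by (simp add: symbol_mult_right symbol_prime_right)
qed auto

lemma symbol_1_left [simp]:
  assumes "\<not> 3 dvd eis_norm n"
  shows "cubic_residue_symbol 1 n = 1"
  using assms
proof (induction n rule: eis_induct)
  case (prime \<pi> n)
  then have "n \<noteq> 0" "\<pi> \<noteq> 0" by auto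
  then show ?case
    using prime by (simp add: symbol_mult_right symbol_prime_right)
qed auto

lemma symbol_minus_1_left [simp]:
  assumes "\<not> 3 dvd eis_norm n"
  shows "cubic_residue_symbol (- 1) n = 1"
  using assms
proof (induction n rule: eis_induct)
  case (prime \<pi> n)
  then have "n \<noteq> 0" "\<pi> \<noteq> 0" by auto
  then show ?case
    using prime by (simp add: symbol_mult_right symbol_prime_right)
qed auto

lemma symbol_power_left:
  assumes "\<not> 3 dvd eis_norm n"
  shows "cubic_residue_symbol (a ^ k) n = cubic_residue_symbol a n ^ k"
  by (induction k) (simp_all add: assms symbol_mult_left)

lemma symbol_omega:
  assumes "\<not> 3 dvd eis_norm n"
  shows "cubic_residue_symbol eis_omega n = omega_pow ((eis_norm n - 1) div 3)"
  using assms
proof (induction n rule: eis_induct)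
  case (unit u)
  then show ?case by (simp add: eis_unit_iff_norm)
next
  case (prime \<pi> n)
  then have nz: "n \<noteq> 0" "\<pi> \<noteq> 0" by auto
  obtain r where r: "eis_norm \<pi> = 3 * r + 1" using eis_prime_norm_mod_3(2)[OF prime(1,2)]
    by (metis mult_div_mod_eq)
  obtain s where s: "eis_norm n = 3 * s + 1" using eis_norm_mod_3_cases[OF prime(3)]
    by (metis mult_div_mod_eq)
  \<comment> \<open>On integers that are 1 modulo 3 the map N to (N - 1)/3 is additive modulo
    3.\<close>
  have "(eis_norm (\<pi> * n) - 1) div 3 = r + s + 3 * (r * s)"
    unfolding eis_norm_mult r s by (simp add: algebra_simps)
  then have "omega_pow ((eis_norm (\<pi> * n) - 1) div 3) = omega_pow (r + s)"
    by (intro omega_pow_cong) (simp add: cong_def)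
  then show ?case
    using nz prime r s by (simp add: symbol_mult_right symbol_prime_right crp_omega omega_pow_add)
qed

section \<open>Symbols between rational integers\<close>

lemma eis_prime_dvd_of_int_coprime:
  assumes "coprime a b" "prime_elem \<pi>" "\<pi> dvd of_int b"
  shows "\<not> \<pi> dvd (of_int a :: eisenstein)"
  using assms eis_prime_dvd_not_coprime by blast

text \<open>For q = 2 modulo 3 the exponent (q^2 - 1)/3 is a multiple of q - 1, so Fermat's little
  theorem in the integers already gives 1.\<close>

lemma symbol_inert:
  assumes "prime q" "q mod 3 = 2" "\<not> int q dvd r"
  shows "cubic_residue_symbol (of_int r) (of_nat q) = 1"
proof -
  note pe = eis_inert_prime[OF assms(1,2)]
  have n3: "\<not> (of_nat q :: eisenstein) dvd 3"
  proof
    assume "(of_nat q :: eisenstein) dvd 3"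
    then have "(of_int (int q) :: eisenstein) dvd of_int 3" by simp
    then have "int q dvd 3" by (simp only: eis_of_int_dvd_of_int_iff)
    then have "q dvd 3" by presburger
    then have "q = 3" using assms(1) prime_nat_3 primes_dvd_imp_eq by blast
    then show False using assms(2) by simp
  qed
  have q2: "int q ^ 2 - 1 = (int q - 1) * (int q + 1)" by (simp add: power2_eq_square algebra_simps)
  obtain j where j: "q = 3 * j + 2" using assms(2) by (metis mult_div_mod_eq)
  have e: "crp_exp (of_nat q) = (q - 1) * (j + 1)"
  proof -
    have "int q ^ 2 - 1 = 3 * (int (q - 1) * int (j + 1))"
      unfolding q2 using j by simp
    then have "nat (int q ^ 2 - 1) = 3 * ((q - 1) * (j + 1))"
      by (metis nat_int of_nat_mult of_nat_numeral)
    then show ?thesis by simp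
  qed
  have "cubic_residue_prime (of_int r) (of_nat q) = 1"
  proof (rule crp_eqI[OF pe n3])
    have "coprime r (int q)"
      using assms(1,3) by (metis coprime_commute prime_imp_coprime prime_int_nat_transfer int_nat_eq nat_int of_nat_0_le_iff)
    have "r * (r ^ (q - 1) - 1) = r ^ q - r"
      using power_minus_mult[OF prime_gt_0_nat[OF assms(1)], of r] by (simp add: right_diff_distrib mult.commute)
    then have "int q dvd r * (r ^ (q - 1) - 1)"
      using int_fermat_little[OF assms(1), of r] by simp
    then have "int q dvd r ^ (q - 1) - 1"
      using \<open>coprime r (int q)\<close> by (simp add: coprime_commute coprime_dvd_mult_right_iff)
    then have "int q dvd (r ^ (q - 1)) ^ (j + 1) - 1 ^ (j + 1)"
      by (rule dvd_power_diff)
    then have "(of_int (int q) :: eisenstein) dvd of_int (r ^ ((q - 1) * (j + 1)) - 1)"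
      by (simp only: eis_of_int_dvd_of_int_iff power_mult power_one)
    then show "of_nat q dvd of_int r ^ crp_exp (of_nat q) - (1 :: eisenstein)"
      unfolding e by simp
  qed auto
  then show ?thesis by (simp add: symbol_prime_right[OF pe])
qed

text \<open>Conjugation moves the factor at the conjugate prime back to \<pi>, so both factors can
  be computed modulo the same prime.\<close>

lemma symbol_split:
  assumes "prime_elem \<pi>" "\<not> \<pi> dvd 3" "\<pi> * eis_cnj \<pi> = of_nat q"
  shows "cubic_residue_symbol a (of_nat q) = cubic_residue_prime a \<pi> * eis_cnj (cubic_residue_prime (eis_cnj a) \<pi>)"
proof -
  have "cubic_residue_symbol a (of_nat q) = cubic_residue_prime a \<pi> * cubic_residue_prime a (eis_cnj \<pi>)"
    unfolding assms(3)[symmetric]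
    using assms(1) prime_elem_cnj[OF assms(1)] by (simp add: symbol_mult_right symbol_prime_right prime_elem_def)
  also have "cubic_residue_prime a (eis_cnj \<pi>) = eis_cnj (cubic_residue_prime (eis_cnj a) \<pi>)"
    using crp_cnj[OF assms(1,2), of "eis_cnj a"] by simp
  finally show ?thesis .
qed

lemma int_induct_coprime_3 [consumes 1, case_names one minus_one prime]:
  fixes n :: int
  assumes "\<not> 3 dvd n"
    and unit: "P 1" "P (- 1)"
    and prime: "\<And>q n. prime (q :: nat) \<Longrightarrow> q mod 3 \<noteq> 0 \<Longrightarrow> \<not> 3 dvd n \<Longrightarrow> P n \<Longrightarrow> P (int q * n)"
  shows "P n"
  using assms(1)
proof (induction n rule: prime_divisors_induct)
  case zero
  then show ?case by simp
next
  case (unit u)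
  then have "u = 1 \<or> u = - 1" by (simp add: zdvd1_eq) linarith
  then show ?case using assms(2,3) by auto
next
  case (factor p n)
  obtain q where q: "p = int q" "prime q"
    using factor(1) by (metis prime_int_nat_transfer int_nat_eq prime_ge_0_int nat_0_le prime_nat_iff_prime)
  have "\<not> 3 dvd int q" "\<not> 3 dvd n" using factor(3) q(1) by auto
  moreover have "q mod 3 \<noteq> 0" using \<open>\<not> 3 dvd int q\<close> by presburger
  ultimately show ?case using prime[OF q(2)] factor(2) q(1) by blast
qed

lemma eis_norm_of_int_not_dvd_3: "\<not> 3 dvd k \<Longrightarrow> \<not> 3 dvd eis_norm (of_int k)"
  using prime_dvd_power[of 3 k 2] by auto

text \<open>At an inert prime the symbol is 1 by itself; at a split prime the two factors are
  conjugate cube roots of unity, because r equals its own conjugate, and they cancel.\<close>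

lemma symbol_of_int_of_int:
  assumes "\<not> 3 dvd n" "coprime r n"
  shows "cubic_residue_symbol (of_int r) (of_int n) = 1"
  using assms
proof (induction n rule: int_induct_coprime_3)
  case (prime q n)
  have "q \<noteq> 0" "n \<noteq> 0" using prime by auto
  then have "cubic_residue_symbol (of_int r) (of_int (int q * n)) =
      cubic_residue_symbol (of_int r) (of_nat q) * cubic_residue_symbol (of_int r) (of_int n)"
    by (simp add: symbol_mult_right eis_eq_iff)
  also have "cubic_residue_symbol (of_int r) (of_int n) = 1"
    using prime by simp
  also have "cubic_residue_symbol (of_int r) (of_nat q) = 1"
  proof (cases "q mod 3 = 2")
    case True
    have "\<not> int q dvd r"
      using prime(5) prime_gt_1_nat[OF prime(1)] by (auto elim!: dvdE simp: coprime_mult_left_iff coprime_mult_right_iff)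
    then show ?thesis using symbol_inert prime(1) True by blast
  next
    case False
    then have "[q = 1] (mod 3)" using prime(2) unfolding cong_def by presburger
    then obtain \<pi> where p: "prime_elem \<pi>" "eis_norm \<pi> = int q" "\<pi> * eis_cnj \<pi> = of_nat q" "\<not> \<pi> dvd 3"
      using eis_ex_split_prime prime(1) by blast
    have "\<pi> dvd of_int (int q)" using p(3) by (metis dvd_triv_left of_int_of_nat_eq)
    then have "\<not> \<pi> dvd of_int r"
      using eis_prime_dvd_of_int_coprime[of r "int q"] prime(5) p(1) by auto
    then show ?thesis
      using symbol_split[OF p(1,4,3)] crp_in_cube_units[OF p(1,4)] cube_units_mult_cnj by simp
  qed
  finally show ?case by simp
qed auto

section \<open>Gauss sums and reciprocity with rational integers\<close>

definition periodic :: "nat \<Rightarrow> (int \<Rightarrow> 'a) \<Rightarrow> bool" where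
  "periodic l f \<longleftrightarrow> (\<forall>t u. int l dvd t - u \<longrightarrow> f t = f u)"

lemma periodicD: "periodic l f \<Longrightarrow> int l dvd t - u \<Longrightarrow> f t = f u"
  by (simp add: periodic_def)

lemma periodic_mod: "periodic l f \<Longrightarrow> f (t mod int l) = f t"
  by (erule periodicD) (simp add: dvd_diff_sym)

text \<open>Injectivity of h modulo l suffices: h then permutes the finite set of residues.\<close>

lemma sum_periodic_reindex:
  fixes f :: "int \<Rightarrow> 'a :: comm_monoid_add"
  assumes l: "l > 0" and f: "periodic l f"
    and h: "\<And>t u. int l dvd h t - h u \<Longrightarrow> int l dvd t - u"
  shows "(\<Sum>t\<in>{0..<int l}. f (h t)) = (\<Sum>t\<in>{0..<int l}. f t)"
proof -
  define m where "m = (\<lambda>t. h t mod int l)"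
  have inj: "inj_on m {0..<int l}"
  proof (rule inj_onI)
    fix t u assume *: "t \<in> {0..<int l}" "u \<in> {0..<int l}" "m t = m u"
    then have "int l dvd t - u"
      using h[of t u] unfolding m_def by (simp add: mod_eq_dvd_iff)
    then have "t mod int l = u mod int l" by (simp add: mod_eq_dvd_iff)
    then show "t = u" using * by simp
  qed
  have "m ` {0..<int l} \<subseteq> {0..<int l}" using l by (auto simp: m_def)
  then have img: "m ` {0..<int l} = {0..<int l}"
    using inj by (intro endo_inj_surj) auto
  have "(\<Sum>t\<in>{0..<int l}. f (h t)) = (\<Sum>t\<in>{0..<int l}. f (m t))"
    by (simp add: m_def periodic_mod[OF f])
  also have "\<dots> = (\<Sum>t\<in>m ` {0..<int l}. f t)"
    using inj by (simp add: sum.reindex)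
  finally show ?thesis by (simp only: img)
qed

hide_const (open) up_ring.monom up_ring.coeff module.smult

text \<open>Gauss sums live in the group ring of the integers mod \<open>l\<close> over the Eisenstein integers,
  represented by polynomials modulo \<open>X\<^sup>l - 1\<close>. Here a periodic \<open>f\<close> becomes the element
  \<open>\<Sum>t. f t X\<^sup>t\<close>, and \<open>group_coeff\<close> reads off coefficients of the residue class.\<close>

definition group_elem :: "nat \<Rightarrow> (int \<Rightarrow> eisenstein) \<Rightarrow> eisenstein poly" where
  "group_elem l f = (\<Sum>t\<in>{0..<int l}. monom (f t) (nat t))"

definition convolution :: "nat \<Rightarrow> (int \<Rightarrow> eisenstein) \<Rightarrow> (int \<Rightarrow> eisenstein) \<Rightarrow> int \<Rightarrow> eisenstein" where
  "convolution l f g s = (\<Sum>t\<in>{0..<int l}. f t * g (s - t))"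

definition group_coeff :: "nat \<Rightarrow> nat \<Rightarrow> eisenstein poly \<Rightarrow> eisenstein" where
  "group_coeff l r p = (\<Sum>i\<le>degree p. if i mod l = r mod l then coeff p i else 0)"

lemma group_coeff_eq:
  assumes "degree p \<le> n"
  shows "group_coeff l r p = (\<Sum>i\<le>n. if i mod l = r mod l then coeff p i else 0)"
  unfolding group_coeff_def
  by (rule sum.mono_neutral_left) (use assms in \<open>auto simp: coeff_eq_0\<close>)

lemma group_coeff_add: "group_coeff l r (p + q) = group_coeff l r p + group_coeff l r q"
proof -
  define n where "n = max (degree p) (degree q)"
  have "degree (p + q) \<le> n" unfolding n_def by (rule degree_add_le_max)
  moreover have "degree p \<le> n" "degree q \<le> n" by (auto simp: n_def)
  ultimately show ?thesis
    by (simp add: group_coeff_eq[of _ n] sum.distrib[symmetric] if_distrib cong: if_cong)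
qed

lemma group_coeff_smult: "group_coeff l r (smult c p) = c * group_coeff l r p"
proof -
  have "degree (smult c p) \<le> degree p" by (rule degree_smult_le)
  then show ?thesis
    by (simp add: group_coeff_eq[of _ "degree p"] sum_distrib_left if_distrib cong: if_cong)
qed

lemma group_coeff_0 [simp]: "group_coeff l r 0 = 0"
  using group_coeff_smult[of l r 0 0] by simp

lemma group_coeff_diff: "group_coeff l r (p - q) = group_coeff l r p - group_coeff l r q"
  using group_coeff_add[of l r "p - q" q] by simp

lemma group_coeff_sum: "group_coeff l r (\<Sum>i\<in>A. f i) = (\<Sum>i\<in>A. group_coeff l r (f i))"
  by (induction A rule: infinite_finite_induct) (auto simp: group_coeff_add)

lemma group_coeff_monom: "group_coeff l r (monom c i) = (if i mod l = r mod l then c else 0)"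
proof -
  have "group_coeff l r (monom c i) = (\<Sum>j\<le>i. if j mod l = r mod l then coeff (monom c i) j else 0)"
    by (rule group_coeff_eq[OF degree_monom_le])
  also have "\<dots> = (\<Sum>j\<le>i. if j = i then (if i mod l = r mod l then c else 0) else 0)"
    by (intro sum.cong refl) auto
  finally have "group_coeff l r (monom c i) = \<dots>" .
  then show ?thesis by (simp only: sum.delta finite_atMost) simp
qed

text \<open>Multiplication by X^l keeps every monomial in its residue class, so
  \<open>group_coeff\<close> is well defined modulo X^l - 1. Comparing such coefficients replaces
  arguments about linear independence of roots of unity.\<close>

lemma group_coeff_relation: "group_coeff l r ((monom 1 l - 1) * p) = 0"
proof -
  have p: "p = (\<Sum>i\<le>degree p. monom (coeff p i) i)"
    by (rule poly_as_sum_of_monoms[symmetric])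
  have "group_coeff l r (monom 1 l * p) = group_coeff l r p"
    by (subst (1 2) p) (simp add: sum_distrib_left group_coeff_sum group_coeff_monom mult_monom)
  then show ?thesis by (simp add: left_diff_distrib group_coeff_diff)
qed

lemma group_coeff_cong: "(monom 1 l - 1) dvd p - q \<Longrightarrow> group_coeff l r p = group_coeff l r q"
  using group_coeff_relation by (metis (no_types, lifting) dvdE eq_iff_diff_eq_0 group_coeff_diff)

lemma group_coeff_cong_nat:
  assumes "of_nat q dvd p - p'"
  shows "of_nat q dvd group_coeff l r p - group_coeff l r p'"
proof -
  obtain s where "p - p' = smult (of_nat q) s"
    using assms by (auto simp: of_nat_poly elim!: dvdE)
  then show ?thesis
    by (metis dvd_triv_left group_coeff_diff group_coeff_smult)
qed

lemma group_coeff_group_elem: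
  assumes "l > 0" "periodic l f"
  shows "group_coeff l r (group_elem l f) = f (int r)"
proof -
  have "group_coeff l r (group_elem l f) = (\<Sum>t\<in>{0..<int l}. if nat t mod l = r mod l then f t else 0)"
    unfolding group_elem_def group_coeff_sum group_coeff_monom ..
  also have "\<dots> = (\<Sum>t\<in>{0..<int l}. if t = int (r mod l) then f t else 0)"
    by (intro sum.cong) (auto simp: nat_less_iff)
  also have "\<dots> = f (int (r mod l))" using assms(1) by (subst sum.delta) (auto simp: zmod_int)
  also have "\<dots> = f (int r)" using periodic_mod[OF assms(2), of "int r"] by (simp add: zmod_int)
  finally show ?thesis .
qed

lemma monom_mod_relation:
  "(monom 1 l - 1) dvd monom c i - monom c (i mod l)" for c :: eisenstein
proof -
  have "monom c i = monom c (i mod l) * monom 1 l ^ (i div l)"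
    by (simp add: mult_monom monom_power)
  then have "monom c i - monom c (i mod l) = monom c (i mod l) * (monom 1 l ^ (i div l) - 1 ^ (i div l))"
    by (simp add: right_diff_distrib)
  then show ?thesis by (metis dvd_mult dvd_power_diff dvd_refl)
qed

lemma group_elem_mult:
  assumes l: "l > 0" and f: "periodic l f" and g: "periodic l g"
  shows "(monom 1 l - 1) dvd group_elem l f * group_elem l g - group_elem l (convolution l f g)"
proof -
  let ?R = "{0..<int l}"
  have "group_elem l (convolution l f g) = (\<Sum>s\<in>?R. \<Sum>t\<in>?R. monom (f t * g (s - t)) (nat s))"
    unfolding group_elem_def convolution_def by (simp add: monom_sum)
  also have "\<dots> = (\<Sum>t\<in>?R. \<Sum>s\<in>?R. monom (f t * g (s - t)) (nat s))"
    by (rule sum.swap)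
  also have "\<dots> = (\<Sum>t\<in>?R. \<Sum>u\<in>?R. monom (f t * g u) (nat (t + u) mod l))"
  proof (rule sum.cong[OF refl])
    fix t assume t: "t \<in> ?R"
    \<comment> \<open>The exponent \<open>nat s\<close> is not periodic in s; reducing s first makes
      the summand periodic, so that the shift by t is a legitimate change of variable.\<close>
    define F where "F = (\<lambda>s. monom (f t * g (s mod int l - t)) (nat (s mod int l)))"
    have "periodic l F"
      unfolding periodic_def F_def by (simp add: mod_eq_dvd_iff[symmetric])
    then have "(\<Sum>u\<in>?R. F (t + u)) = (\<Sum>s\<in>?R. F s)"
      by (rule sum_periodic_reindex[OF l]) simp
    moreover have "(\<Sum>s\<in>?R. F s) = (\<Sum>s\<in>?R. monom (f t * g (s - t)) (nat s))"
      by (intro sum.cong) (auto simp: F_def)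
    moreover have "F (t + u) = monom (f t * g u) (nat (t + u) mod l)" if "u \<in> ?R" for u
    proof -
      have "int l dvd (t + u) mod int l - t - u"
        using dvd_diff_sym[OF dvd_minus_mod[of "int l" "t + u"]] by (simp add: algebra_simps)
      then have "g ((t + u) mod int l - t) = g u" by (rule periodicD[OF g])
      moreover have "nat ((t + u) mod int l) = nat (t + u) mod l"
        using t that by (simp add: nat_mod_distrib)
      ultimately show ?thesis by (simp add: F_def)
    qed
    then have "(\<Sum>u\<in>?R. F (t + u)) = (\<Sum>u\<in>?R. monom (f t * g u) (nat (t + u) mod l))"
      by (intro sum.cong) auto
    ultimately show "(\<Sum>s\<in>?R. monom (f t * g (s - t)) (nat s)) = (\<Sum>u\<in>?R. monom (f t * g u) (nat (t + u) mod l))"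
      by simp
  qed
  moreover have "group_elem l f * group_elem l g = (\<Sum>t\<in>?R. \<Sum>u\<in>?R. monom (f t * g u) (nat (t + u)))"
    unfolding group_elem_def sum_product by (intro sum.cong refl) (simp add: mult_monom nat_add_distrib)
  ultimately have "group_elem l f * group_elem l g - group_elem l (convolution l f g) =
      (\<Sum>t\<in>?R. \<Sum>u\<in>?R. monom (f t * g u) (nat (t + u)) - monom (f t * g u) (nat (t + u) mod l))"
    by (simp add: sum_subtractf)
  also have "(monom 1 l - 1) dvd \<dots>"
    by (intro dvd_sum monom_mod_relation)
  finally show ?thesis .
qed

lemma group_elem_smult: "group_elem l (\<lambda>t. c * f t) = smult c (group_elem l f)"
proof -
  have "smult c (\<Sum>t\<in>A. monom (f t) (nat t)) = (\<Sum>t\<in>A. monom (c * f t) (nat t))" for A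
    by (induction A rule: infinite_finite_induct) (auto simp: smult_add_right smult_monom)
  then show ?thesis by (simp add: group_elem_def)
qed

lemma dvd_sum_power_prime_power:
  fixes f :: "'b \<Rightarrow> 'a :: comm_ring_1"
  assumes "prime q"
  shows "of_nat q dvd (\<Sum>i\<in>A. f i) ^ (q ^ n) - (\<Sum>i\<in>A. f i ^ (q ^ n))"
proof (induction n)
  case (Suc n)
  have "of_nat q dvd ((\<Sum>i\<in>A. f i) ^ (q ^ n)) ^ q - (\<Sum>i\<in>A. f i ^ (q ^ n)) ^ q"
    by (rule dvd_power_diff[OF Suc])
  moreover have "of_nat q dvd (\<Sum>i\<in>A. f i ^ (q ^ n)) ^ q - (\<Sum>i\<in>A. (f i ^ (q ^ n)) ^ q)"
    by (rule dvd_sum_power_prime[OF assms])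
  ultimately have "of_nat q dvd ((\<Sum>i\<in>A. f i) ^ (q ^ n)) ^ q - (\<Sum>i\<in>A. (f i ^ (q ^ n)) ^ q)"
    by (rule dvd_diff_trans)
  then show ?case by (simp add: power_mult[symmetric] mult.commute)
qed simp

lemma cube_units_square_eq_iff: "a \<in> cube_units \<Longrightarrow> b \<in> cube_units \<Longrightarrow> a ^ 2 = b ^ 2 \<longleftrightarrow> a = b"
  unfolding cube_units_def by (elim insertE emptyE) (simp_all add: eis_eq_iff power2_eq_square)

lemma cube_units_eq_1I:
  assumes "\<not> \<pi> dvd 3" "s \<in> cube_units" "\<pi> dvd s - 1"
  shows "s = 1"
  using cubic_residue_prime_unique[OF assms(1), of s 1 s] assms(2,3) by (auto simp: cube_units_def)

section \<open>Cubic Gauss and Jacobi sums at a split prime\<close>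

locale split_prime =
  fixes \<rho> :: eisenstein and l :: nat
  assumes lam: "prime_elem \<rho>" "\<not> \<rho> dvd 3" and prime_l: "prime l" and norm_lam: "eis_norm \<rho> = int l"
begin

lemma l_pos: "l > 0" and l_gt_1: "l > 1" and int_l_gt_1: "int l > 1"
  using prime_l prime_gt_1_nat[of l] by auto

lemma l_exp: "l = 3 * crp_exp \<rho> + 1" "crp_exp \<rho> > 0"
  using crp_exp_nat[OF lam] norm_lam by auto

lemma l_ge: "l > 3"
  using l_exp by linarith

lemma lam_mult_cnj: "\<rho> * eis_cnj \<rho> = of_nat l"
  by (simp add: eis_mult_cnj norm_lam)

lemma lam_dvd_of_int_iff: "\<rho> dvd of_int t \<longleftrightarrow> int l dvd t"
proof
  assume "int l dvd t"
  then have "(of_int (int l) :: eisenstein) dvd of_int t" by (simp only: eis_of_int_dvd_of_int_iff)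
  moreover have "\<rho> dvd of_int (int l)" using lam_mult_cnj by (metis dvd_triv_left of_int_of_nat_eq)
  ultimately show "\<rho> dvd of_int t" by (rule dvd_trans[rotated])
next
  assume *: "\<rho> dvd of_int t"
  have "\<rho> dvd of_int (int l)" using lam_mult_cnj by (metis dvd_triv_left of_int_of_nat_eq)
  then have "\<not> coprime (int l) t" using * eis_prime_dvd_not_coprime lam(1) by blast
  then show "int l dvd t" using prime_l prime_imp_coprime[of "int l" t] by auto
qed

definition chi :: "int \<Rightarrow> eisenstein" where "chi t = cubic_residue_prime (of_int t) \<rho>"

lemma chi_periodic: "periodic l chi"
  unfolding periodic_def chi_def
  using crp_cong[OF lam] lam_dvd_of_int_iff by (metis of_int_diff)

lemma chi_mult: "chi (s * t) = chi s * chi t"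
  by (simp add: chi_def crp_mult[OF lam])

lemma chi_1 [simp]: "chi 1 = 1"
  by (simp add: chi_def lam)

lemma chi_eq_0_iff: "chi t = 0 \<longleftrightarrow> int l dvd t"
  by (simp add: chi_def crp_eq_0_iff[OF lam] lam_dvd_of_int_iff)

lemma chi_in: "\<not> int l dvd t \<Longrightarrow> chi t \<in> cube_units"
  unfolding chi_def by (intro crp_in_cube_units lam) (simp add: lam_dvd_of_int_iff)

lemma chi_uminus: "chi (- t) = chi t"
proof -
  have "chi (- 1) = 1" by (simp add: chi_def lam)
  then show ?thesis using chi_mult[of "- 1" t] by simp
qed

lemma chi_cnj: "eis_cnj (chi t) = chi t ^ 2"
  using chi_in[of t] chi_eq_0_iff[of t] cube_units_cnj by (cases "int l dvd t") auto

lemma chi_power: "chi (t ^ n) = chi t ^ n"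
  by (induction n) (auto simp: chi_mult)

lemma chi_cube: "chi t ^ 3 = (if int l dvd t then 0 else 1)"
  using chi_in[of t] chi_eq_0_iff[of t] cube_units_cube by auto

lemma ex_generator:
  obtains g where "\<not> int l dvd g" "\<And>i. 0 < i \<Longrightarrow> i < l - 1 \<Longrightarrow> \<not> int l dvd g ^ i - 1"
proof -
  obtain g where g: "residue_primroot l g"
    using prime_primitive_root_exists prime_l prime_gt_1_nat by blast
  have o: "ord l g = l - 1" "coprime l g"
    using g prime_l by (auto simp: residue_primroot_def totient_prime)
  have 1: "\<not> int l dvd int g"
    using o(2) l_gt_1 by (metis coprime_absorb_left int_dvd_int_iff nat_dvd_1_iff_1 nat_neq_iff)
  have 2: "\<not> int l dvd int g ^ i - 1" if i: "0 < i" "i < l - 1" for i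
  proof
    assume "int l dvd int g ^ i - 1"
    then have "[g ^ i = 1] (mod l)"
      by (metis cong_iff_dvd_diff cong_int_iff of_nat_1 of_nat_power)
    then have "ord l g dvd i"
      using ord_divides by blast
    then show False
      using i o(1) by (auto dest!: dvd_imp_le)
  qed
  show ?thesis using that[of "int g"] 1 2 by blast
qed

lemma chi_nontrivial: obtains g where "\<not> int l dvd g" "chi g \<noteq> 1"
proof -
  obtain g where g: "\<not> int l dvd g" "\<And>i. 0 < i \<Longrightarrow> i < l - 1 \<Longrightarrow> \<not> int l dvd g ^ i - 1"
    using ex_generator by blast
  have "chi g \<noteq> 1"
  proof
    assume "chi g = 1"
    then have "\<rho> dvd of_int g ^ crp_exp \<rho> - 1"
      using crp_props(2)[OF lam, of "of_int g"] unfolding chi_def by simp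
    then have "int l dvd g ^ crp_exp \<rho> - 1"
      using lam_dvd_of_int_iff by (metis of_int_1 of_int_diff of_int_power)
    then show False using g(2)[of "crp_exp \<rho>"] l_exp by simp
  qed
  then show ?thesis using that g(1) by blast
qed

abbreviation R :: "int set" where "R \<equiv> {0..<int l}"

lemma R_dvd: "t \<in> R \<Longrightarrow> int l dvd t \<longleftrightarrow> t = 0"
  using zdvd_not_zless[of t "int l"] by force

lemma dvd_multD: "\<not> int l dvd s \<Longrightarrow> int l dvd s * t - s * u \<Longrightarrow> int l dvd t - u"
  using prime_l by (simp add: right_diff_distrib[symmetric] prime_dvd_mult_iff)

lemma sum_chi: "(\<Sum>t\<in>R. chi t) = 0"
proof -
  obtain g where g: "\<not> int l dvd g" "chi g \<noteq> 1" using chi_nontrivial .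
  have "(\<Sum>t\<in>R. chi (g * t)) = (\<Sum>t\<in>R. chi t)"
    by (rule sum_periodic_reindex[OF l_pos chi_periodic dvd_multD[OF g(1)]])
  then have "chi g * (\<Sum>t\<in>R. chi t) = (\<Sum>t\<in>R. chi t)"
    by (simp add: chi_mult sum_distrib_left)
  then have "(chi g - 1) * (\<Sum>t\<in>R. chi t) = 0"
    by (simp only: left_diff_distrib) simp
  then show ?thesis using g(2) by simp
qed

lemma sum_chi_square: "(\<Sum>t\<in>R. chi t ^ 2) = 0"
  using arg_cong[OF sum_chi, of eis_cnj] by (simp add: chi_cnj)

text \<open>The Jacobi sum J(chi, chi).\<close>

definition jac :: eisenstein where "jac = (\<Sum>t\<in>R. chi t * chi (1 - t))"

text \<open>The coefficients of l minus the sum of all group elements. In the group ring this is the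
  product of the two conjugate Gauss sums; it becomes l only at a nontrivial l-th root of
  unity.\<close>

definition kap :: "int \<Rightarrow> eisenstein" where "kap t = (if int l dvd t then of_nat l else 0) - 1"

lemma chi_square_periodic: "periodic l (\<lambda>t. chi t ^ 2)"
  using periodicD[OF chi_periodic] unfolding periodic_def by metis

lemma kap_periodic: "periodic l kap"
  unfolding periodic_def kap_def using dvd_add_right_iff[of "int l"] by (metis diff_add_cancel)

text \<open>For s not 0 modulo l the substitution t to st pulls out chi(s)^2. For s = 0 the sum is
  that of chi^2, because chi(-1) = 1, and it vanishes together with chi(s).\<close>

lemma conv_chi_chi: "convolution l chi chi s = jac * chi s ^ 2"
proof (cases "int l dvd s")
  case True
  have "chi (s - t) = chi t" for t
    using periodicD[OF chi_periodic, of "s - t" "- t"] True by (simp add: chi_uminus)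
  then have "convolution l chi chi s = (\<Sum>t\<in>R. chi t ^ 2)"
    by (simp add: convolution_def power2_eq_square)
  then show ?thesis using True chi_eq_0_iff sum_chi_square by simp
next
  case False
  have per: "periodic l (\<lambda>t. chi t * chi (s - t))"
    unfolding periodic_def
  proof (intro allI impI)
    fix t u assume d: "int l dvd t - u"
    then have "int l dvd (s - t) - (s - u)" using dvd_diff_sym[OF d] by simp
    then show "chi t * chi (s - t) = chi u * chi (s - u)"
      using d periodicD[OF chi_periodic] by metis
  qed
  have "convolution l chi chi s = (\<Sum>t\<in>R. chi (s * t) * chi (s - s * t))"
    unfolding convolution_def
    by (rule sum_periodic_reindex[OF l_pos per dvd_multD[OF False], symmetric])
  also have "\<dots> = (\<Sum>t\<in>R. chi s ^ 2 * (chi t * chi (1 - t)))"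
  proof (rule sum.cong[OF refl])
    fix t
    have "s - s * t = s * (1 - t)" by (simp add: algebra_simps)
    then show "chi (s * t) * chi (s - s * t) = chi s ^ 2 * (chi t * chi (1 - t))"
      by (simp add: chi_mult power2_eq_square)
  qed
  finally show ?thesis by (simp add: jac_def sum_distrib_left mult.commute)
qed

lemma conv_chi_chi_square_0: "int l dvd s \<Longrightarrow> convolution l chi (\<lambda>t. chi t ^ 2) s = of_nat l - 1"
proof -
  assume s: "int l dvd s"
  have "chi (s - t) = chi t" for t
    using periodicD[OF chi_periodic, of "s - t" "- t"] s by (simp add: chi_uminus)
  then have "convolution l chi (\<lambda>t. chi t ^ 2) s = (\<Sum>t\<in>R. chi t ^ 3)"
    by (simp add: convolution_def power2_eq_square power3_eq_cube mult.assoc)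
  also have "\<dots> = (\<Sum>t\<in>R. 1 - (if t = 0 then 1 else 0))"
    by (intro sum.cong) (auto simp: chi_cube R_dvd)
  also have "\<dots> = of_nat l - 1"
    using l_pos by (simp add: sum_subtractf)
  finally show ?thesis .
qed

text \<open>Scaling shows that the value c is the same for all s prime to l. The sum over all s
  vanishes, and the term s = 0 is l - 1, so (l - 1)(c + 1) = 0.\<close>

lemma conv_chi_chi_square: "convolution l chi (\<lambda>t. chi t ^ 2) s = kap s"
proof (cases "int l dvd s")
  case True
  then show ?thesis by (simp add: conv_chi_chi_square_0 kap_def)
next
  case False
  define c where "c = (\<Sum>t\<in>R. chi t * chi (1 - t) ^ 2)"
  have *: "convolution l chi (\<lambda>t. chi t ^ 2) s = c" if s: "\<not> int l dvd s" for s
  proof -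
    have per: "periodic l (\<lambda>t. chi t * chi (s - t) ^ 2)"
      unfolding periodic_def
    proof (intro allI impI)
      fix t u assume d: "int l dvd t - u"
      then have "int l dvd (s - t) - (s - u)" using dvd_diff_sym[OF d] by simp
      then show "chi t * chi (s - t) ^ 2 = chi u * chi (s - u) ^ 2"
        using d periodicD[OF chi_periodic] by metis
    qed
    have "convolution l chi (\<lambda>t. chi t ^ 2) s = (\<Sum>t\<in>R. chi (s * t) * chi (s - s * t) ^ 2)"
      unfolding convolution_def
      by (rule sum_periodic_reindex[OF l_pos per dvd_multD[OF s], symmetric])
    also have "\<dots> = c"
      unfolding c_def
    proof (rule sum.cong[OF refl])
      fix t
      have "s - s * t = s * (1 - t)" by (simp add: algebra_simps)
      then have "chi (s * t) * chi (s - s * t) ^ 2 = chi s ^ 3 * (chi t * chi (1 - t) ^ 2)"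
        by (simp add: chi_mult power2_eq_square power3_eq_cube)
      then show "chi (s * t) * chi (s - s * t) ^ 2 = chi t * chi (1 - t) ^ 2"
        using s by (simp add: chi_cube)
    qed
    finally show ?thesis .
  qed
  have "(\<Sum>s\<in>R. convolution l chi (\<lambda>t. chi t ^ 2) s) = (\<Sum>t\<in>R. \<Sum>s\<in>R. chi t * chi (s - t) ^ 2)"
    unfolding convolution_def by (rule sum.swap)
  also have "\<dots> = (\<Sum>t\<in>R. 0)"
  proof (rule sum.cong[OF refl])
    fix t
    have "(\<Sum>s\<in>R. chi (s - t) ^ 2) = (\<Sum>s\<in>R. chi s ^ 2)"
      by (rule sum_periodic_reindex[OF l_pos chi_square_periodic]) simp
    then show "(\<Sum>s\<in>R. chi t * chi (s - t) ^ 2) = 0"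
      by (simp add: sum_distrib_left[symmetric] sum_chi_square)
  qed
  finally have "0 = (\<Sum>s\<in>R. convolution l chi (\<lambda>t. chi t ^ 2) s)" by simp
  also have "\<dots> = (\<Sum>s\<in>R. c + (if s = 0 then of_nat l - 1 - c else 0))"
    by (intro sum.cong) (auto simp: * R_dvd conv_chi_chi_square_0)
  also have "\<dots> = of_nat l * c + (of_nat l - 1 - c)"
    using l_pos by (simp add: sum.distrib)
  also have "\<dots> = (of_nat l - 1) * (c + 1)" by (simp add: algebra_simps)
  finally have "(of_nat l - 1) * (c + 1) = 0" by simp
  moreover have "(of_nat l :: eisenstein) - 1 \<noteq> 0"
    using l_gt_1 by (simp add: eis_eq_iff)
  ultimately have "c = - 1" by (simp add: eq_neg_iff_add_eq_0)
  then show ?thesis using * False by (simp add: kap_def)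
qed

text \<open>The sum of all group elements annihilates every element whose coefficients add up to 0,
  so \<open>kap\<close> acts on such an element as multiplication by l.\<close>

lemma conv_kap:
  assumes "periodic l f" "(\<Sum>t\<in>R. f t) = 0"
  shows "convolution l kap f s = of_nat l * f s"
proof -
  have "(\<Sum>t\<in>R. f (s - t)) = (\<Sum>t\<in>R. f t)"
  proof (rule sum_periodic_reindex[OF l_pos assms(1)])
    fix t u assume "int l dvd s - t - (s - u)"
    then have "int l dvd - (t - u)" by (simp add: algebra_simps)
    then show "int l dvd t - u" by (simp only: dvd_minus_iff)
  qed
  then have z: "(\<Sum>t\<in>R. f (s - t)) = 0" using assms(2) by simp
  have "convolution l kap f s = (\<Sum>t\<in>R. (if t = 0 then of_nat l * f s else 0) - f (s - t))"
    unfolding convolution_def by (intro sum.cong) (auto simp: kap_def R_dvd left_diff_distrib)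
  also have "\<dots> = of_nat l * f s"
    using l_pos z by (simp add: sum_subtractf)
  finally show ?thesis .
qed

lemma sum_kap: "(\<Sum>t\<in>R. kap t) = 0"
proof -
  have "(\<Sum>t\<in>R. kap t) = (\<Sum>t\<in>R. (if t = 0 then of_nat l else 0) - 1)"
    by (intro sum.cong) (auto simp: kap_def R_dvd)
  then show ?thesis using l_pos by (simp add: sum_subtractf)
qed

abbreviation "X_rel \<equiv> monom 1 l - (1 :: eisenstein poly)"
abbreviation "gauss \<equiv> group_elem l chi"
abbreviation "gauss' \<equiv> group_elem l (\<lambda>t. chi t ^ 2)"

lemma gauss_square: "X_rel dvd gauss ^ 2 - smult jac gauss'"
  using group_elem_mult[OF l_pos chi_periodic chi_periodic]
  by (simp add: conv_chi_chi group_elem_smult power2_eq_square[of gauss] ext[OF conv_chi_chi])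

lemma gauss'_square: "X_rel dvd gauss' ^ 2 - smult (eis_cnj jac) gauss"
proof -
  have "convolution l (\<lambda>t. chi t ^ 2) (\<lambda>t. chi t ^ 2) s = eis_cnj jac * chi s" for s
  proof -
    have "convolution l (\<lambda>t. chi t ^ 2) (\<lambda>t. chi t ^ 2) s = eis_cnj (convolution l chi chi s)"
      by (simp add: convolution_def chi_cnj)
    also have "\<dots> = eis_cnj jac * (chi s ^ 2) ^ 2" by (simp add: conv_chi_chi chi_cnj)
    also have "(chi s ^ 2) ^ 2 = chi s ^ 3 * chi s" by (simp add: power2_eq_square power3_eq_cube)
    also have "\<dots> = chi s" using chi_eq_0_iff[of s] by (simp add: chi_cube)
    finally show ?thesis .
  qed
  then have "convolution l (\<lambda>t. chi t ^ 2) (\<lambda>t. chi t ^ 2) = (\<lambda>s. eis_cnj jac * chi s)"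
    by (rule ext)
  then show ?thesis
    using group_elem_mult[OF l_pos chi_square_periodic chi_square_periodic]
    by (simp only: group_elem_smult power2_eq_square[of gauss'])
qed

lemma gauss_gauss': "X_rel dvd gauss * gauss' - group_elem l kap"
  using group_elem_mult[OF l_pos chi_periodic chi_square_periodic]
  by (simp add: ext[OF conv_chi_chi_square])

lemma gauss_cube: "X_rel dvd gauss ^ 3 - smult jac (group_elem l kap)"
proof -
  have "X_rel dvd gauss ^ 2 * gauss - smult jac gauss' * gauss"
    by (rule dvd_mult_diff[OF gauss_square]) simp
  moreover have "X_rel dvd smult jac gauss' * gauss - smult jac (group_elem l kap)"
    using dvd_smult[OF gauss_gauss', of jac] by (simp add: smult_diff_right mult.commute)
  ultimately have "X_rel dvd gauss ^ 2 * gauss - smult jac (group_elem l kap)"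
    by (rule dvd_diff_trans)
  then show ?thesis by (simp add: power2_eq_square power3_eq_cube mult.assoc)
qed

text \<open>The cube of the Gauss sum is only \<open>jac\<close> times \<open>kap\<close>. One more
  factor \<open>gauss\<close>, whose coefficients add up to 0, turns \<open>kap\<close> into l;
  hence all later powers have exponent 3k + 1.\<close>

lemma gauss_fourth: "X_rel dvd gauss ^ 4 - smult (jac * of_nat l) gauss"
proof -
  have "X_rel dvd gauss ^ 3 * gauss - smult jac (group_elem l kap) * gauss"
    by (rule dvd_mult_diff[OF gauss_cube]) simp
  moreover have "X_rel dvd group_elem l kap * gauss - smult (of_nat l) gauss"
    using group_elem_mult[OF l_pos kap_periodic chi_periodic]
    by (simp add: ext[OF conv_kap[OF chi_periodic sum_chi]] group_elem_smult)
  then have "X_rel dvd smult jac (group_elem l kap) * gauss - smult (jac * of_nat l) gauss"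
    using dvd_smult[of X_rel "group_elem l kap * gauss - smult (of_nat l) gauss" jac] by (simp add: smult_diff_right)
  ultimately have "X_rel dvd gauss ^ 3 * gauss - smult (jac * of_nat l) gauss"
    by (rule dvd_diff_trans)
  moreover have "gauss ^ 3 * gauss = gauss ^ 4" by (simp add: power4_eq_xxxx power3_eq_cube mult.assoc)
  ultimately show ?thesis by simp
qed

lemma gauss_power: "X_rel dvd gauss ^ (3 * k + 1) - smult ((jac * of_nat l) ^ k) gauss"
proof (induction k)
  case (Suc k)
  have 1: "X_rel dvd gauss ^ (3 * k + 1) * gauss ^ 3 - smult ((jac * of_nat l) ^ k) gauss * gauss ^ 3"
    by (rule dvd_mult_diff[OF Suc]) simp
  have 2: "smult ((jac * of_nat l) ^ k) gauss * gauss ^ 3 = smult ((jac * of_nat l) ^ k) (gauss ^ 4)"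
    by (simp add: power4_eq_xxxx power3_eq_cube mult.assoc)
  have 3: "X_rel dvd smult ((jac * of_nat l) ^ k) (gauss ^ 4) - smult ((jac * of_nat l) ^ k) (smult (jac * of_nat l) gauss)"
    unfolding smult_diff_right[symmetric] by (rule dvd_smult[OF gauss_fourth])
  have "X_rel dvd gauss ^ (3 * k + 1) * gauss ^ 3 - smult ((jac * of_nat l) ^ k) (smult (jac * of_nat l) gauss)"
    by (rule dvd_diff_trans[OF 1[unfolded 2] 3])
  moreover have "gauss ^ (3 * k + 1) * gauss ^ 3 = gauss ^ (3 * Suc k + 1)"
    unfolding power_add[symmetric] by simp
  ultimately show ?case by (simp add: mult.commute)
qed simp

text \<open>The product of the squares of the two Gauss sums is evaluated as N(J) \<open>kap\<close>
  and as l \<open>kap\<close>. The coefficient at 1, where \<open>kap\<close> is -1, gives the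
  equality.\<close>

lemma jac_norm: "eis_norm jac = int l"
proof -
  have "X_rel dvd gauss ^ 2 * gauss' ^ 2 - smult jac gauss' * smult (eis_cnj jac) gauss"
    by (rule dvd_mult_diff[OF gauss_square gauss'_square])
  moreover have "X_rel dvd smult jac gauss' * smult (eis_cnj jac) gauss - smult (jac * eis_cnj jac) (group_elem l kap)"
    using dvd_smult[OF gauss_gauss', of "jac * eis_cnj jac"] by (simp add: smult_diff_right mult.commute)
  ultimately have 1: "X_rel dvd gauss ^ 2 * gauss' ^ 2 - smult (jac * eis_cnj jac) (group_elem l kap)"
    by (rule dvd_diff_trans)
  have "X_rel dvd (gauss * gauss') ^ 2 - group_elem l kap ^ 2"
    by (rule dvd_power_diff[OF gauss_gauss'])
  moreover have "X_rel dvd group_elem l kap ^ 2 - smult (of_nat l) (group_elem l kap)"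
    using group_elem_mult[OF l_pos kap_periodic kap_periodic]
    by (simp add: ext[OF conv_kap[OF kap_periodic sum_kap]] group_elem_smult power2_eq_square)
  ultimately have 2: "X_rel dvd gauss ^ 2 * gauss' ^ 2 - smult (of_nat l) (group_elem l kap)"
    unfolding power_mult_distrib by (rule dvd_diff_trans)
  have "jac * eis_cnj jac * kap 1 = of_nat l * kap 1"
    using group_coeff_cong[OF 1, of 1] group_coeff_cong[OF 2, of 1]
    by (simp add: group_coeff_smult group_coeff_group_elem[OF l_pos kap_periodic])
  moreover have "kap 1 = - 1" using l_gt_1 by (simp add: kap_def)
  ultimately have "jac * eis_cnj jac = of_nat l" by simp
  then have "(of_int (eis_norm jac) :: eisenstein) = of_int (int l)"
    by (simp add: eis_mult_cnj)
  then show ?thesis by (simp add: eis_eq_iff)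
qed

text \<open>With Q = q^n, modulo q the power is the sum of chi(t)^Q X^(tQ). As Q is invertible
  modulo l, the class of Q receives only the term t = 1, where chi is 1.\<close>

lemma gauss_frobenius_coeff:
  assumes "prime q" "q \<noteq> l"
  shows "of_nat q dvd group_coeff l (q ^ n) (gauss ^ (q ^ n)) - 1"
proof -
  define Q where "Q = q ^ n"
  have "coprime q l" using assms prime_l primes_coprime by blast
  then have cop: "coprime (int Q) (int l)" by (simp add: Q_def)
  define S where "S = (\<Sum>t\<in>R. monom (chi t) (nat t) ^ Q)"
  have "group_coeff l Q S = (\<Sum>t\<in>R. if nat t * Q mod l = Q mod l then chi t ^ Q else 0)"
    unfolding S_def group_coeff_sum by (intro sum.cong refl) (simp add: monom_power group_coeff_monom)
  also have "\<dots> = (\<Sum>t\<in>R. if t = 1 then 1 else 0)"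
  proof (rule sum.cong[OF refl])
    fix t assume t: "t \<in> R"
    have "nat t * Q mod l = Q mod l \<longleftrightarrow> [nat t * Q = 1 * Q] (mod l)" by (simp add: cong_def)
    also have "\<dots> \<longleftrightarrow> [nat t = 1] (mod l)"
      using \<open>coprime q l\<close> by (intro cong_mult_rcancel_nat) (simp add: Q_def)
    also have "\<dots> \<longleftrightarrow> t = 1"
      using t l_gt_1 by (auto simp: cong_def nat_less_iff)
    finally show "(if nat t * Q mod l = Q mod l then chi t ^ Q else 0) = (if t = 1 then 1 else 0)"
      by simp
  qed
  also have "\<dots> = 1" using l_gt_1 by simp
  finally have "group_coeff l Q S = 1" .
  moreover have "of_nat q dvd gauss ^ Q - S"
    unfolding S_def Q_def group_elem_def by (rule dvd_sum_power_prime_power[OF assms(1)])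
  ultimately show ?thesis
    using group_coeff_cong_nat[of q "gauss ^ Q" S l Q] unfolding Q_def by simp
qed

text \<open>By \<open>gauss_power\<close> the coefficient in the class of q^n is also (J l)^k
  chi(q)^n. The power (J l)^k is a cubic residue symbol by Euler's criterion when 3k + 1 is the norm
  of a prime above q; this is how chi(q) meets the symbol of J.\<close>

lemma jac_power_cong:
  assumes "prime q" "q \<noteq> l" "q ^ n = 3 * k + 1"
  shows "of_nat q dvd (jac * of_nat l) ^ k * chi (int q) ^ n - 1"
proof -
  have "group_coeff l (q ^ n) (gauss ^ (q ^ n)) = (jac * of_nat l) ^ k * chi (int (q ^ n))"
    using group_coeff_cong[OF gauss_power, of "q ^ n" k]
    by (simp add: assms(3) group_coeff_smult group_coeff_group_elem[OF l_pos chi_periodic])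
  then show ?thesis
    using gauss_frobenius_coeff[OF assms(1,2), of n] by (simp add: chi_power)
qed

text \<open>The same comparison for the prime 3: the coefficient of \<open>gauss ^ 3\<close> in the
  class of 3 is J \<open>kap 3\<close> = -J, and Frobenius makes it 1 modulo 3.\<close>

lemma jac_mod_3: "of_int 3 dvd jac + 1"
proof -
  have "group_coeff l 3 (gauss ^ 3) = jac * kap 3"
    using group_coeff_cong[OF gauss_cube, of 3]
    by (simp add: group_coeff_smult group_coeff_group_elem[OF l_pos kap_periodic])
  moreover have "\<not> int l dvd 3" using l_ge by (auto dest!: zdvd_imp_le)
  ultimately have "group_coeff l 3 (gauss ^ 3) = - jac" by (simp add: kap_def)
  moreover have "of_nat 3 dvd group_coeff l (3 ^ 1) (gauss ^ (3 ^ 1)) - 1"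
    using l_ge by (intro gauss_frobenius_coeff) auto
  ultimately have "3 dvd - jac - 1" by simp
  then have "3 dvd - (- jac - 1)" by (simp only: dvd_minus_iff)
  then show ?thesis by (simp add: add.commute)
qed

text \<open>Scaling by a generator g multiplies the sum by g^i, which is not 1 modulo l in this
  range of i.\<close>

lemma power_sum_dvd:
  assumes "0 < i" "i < l - 1"
  shows "int l dvd (\<Sum>t\<in>R. t ^ i)"
proof -
  obtain g where g: "\<not> int l dvd g" "\<And>i. 0 < i \<Longrightarrow> i < l - 1 \<Longrightarrow> \<not> int l dvd g ^ i - 1"
    using ex_generator by blast
  define f where "f = (\<lambda>t. (t mod int l) ^ i)"
  have "periodic l f"
    unfolding periodic_def f_def by (simp add: mod_eq_dvd_iff[symmetric])
  then have "(\<Sum>t\<in>R. f (g * t)) = (\<Sum>t\<in>R. f t)"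
    by (rule sum_periodic_reindex[OF l_pos _ dvd_multD[OF g(1)]])
  also have "\<dots> = (\<Sum>t\<in>R. t ^ i)"
    by (intro sum.cong) (auto simp: f_def)
  finally have e: "(\<Sum>t\<in>R. f (g * t)) = (\<Sum>t\<in>R. t ^ i)" .
  have "int l dvd (\<Sum>t\<in>R. (g * t) ^ i - f (g * t))"
    unfolding f_def by (intro dvd_sum dvd_power_diff) simp
  also have "(\<Sum>t\<in>R. (g * t) ^ i - f (g * t)) = (g ^ i - 1) * (\<Sum>t\<in>R. t ^ i)"
    unfolding sum_subtractf e by (simp add: power_mult_distrib sum_distrib_left left_diff_distrib sum_subtractf)
  finally show ?thesis
    using g(2)[OF assms] prime_l by (simp add: prime_dvd_mult_iff)
qed

text \<open>Modulo \<rho> the character is t^k with k = (l - 1)/3, so J becomes a sum of powers with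
  exponents between k and 2k < l - 1, each of which vanishes modulo l.\<close>

lemma lam_dvd_jac: "\<rho> dvd jac"
proof -
  define k where "k = crp_exp \<rho>"
  define S where "S = (\<Sum>t\<in>R. t ^ k * (1 - t) ^ k)"
  have "\<rho> dvd of_int S - jac"
  proof -
    have "of_int S - jac = (\<Sum>t\<in>R. of_int t ^ k * of_int (1 - t) ^ k - chi t * chi (1 - t))"
      by (simp add: S_def jac_def sum_subtractf)
    also have "\<rho> dvd \<dots>"
      unfolding k_def chi_def by (intro dvd_sum dvd_mult_diff crp_props(2)[OF lam])
    finally show ?thesis .
  qed
  moreover have "int l dvd S"
  proof -
    have "(1 - t) ^ k = (\<Sum>j\<le>k. int (k choose j) * (- 1) ^ j * t ^ j)" for t :: int
      using binomial_ring[of "- t" 1 k] by (simp add: power_minus[of t] mult.assoc)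
    then have "S = (\<Sum>t\<in>R. \<Sum>j\<le>k. int (k choose j) * (- 1) ^ j * t ^ (k + j))"
      unfolding S_def by (simp add: sum_distrib_left power_add mult_ac)
    also have "\<dots> = (\<Sum>j\<le>k. int (k choose j) * (- 1) ^ j * (\<Sum>t\<in>R. t ^ (k + j)))"
      by (subst sum.swap) (simp add: sum_distrib_left)
    also have "int l dvd \<dots>"
      using l_exp by (intro dvd_sum dvd_mult power_sum_dvd) (auto simp: k_def)
    finally show ?thesis .
  qed
  then have "\<rho> dvd of_int S" by (simp add: lam_dvd_of_int_iff)
  ultimately show ?thesis by (rule dvd_diff_imp_dvd)
qed

text \<open>\<rho> divides J and both have norm l, so they differ by a unit; both are primary, so
  the unit is 1 or -1.\<close>

lemma jac_eq:
  assumes "3 dvd eis_snd \<rho>"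
  shows "jac = \<rho> \<or> jac = - \<rho>"
proof -
  obtain u where u: "jac = \<rho> * u" using lam_dvd_jac by auto
  then have "int l * eis_norm u = int l"
    using jac_norm norm_lam by (metis eis_norm_mult)
  then have nu: "eis_norm u = 1" using l_pos by simp
  have "3 dvd eis_snd jac" using jac_mod_3 by (simp add: eis_of_int_dvd_iff[of 3, simplified])
  then have "3 dvd eis_snd u"
    using eis_primary_cancel[of \<rho> u] assms eis_prime_norm_mod_3(1)[OF lam] unfolding u by blast
  then have "u = 1 \<or> u = - 1"
    using nu by (simp add: eis_unit_rational eis_unit_iff_norm)
  then show ?thesis using u by auto
qed

lemma crp_jac:
  assumes "3 dvd eis_snd \<rho>" "prime_elem \<pi>" "\<not> \<pi> dvd 3"
  shows "cubic_residue_prime jac \<pi> = cubic_residue_prime \<rho> \<pi>"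
    "cubic_residue_prime (eis_cnj jac) \<pi> = cubic_residue_prime (eis_cnj \<rho>) \<pi>"
proof -
  have "cubic_residue_prime (- a) \<pi> = cubic_residue_prime a \<pi>" for a
    using crp_mult[OF assms(2,3), of "- 1" a] assms by simp
  then show "cubic_residue_prime jac \<pi> = cubic_residue_prime \<rho> \<pi>"
    "cubic_residue_prime (eis_cnj jac) \<pi> = cubic_residue_prime (eis_cnj \<rho>) \<pi>"
    using jac_eq[OF assms(1)] by auto
qed

text \<open>For inert q, take n = 2 in \<open>jac_power_cong\<close>: l has symbol 1, so the symbol
  s of J satisfies s chi(q)^2 = 1. For split q, take n = 1 and write l as J times its conjugate:
  then s^2 t chi(q) = 1, where s and t belong to \<rho> and its conjugate, and s times the conjugate
  of t is the symbol of \<rho> modulo q.\<close>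

lemma reciprocity_prime:
  assumes prim: "3 dvd eis_snd \<rho>" and q: "prime q" "q mod 3 \<noteq> 0" "q \<noteq> l"
  shows "cubic_residue_symbol \<rho> (of_nat q) = cubic_residue_symbol (of_nat q) \<rho>"
proof -
  have chi_q: "cubic_residue_symbol (of_nat q) \<rho> = chi (int q)"
    by (simp add: symbol_prime_right[OF lam(1)] chi_def)
  have cop: "coprime (int l) (int q)" using q(1,3) prime_l primes_coprime by (metis coprime_int_iff)
  then have "\<not> int l dvd int q" using int_l_gt_1 by (metis coprime_absorb_left abs_of_nat less_irrefl zdvd1_eq)
  then have chi_q_in: "chi (int q) \<in> cube_units" by (rule chi_in)
  have lam_l: "\<rho> dvd of_int (int l)" using lam_mult_cnj by (metis dvd_triv_left of_int_of_nat_eq)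
  have not_dvd: "\<not> \<pi> dvd \<rho>" "\<not> \<pi> dvd eis_cnj \<rho>" if p: "prime_elem \<pi>" "\<pi> dvd of_nat q" for \<pi>
  proof -
    have "\<pi> dvd of_int (int q)" using p(2) by simp
    then have "\<not> \<pi> dvd of_int (int l)" using cop eis_prime_dvd_not_coprime p(1) by blast
    moreover have "of_int (int l) = \<rho> * eis_cnj \<rho>" by (simp add: lam_mult_cnj)
    ultimately show "\<not> \<pi> dvd \<rho>" "\<not> \<pi> dvd eis_cnj \<rho>" by auto
  qed
  show ?thesis
  proof (cases "q mod 3 = 2")
    case True
    note pe = eis_inert_prime[OF q(1) True]
    have n3: "\<not> (of_nat q :: eisenstein) dvd 3"
    proof
      assume "(of_nat q :: eisenstein) dvd 3"
      then have "\<not> coprime (int q) 3"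
        using eis_prime_dvd_not_coprime[OF pe, of "int q" 3] by simp
      then show False using prime_coprime_3[OF q(1,2)] by (simp add: coprime_commute)
    qed
    define k where "k = crp_exp (of_nat q)"
    have e: "q ^ 2 = 3 * k + 1"
      using crp_exp_nat(3)[OF pe n3] by (simp add: k_def nat_power_eq)
    define s where "s = cubic_residue_prime jac (of_nat q)"
    have s: "s \<in> cube_units"
      unfolding s_def crp_jac(1)[OF prim pe n3] using not_dvd[OF pe] by (intro crp_in_cube_units pe n3) auto
    have "\<not> int q dvd int l" using q(1,3) prime_l primes_dvd_imp_eq by (metis int_dvd_int_iff)
    then have "cubic_residue_prime (of_nat l) (of_nat q) = 1"
      using symbol_inert[OF q(1) True, of "int l"] by (simp add: symbol_prime_right[OF pe])
    then have "cubic_residue_prime (jac * of_nat l) (of_nat q) = s"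
      unfolding crp_mult[OF pe n3] s_def by simp
    then have "of_nat q dvd (jac * of_nat l) ^ k - s"
      using crp_props(2)[OF pe n3] unfolding k_def by metis
    then have "of_nat q dvd (jac * of_nat l) ^ k * chi (int q) ^ 2 - s * chi (int q) ^ 2"
      by (rule dvd_mult_diff) simp
    then have "of_nat q dvd s * chi (int q) ^ 2 - 1"
      using jac_power_cong[OF q(1,3) e] dvd_diff_trans dvd_diff_sym by blast
    then have "s * chi (int q) ^ 2 = 1"
      using cube_units_eq_1I[OF n3] s chi_q_in by simp
    then have "chi (int q) ^ 2 = s ^ 2"
      using cube_units_mult_eq_1_iff s chi_q_in by simp
    then have "chi (int q) = s" using cube_units_square_eq_iff s chi_q_in by blast
    then show ?thesis
      unfolding chi_q symbol_prime_right[OF pe] using crp_jac(1)[OF prim pe n3] s_def by simp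
  next
    case False
    then have q1: "[q = 1] (mod 3)" using q(2) unfolding cong_def by presburger
    obtain \<pi> where p: "prime_elem \<pi>" "eis_norm \<pi> = int q" "\<pi> * eis_cnj \<pi> = of_nat q" "\<not> \<pi> dvd 3"
      using eis_ex_split_prime q(1) q1 by blast
    have pq: "\<pi> dvd of_nat q" using p(3) by (metis dvd_triv_left)
    define k where "k = crp_exp \<pi>"
    have e: "q ^ 1 = 3 * k + 1"
      using crp_exp_nat(3)[OF p(1,4)] p(2) by (simp add: k_def)
    define s t where "s = cubic_residue_prime \<rho> \<pi>" and "t = cubic_residue_prime (eis_cnj \<rho>) \<pi>"
    have st: "s \<in> cube_units" "t \<in> cube_units"
      unfolding s_def t_def using not_dvd[OF p(1) pq] by (auto intro!: crp_in_cube_units p)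
    have "(of_nat l :: eisenstein) = jac * eis_cnj jac" by (simp add: eis_mult_cnj jac_norm)
    then have "cubic_residue_prime (jac * of_nat l) \<pi> = s ^ 2 * t"
      by (simp add: crp_mult[OF p(1,4)] crp_jac[OF prim p(1,4)] s_def t_def power2_eq_square)
    then have "\<pi> dvd (jac * of_nat l) ^ k - s ^ 2 * t"
      using crp_props(2)[OF p(1,4)] unfolding k_def by metis
    then have "\<pi> dvd (jac * of_nat l) ^ k * chi (int q) ^ 1 - s ^ 2 * t * chi (int q) ^ 1"
      by (rule dvd_mult_diff) simp
    then have "\<pi> dvd s ^ 2 * t * chi (int q) ^ 1 - 1"
      using dvd_trans[OF pq jac_power_cong[OF q(1,3) e]] dvd_diff_trans dvd_diff_sym by blast
    then have "s ^ 2 * t * chi (int q) = 1"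
      using cube_units_eq_1I[OF p(4)] st chi_q_in by simp
    then have "chi (int q) = (s ^ 2 * t) ^ 2"
      using cube_units_mult_eq_1_iff[of "s ^ 2 * t"] st chi_q_in by simp
    also have "\<dots> = s ^ 3 * s * t ^ 2"
      by (simp add: power2_eq_square power3_eq_cube mult_ac)
    also have "\<dots> = s * eis_cnj t"
      by (simp add: cube_units_cube cube_units_cnj st)
    finally show ?thesis
      unfolding chi_q symbol_split[OF p(1,4,3)] s_def t_def by simp
  qed
qed

end

section \<open>Reciprocity between primary elements and rational integers\<close>

lemma symbol_eq_0:
  assumes "\<not> 3 dvd eis_norm n" "prime_elem \<pi>" "\<pi> dvd n" "\<pi> dvd a"
  shows "cubic_residue_symbol a n = 0"
proof -
  obtain m where m: "n = \<pi> * m" using assms(3) by auto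
  have n0: "n \<noteq> 0" using assms(1) by auto
  have "\<not> \<pi> dvd 3" by (rule eis_prime_factor_not_dvd_3[OF assms(2,3,1)])
  then have "cubic_residue_prime a \<pi> = 0"
    using crp_eq_0_iff assms by blast
  then show ?thesis
    using n0 unfolding m by (simp add: symbol_mult_right symbol_prime_right[OF assms(2)])
qed

text \<open>At a split prime both sides are multiplicative in n, and for q = l both are 0. A primary
  inert prime is q or -q, so only symbols between rational integers occur, or both sides are
  0.\<close>

lemma reciprocity_primary_prime:
  assumes \<pi>: "prime_elem \<pi>" "\<not> \<pi> dvd 3" "3 dvd eis_snd \<pi>" and n: "\<not> 3 dvd n"
  shows "cubic_residue_symbol \<pi> (of_int n) = cubic_residue_symbol (of_int n) \<pi>"
  using \<pi>(1,2)
proof (cases rule: eis_prime_cases)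
  case (split l)
  interpret split_prime \<pi> l by standard (use \<pi> split in auto)
  note N = eis_prime_norm_mod_3(1)[OF \<pi>(1,2)]
  show ?thesis using n
  proof (induction n rule: int_induct_coprime_3)
    case one
    then show ?case using N by simp
  next
    case minus_one
    then show ?case using N by simp
  next
    case (prime q n)
    have q0: "(of_nat q :: eisenstein) \<noteq> 0" "(of_int n :: eisenstein) \<noteq> 0"
      using prime(1,3) prime_gt_0_nat[OF prime(1)] by (auto simp: eis_eq_iff)
    have nq: "\<not> 3 dvd eis_norm (of_nat q)"
      using prime(2) eis_norm_of_int_not_dvd_3[of "int q"] by (simp add: mod_eq_0_iff_dvd int_dvd_int_iff[of 3, simplified])
    have "cubic_residue_symbol \<pi> (of_nat q) = cubic_residue_symbol (of_nat q) \<pi>"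
    proof (cases "q = l")
      case True
      have "\<pi> dvd of_nat l" using lam_mult_cnj by (metis dvd_triv_left)
      then show ?thesis
        using symbol_eq_0[OF nq \<pi>(1), of \<pi>] symbol_eq_0[OF N \<pi>(1), of "of_nat q"] True by simp
    next
      case False
      then show ?thesis using reciprocity_prime \<pi>(3) prime(1,2) by blast
    qed
    then show ?case
      using q0 prime(4) N by (simp add: symbol_mult_right symbol_mult_left)
  qed
next
  case (inert q u)
  obtain v where v: "1 = u * v" using inert(5) by (elim dvdE)
  have pv: "\<pi> = of_int (int q) * v" using inert(4) v by (simp add: mult.assoc)
  have "v dvd 1" using v by (metis dvd_triv_right)
  have "3 dvd int q * eis_snd v" using \<pi>(3) by (simp add: pv)
  moreover have "\<not> 3 dvd int q" using inert(2) by presburger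
  ultimately have "3 dvd eis_snd v" by (simp add: prime_dvd_mult_iff)
  then have "v = 1 \<or> v = - 1" using \<open>v dvd 1\<close> eis_unit_rational by blast
  then have pq: "\<pi> = of_int (int q) \<or> \<pi> = - of_int (int q)" unfolding pv by auto
  have N: "\<not> 3 dvd eis_norm (of_int n)" using n by (rule eis_norm_of_int_not_dvd_3)
  have 1: "cubic_residue_symbol \<pi> (of_int n) = cubic_residue_symbol (of_int (int q)) (of_int n)"
    using pq symbol_mult_left[OF N, of "- 1" "of_int (int q)"] N by auto
  have 2: "cubic_residue_symbol (of_int n) \<pi> = cubic_residue_symbol (of_int n) (of_int (int q))"
    using pq by (intro symbol_assoc_right) auto
  show ?thesis
  proof (cases "coprime (int q) n")
    case True
    then show ?thesis
      unfolding 1 2 using n \<open>\<not> 3 dvd int q\<close> by (simp add: symbol_of_int_of_int coprime_commute del: of_int_of_nat_eq)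
  next
    case False
    then have "int q dvd n" using inert(1) prime_imp_coprime[of "int q" n] by auto
    then have "(of_int (int q) :: eisenstein) dvd of_int n" by (simp only: eis_of_int_dvd_of_int_iff)
    moreover have "prime_elem (of_int (int q) :: eisenstein)" using eis_inert_prime[OF inert(1,2)] by simp
    ultimately show ?thesis
      unfolding 1 2 using N eis_norm_of_int_not_dvd_3[OF \<open>\<not> 3 dvd int q\<close>]
      by (metis dvd_refl symbol_eq_0)
  qed
qed

theorem reciprocity_of_int:
  assumes "\<not> 3 dvd eis_norm \<alpha>" "3 dvd eis_snd \<alpha>" "\<not> 3 dvd n"
  shows "cubic_residue_symbol \<alpha> (of_int n) = cubic_residue_symbol (of_int n) \<alpha>"
proof -
  have N: "\<not> 3 dvd eis_norm (of_int n)" using assms(3) by (rule eis_norm_of_int_not_dvd_3)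
  \<comment> \<open>Quantified over units because each prime factor is made primary by a unit whose
    inverse has to be absorbed by the remaining factor.\<close>
  have "\<forall>u. u dvd 1 \<longrightarrow> 3 dvd eis_snd (\<alpha> * u) \<longrightarrow>
      cubic_residue_symbol (\<alpha> * u) (of_int n) = cubic_residue_symbol (of_int n) (\<alpha> * u)"
    using assms(1)
  proof (induction \<alpha> rule: eis_induct)
    case (unit v)
    show ?case
    proof (intro allI impI)
      fix u :: eisenstein assume "u dvd 1" "3 dvd eis_snd (v * u)"
      then have "v * u dvd 1" using unit mult_dvd_mono[of v 1 u 1] by simp
      then have "v * u = 1 \<or> v * u = - 1"
        using eis_unit_rational \<open>3 dvd eis_snd (v * u)\<close> by blast
      then show "cubic_residue_symbol (v * u) (of_int n) = cubic_residue_symbol (of_int n) (v * u)"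
        using N \<open>v * u dvd 1\<close> by auto
    qed
  next
    case (prime \<pi> \<alpha>)
    show ?case
    proof (intro allI impI)
      fix u :: eisenstein assume u: "u dvd 1" "3 dvd eis_snd (\<pi> * \<alpha> * u)"
      note Np = eis_prime_norm_mod_3(1)[OF prime(1,2)]
      obtain v where v: "v dvd 1" "3 dvd eis_snd (\<pi> * v)"
        using ex_unit_primary[OF Np] by blast
      obtain v' where v': "1 = v * v'" using v(1) by (elim dvdE)
      have "v' dvd 1" using v' by (metis dvd_triv_right)
      have e: "\<pi> * \<alpha> * u = (\<pi> * v) * (\<alpha> * (v' * u))"
        using v' by (metis mult.assoc mult.left_commute mult_1_left)
      have pe: "prime_elem (\<pi> * v)" using prime(1) v(1) by (rule prime_elem_mult_unit)
      have p3: "\<not> \<pi> * v dvd 3" using prime(2) by (auto dest: dvd_mult_left)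
      have "3 dvd eis_snd (\<alpha> * (v' * u))"
        using eis_primary_cancel[OF u(2)[unfolded e] v(2)] eis_prime_norm_mod_3(1)[OF pe p3] by blast
      then have "cubic_residue_symbol (\<alpha> * (v' * u)) (of_int n) = cubic_residue_symbol (of_int n) (\<alpha> * (v' * u))"
        using prime(4) mult_dvd_mono[OF \<open>v' dvd 1\<close> u(1)] by simp
      moreover have "cubic_residue_symbol (\<pi> * v) (of_int n) = cubic_residue_symbol (of_int n) (\<pi> * v)"
        by (rule reciprocity_primary_prime[OF pe p3 v(2) assms(3)])
      moreover have "\<pi> * v \<noteq> 0" "\<alpha> * (v' * u) \<noteq> 0"
        using pe prime(3) u(1) \<open>v' dvd 1\<close> by auto
      ultimately show "cubic_residue_symbol (\<pi> * \<alpha> * u) (of_int n) = cubic_residue_symbol (of_int n) (\<pi> * \<alpha> * u)"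
        unfolding e by (simp add: symbol_mult_right symbol_mult_left[OF N])
    qed
  qed
  from spec[OF this, of 1] show ?thesis using assms(2) by simp
qed

section \<open>The supplementary law for 3\<close>

lemma symbol_of_int_omega:
  assumes "\<not> 3 dvd n"
  shows "cubic_residue_symbol eis_omega (of_int n) = omega_pow ((n ^ 2 - 1) div 3)"
  using symbol_omega[OF eis_norm_of_int_not_dvd_3[OF assms]] by simp

lemma omega_pow_solve:
  assumes "s * omega_pow a = omega_pow b" "[b - a = c] (mod 3)"
  shows "s = omega_pow c"
proof -
  have "s * (omega_pow a * omega_pow (- a)) = omega_pow b * omega_pow (- a)"
    using assms(1) by (simp only: mult.assoc[symmetric])
  then have "s = omega_pow (b - a)"
    by (simp add: omega_pow_add[symmetric])
  then show ?thesis using omega_pow_cong[OF assms(2)] by simp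
qed

lemma eis_norm_primary:
  assumes "3 dvd eis_snd \<alpha>"
  shows "3 dvd eis_norm \<alpha> \<longleftrightarrow> 3 dvd eis_fst \<alpha>"
proof -
  have "3 dvd eis_norm \<alpha> \<longleftrightarrow> 3 dvd (eis_fst \<alpha>) ^ 2"
  proof -
    have "eis_norm \<alpha> = (eis_fst \<alpha>) ^ 2 + eis_snd \<alpha> * (eis_snd \<alpha> - eis_fst \<alpha>)"
      by (simp add: eis_norm_def power2_eq_square algebra_simps)
    then show ?thesis using assms by (simp add: dvd_add_left_iff)
  qed
  then show ?thesis by (simp add: prime_dvd_power_iff)
qed

text \<open>Exchanging with h gives (h/\<alpha>) = (e/h) = 1, and exchanging with e gives
  (e/\<alpha>) = (3h\<omega>/e) = (\<omega>/e). What is left is (3/\<alpha>)(\<omega>/\<alpha>) =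
  (\<omega>/e), whose known exponents (N\<alpha> - 1)/3 and (e^2 - 1)/3 differ by -eh modulo
  3.\<close>

lemma symbol_3_coprime:
  assumes e: "\<not> 3 dvd e" and h: "\<not> 3 dvd h" and eh: "coprime e h"
  shows "cubic_residue_symbol 3 (Eis e (3 * h)) = omega_pow (e * h)"
proof -
  define \<alpha> where "\<alpha> = Eis e (3 * h)"
  have N: "\<not> 3 dvd eis_norm \<alpha>" using e eis_norm_primary[of \<alpha>] by (simp add: \<alpha>_def)
  have p: "3 dvd eis_snd \<alpha>" by (simp add: \<alpha>_def)
  note Ne = eis_norm_of_int_not_dvd_3[OF e]
  note Nh = eis_norm_of_int_not_dvd_3[OF h]
  have eq: "\<alpha> = of_int e + of_int (3 * h) * eis_omega"
    by (simp add: \<alpha>_def eis_eq_iff)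
  have "cubic_residue_symbol (of_int h) \<alpha> = cubic_residue_symbol \<alpha> (of_int h)"
    using reciprocity_of_int[OF N p h] by simp
  also have "\<dots> = cubic_residue_symbol (of_int e) (of_int h)"
    by (rule symbol_cong[OF Nh]) (simp add: eq)
  also have "\<dots> = 1" using symbol_of_int_of_int[OF h eh] .
  finally have H: "cubic_residue_symbol (of_int h) \<alpha> = 1" .
  have "cubic_residue_symbol (of_int (3 * h) * eis_omega) \<alpha> = cubic_residue_symbol (- 1 * of_int e) \<alpha>"
    by (rule symbol_cong[OF N]) (simp add: eq add.commute)
  also have "\<dots> = cubic_residue_symbol (of_int e) \<alpha>"
    unfolding symbol_mult_left[OF N] by (simp add: N)
  also have "\<dots> = cubic_residue_symbol \<alpha> (of_int e)"
    using reciprocity_of_int[OF N p e] by simp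
  also have "\<dots> = cubic_residue_symbol (of_int (3 * h) * eis_omega) (of_int e)"
    by (rule symbol_cong[OF Ne]) (simp add: eq)
  also have "\<dots> = omega_pow ((e ^ 2 - 1) div 3)"
  proof -
    have "coprime 3 e" using e by (simp add: prime_imp_coprime)
    then have "coprime (3 * h) e" using eh by (simp add: coprime_commute)
    then show ?thesis
      using symbol_of_int_of_int[OF e, of "3 * h"]
      by (simp add: symbol_mult_left[OF Ne] symbol_of_int_omega[OF e])
  qed
  finally have "cubic_residue_symbol 3 \<alpha> * omega_pow ((eis_norm \<alpha> - 1) div 3) = omega_pow ((e ^ 2 - 1) div 3)"
    by (simp add: symbol_mult_left[OF N] H symbol_omega[OF N])
  then have "cubic_residue_symbol 3 \<alpha> = omega_pow (e * h)"
  proof (rule omega_pow_solve)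
    obtain k where k: "e ^ 2 = 3 * k + 1"
      using int_square_mod_3[OF e] by (metis mult_div_mod_eq)
    have "eis_norm \<alpha> - 1 = 3 * (k - e * h + 3 * h ^ 2)"
      using k by (simp add: eis_norm_def \<alpha>_def power2_eq_square algebra_simps)
    then have "(eis_norm \<alpha> - 1) div 3 = k - e * h + 3 * h ^ 2" by simp
    moreover have "(e ^ 2 - 1) div 3 = k" using k by simp
    ultimately show "[(e\<^sup>2 - 1) div 3 - (eis_norm \<alpha> - 1) div 3 = e * h] (mod 3)"
      by (simp add: cong_iff_dvd_diff)
  qed
  then show ?thesis by (simp add: \<alpha>_def)
qed

text \<open>A common rational factor g contributes (3/g) = 1 on the left, and changes eh by g^2,
  which is 1 modulo 3, on the right.\<close>

lemma symbol_3_not_dvd: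
  assumes e: "\<not> 3 dvd e" and h: "\<not> 3 dvd h"
  shows "cubic_residue_symbol 3 (Eis e (3 * h)) = omega_pow (e * h)"
proof -
  define g where "g = gcd e h"
  have "g \<noteq> 0" using e by (auto simp: g_def)
  then obtain e' h' where eh: "e = e' * g" "h = h' * g" "coprime e' h'"
    using gcd_coprime_exists[of e h] unfolding g_def by blast
  have n: "\<not> 3 dvd g" "\<not> 3 dvd e'" "\<not> 3 dvd h'" using e h eh(1,2) by auto
  have "Eis e (3 * h) = of_int g * Eis e' (3 * h')"
    by (simp add: eis_eq_iff eh)
  moreover have "Eis e' (3 * h') \<noteq> 0" using n by (auto simp: eis_eq_iff)
  moreover have "(of_int g :: eisenstein) \<noteq> 0" using \<open>g \<noteq> 0\<close> by (simp add: eis_eq_iff)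
  moreover have "cubic_residue_symbol (of_int 3) (of_int g) = 1"
    using n(1) by (intro symbol_of_int_of_int prime_imp_coprime) auto
  ultimately have "cubic_residue_symbol 3 (Eis e (3 * h)) = omega_pow (e' * h')"
    using symbol_3_coprime[OF n(2,3) eh(3)] by (simp add: symbol_mult_right)
  also have "\<dots> = omega_pow (e * h)"
  proof (rule omega_pow_cong)
    have "e' * h' - e * h = e' * h' * (1 - g ^ 2)"
      by (simp add: eh(1,2) power2_eq_square algebra_simps)
    moreover have "3 dvd 1 - g ^ 2"
      using int_square_mod_3[OF n(1)] by presburger
    ultimately show "[e' * h' = e * h] (mod 3)"
      by (simp add: cong_iff_dvd_diff)
  qed
  finally show ?thesis .
qed

lemma symbol_3:
  assumes e: "\<not> 3 dvd e"
  shows "cubic_residue_symbol 3 (Eis e (3 * h)) = omega_pow (e * h)"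
proof (cases "3 dvd h")
  case False
  then show ?thesis using symbol_3_not_dvd e by blast
next
  case True
  \<comment> \<open>multiply by the prime \<open>2 + 3\<omega>\<close> of norm 7 to reach the case already settled\<close>
  have "\<not> 3 dvd e - h" using e True by presburger
  moreover have "\<not> 3 dvd 2 * e - 9 * h" using e by presburger
  ultimately have "cubic_residue_symbol 3 (Eis (2 * e - 9 * h) (3 * (e - h))) = omega_pow ((2 * e - 9 * h) * (e - h))"
    by (intro symbol_3_not_dvd)
  moreover have "Eis (2 * e - 9 * h) (3 * (e - h)) = Eis e (3 * h) * Eis 2 (3 * 1)"
    by (simp add: eis_eq_iff algebra_simps)
  moreover have "Eis e (3 * h) \<noteq> 0" "Eis 2 (3 * 1) \<noteq> 0" using e by (auto simp: eis_eq_iff)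
  moreover have "cubic_residue_symbol 3 (Eis 2 (3 * 1)) = omega_pow (2 * 1)"
    by (rule symbol_3_not_dvd) auto
  ultimately have "cubic_residue_symbol 3 (Eis e (3 * h)) * omega_pow 2 = omega_pow ((2 * e - 9 * h) * (e - h))"
    by (simp add: symbol_mult_right)
  then show ?thesis
  proof (rule omega_pow_solve)
    obtain k where k: "h = 3 * k" using True by auto
    obtain j where j: "e * e = 3 * j + 1"
      using int_square_mod_3[OF e] by (metis mult_div_mod_eq power2_eq_square)
    have "(2 * e - 9 * h) * (e - h) - 2 - e * h = 3 * (2 * j - 2 * e * k - 9 * k * e + 27 * k * k - e * k)"
      using j unfolding k by (simp add: algebra_simps)
    then show "[(2 * e - 9 * h) * (e - h) - 2 = e * h] (mod 3)"
      by (simp add: cong_iff_dvd_diff)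
  qed
qed

section \<open>Symbols with rational modulus\<close>

text \<open>\<theta>^2 = -3 is rational with symbol 1, and 1 is the only cube root of unity with
  square 1.\<close>

lemma symbol_theta_of_int:
  assumes "\<not> 3 dvd n"
  shows "cubic_residue_symbol \<theta> (of_int n) = 1"
proof -
  note N = eis_norm_of_int_not_dvd_3[OF assms]
  have "cubic_residue_symbol (\<theta> ^ 2) (of_int n) = cubic_residue_symbol (of_int (- 3)) (of_int n)"
    by (simp add: eis_theta_square)
  also have "\<dots> = 1"
    using assms by (intro symbol_of_int_of_int) (auto intro: prime_imp_coprime)
  finally have s: "cubic_residue_symbol \<theta> (of_int n) ^ 2 = 1"
    by (simp only: symbol_power_left[OF N])
  then have "cubic_residue_symbol \<theta> (of_int n) \<noteq> 0" by (auto simp: power2_eq_square)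
  then have "cubic_residue_symbol \<theta> (of_int n) \<in> cube_units"
    using symbol_values[OF N] cube_unitsI by blast
  then show ?thesis using s cube_units_square_eq_1_iff by blast
qed

text \<open>Modulo each prime of b one of the two terms disappears, leaving a rational integer or a
  rational multiple of \<theta>, both with symbol 1.\<close>

lemma symbol_theta_form_of_int:
  assumes "\<not> 3 dvd b" "coprime P Q" "\<And>r. prime r \<Longrightarrow> r dvd b \<Longrightarrow> r dvd P \<or> r dvd Q"
  shows "cubic_residue_symbol (of_int P + of_int Q * \<theta>) (of_int b) = 1"
  using assms(1,3)
proof (induction b rule: int_induct_coprime_3)
  case (prime q n)
  have q0: "(of_int (int q) :: eisenstein) \<noteq> 0" "(of_int n :: eisenstein) \<noteq> 0"
    using prime(1,3) prime_gt_0_nat[OF prime(1)] by (auto simp: eis_eq_iff)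
  have q3: "\<not> 3 dvd int q" using prime(2) by presburger
  note N = eis_norm_of_int_not_dvd_3[OF q3]
  have pq: "prime (int q)" using prime(1) by simp
  have "int q dvd P \<or> int q dvd Q" using prime(5)[OF pq] by simp
  then have "cubic_residue_symbol (of_int P + of_int Q * \<theta>) (of_int (int q)) = 1"
  proof
    assume d: "int q dvd P"
    then have d': "(of_int (int q) :: eisenstein) dvd of_int P" by (simp only: eis_of_int_dvd_of_int_iff)
    have "coprime Q (int q)"
      using assms(2) d by (meson coprime_commute coprime_divisors dvd_refl)
    then have "cubic_residue_symbol (of_int Q * \<theta>) (of_int (int q)) = 1"
      unfolding symbol_mult_left[OF N] symbol_theta_of_int[OF q3] by (simp add: symbol_of_int_of_int[OF q3] del: of_int_of_nat_eq)
    moreover have "cubic_residue_symbol (of_int P + of_int Q * \<theta>) (of_int (int q)) = cubic_residue_symbol (of_int Q * \<theta>) (of_int (int q))"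
      by (rule symbol_cong[OF N]) (use d' in simp)
    ultimately show ?thesis by simp
  next
    assume d: "int q dvd Q"
    then have d': "(of_int (int q) :: eisenstein) dvd of_int Q" by (simp only: eis_of_int_dvd_of_int_iff)
    have "coprime P (int q)"
      using assms(2) d by (meson coprime_commute coprime_divisors dvd_refl)
    then have "cubic_residue_symbol (of_int P) (of_int (int q)) = 1"
      by (rule symbol_of_int_of_int[OF q3])
    moreover have "cubic_residue_symbol (of_int P + of_int Q * \<theta>) (of_int (int q)) = cubic_residue_symbol (of_int P) (of_int (int q))"
      by (rule symbol_cong[OF N]) (use d' in simp)
    ultimately show ?thesis by simp
  qed
  moreover have "cubic_residue_symbol (of_int P + of_int Q * \<theta>) (of_int n) = 1"
    using prime(4,5) by simp
  ultimately show ?case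
    using q0 by (simp add: symbol_mult_right)
qed auto

section \<open>Exchanging \<tau> and n\<close>

lemma omega_pow_power: "omega_pow a ^ k = omega_pow (int k * a)"
  by (induction k) (auto simp: omega_pow_add distrib_right)

lemma eis_dvd_of_int_prime:
  fixes \<pi> :: eisenstein
  assumes "prime_elem \<pi>" "\<pi> dvd of_int k" "k \<noteq> 0"
  obtains r :: int where "prime r" "r dvd k" "\<pi> dvd of_int r"
proof -
  have "\<pi> dvd of_nat (nat \<bar>k\<bar>)"
  proof (cases "k \<ge> 0")
    case True
    then show ?thesis using assms(2) by simp
  next
    case False
    then have "(of_nat (nat \<bar>k\<bar>) :: eisenstein) = - of_int k" by simp
    then show ?thesis using assms(2) by simp
  qed
  then obtain q where q: "prime q" "q dvd nat \<bar>k\<bar>" "\<pi> dvd of_nat q"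
    using eis_prime_dvd_prime[OF assms(1)] assms(3) by (metis zero_less_abs_iff zero_less_nat_eq)
  have "int q dvd k" using q(2) by (metis abs_dvd_iff dvd_abs_iff int_dvd_int_iff int_nat_eq abs_ge_zero)
  then show ?thesis using that[of "int q"] q by simp
qed

lemma eis_norm_theta_form: "eis_norm (of_int P + of_int Q * \<theta>) = P ^ 2 + 3 * Q ^ 2"
  by (simp add: eis_norm_def power2_eq_square algebra_simps)

text \<open>The exponent of \<omega> in the symbol of \<omega> modulo k
  (\<open>symbol_of_int_omega\<close>). By \<open>phi_mult\<close> it is additive modulo 3, so it
  behaves like a logarithm.\<close>

abbreviation phi :: "int \<Rightarrow> int" where "phi k \<equiv> (k ^ 2 - 1) div 3"

lemma phi_eq: "\<not> 3 dvd k \<Longrightarrow> k ^ 2 = 3 * phi k + 1"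
  using int_square_mod_3[of k] by (metis add_diff_cancel_right' mult_div_mod_eq nonzero_mult_div_cancel_left zero_neq_numeral)

lemma phi_mult:
  assumes "\<not> 3 dvd a" "\<not> 3 dvd b"
  shows "3 dvd phi (a * b) - (phi a + phi b)"
proof -
  have "\<not> 3 dvd a * b" using assms by (simp add: prime_dvd_mult_iff)
  then have "3 * phi (a * b) + 1 = (3 * phi a + 1) * (3 * phi b + 1)"
    using phi_eq assms by (metis power_mult_distrib)
  then have "phi (a * b) - (phi a + phi b) = 3 * (phi a * phi b)"
    by (simp add: algebra_simps)
  then show ?thesis by simp
qed

text \<open>Only the associate \<open>\<alpha>\<omega>\<^sup>s\<close> is primary; the exponents \<open>phi\<close> account for the factor \<open>\<omega>\<^sup>s\<close> in each
  use of reciprocity.\<close>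

lemma flip_symbol:
  fixes P Q n m y1 b1 :: int and i j s :: nat
  defines "\<alpha> \<equiv> of_int P + of_int Q * \<theta>"
  assumes PQ: "coprime P Q" "\<not> 3 dvd P" and prim: "3 dvd eis_snd (\<alpha> * eis_omega ^ s)"
    and n3: "\<not> 3 dvd n" and y1: "\<not> 3 dvd y1" and b1: "\<not> 3 dvd b1"
    and rel: "\<alpha> dvd of_int (81 * (3 ^ i * y1) ^ 2 * m ^ 3 + 3 * (3 ^ j * b1) ^ 2 * n)"
    and cop: "coprime n m" "coprime n y1"
    and y1_PQ: "\<And>r. prime r \<Longrightarrow> r dvd y1 \<Longrightarrow> r dvd P \<or> r dvd Q"
    and b1_PQ: "\<And>r. prime r \<Longrightarrow> r dvd b1 \<Longrightarrow> r dvd P \<or> r dvd Q"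
  shows "cubic_residue_symbol \<alpha> (of_int n) * omega_pow (int s * phi n) =
     omega_pow (int s * (2 * phi y1 + phi b1)) * cubic_residue_symbol 3 (\<alpha> * eis_omega ^ s) ^ (2 * i + j)"
proof -
  define \<alpha>' where "\<alpha>' = \<alpha> * eis_omega ^ s"
  have "\<not> 3 dvd P ^ 2" using PQ(2) by (simp add: prime_dvd_power_iff)
  then have Na: "\<not> 3 dvd eis_norm \<alpha>"
    unfolding \<alpha>_def eis_norm_theta_form by (simp add: dvd_add_left_iff)
  then have N: "\<not> 3 dvd eis_norm \<alpha>'"
    by (simp add: \<alpha>'_def eis_norm_mult eis_norm_power)
  have rel': "\<alpha>' dvd of_int (81 * (3 ^ i * y1) ^ 2 * m ^ 3 + 3 * (3 ^ j * b1) ^ 2 * n)"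
  proof -
    have "eis_omega ^ s dvd 1" by (simp add: eis_unit_iff_norm eis_norm_power)
    then show ?thesis using rel by (simp add: \<alpha>'_def mult_unit_dvd_iff)
  qed
  have not3: "\<not> \<pi> dvd 3" "\<not> \<pi> dvd \<theta>" if "prime_elem \<pi>" "\<pi> dvd \<alpha>'" for \<pi>
  proof -
    show "\<not> \<pi> dvd 3" by (rule eis_prime_factor_not_dvd_3[OF that N])
    moreover have "3 = \<theta> * (- \<theta>)" by (simp add: eis_eq_iff)
    ultimately show "\<not> \<pi> dvd \<theta>" by (metis dvd_mult2)
  qed
  \<comment> \<open>A prime of \<open>\<alpha>'\<close> dividing k lies over a rational prime
    dividing P or Q, hence divides one term of \<alpha>, hence the other, against coprimality of P
    and Q.\<close>
  have notPQ: "\<not> \<pi> dvd of_int k"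
    if p: "prime_elem \<pi>" "\<pi> dvd \<alpha>'" and k: "\<not> 3 dvd k" "\<And>r. prime r \<Longrightarrow> r dvd k \<Longrightarrow> r dvd P \<or> r dvd Q" for \<pi> k
  proof
    assume "\<pi> dvd of_int k"
    moreover have "k \<noteq> 0" using k(1) by auto
    ultimately obtain r :: int where r: "prime r" "r dvd k" "\<pi> dvd of_int r"
      using eis_dvd_of_int_prime[OF p(1)] by blast
    have "\<not> \<pi> dvd eis_omega ^ s"
    proof
      assume "\<pi> dvd eis_omega ^ s"
      moreover have "eis_omega ^ s dvd 1" by (simp add: eis_unit_iff_norm eis_norm_power)
      ultimately show False using p(1) dvd_trans by (auto simp: prime_elem_def)
    qed
    then have pa: "\<pi> dvd of_int P + of_int Q * \<theta>"
      using p unfolding \<alpha>'_def \<alpha>_def by (simp add: prime_elem_dvd_mult_iff)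
    have "\<pi> dvd of_int P \<and> \<pi> dvd of_int Q"
    proof (cases "r dvd P")
      case True
      then have "\<pi> dvd of_int P" using r(3) eis_of_int_dvd_of_int_iff dvd_trans by blast
      then have "\<pi> dvd of_int Q * \<theta>" using pa by (simp add: dvd_add_right_iff)
      then show ?thesis using \<open>\<pi> dvd of_int P\<close> p(1) not3(2)[OF p] by (simp add: prime_elem_dvd_mult_iff)
    next
      case False
      then have "r dvd Q" using k(2) r by blast
      then have "\<pi> dvd of_int Q" using r(3) eis_of_int_dvd_of_int_iff dvd_trans by blast
      then show ?thesis using pa by (simp add: dvd_add_left_iff)
    qed
    then show False using PQ(1) eis_prime_dvd_not_coprime p(1) by blast
  qed
  have not_n: "\<not> \<pi> dvd of_int n" "\<not> \<pi> dvd of_int m" if p: "prime_elem \<pi>" "\<pi> dvd \<alpha>'" for \<pi>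
  proof -
    note yb = notPQ[OF p y1 y1_PQ] notPQ[OF p b1 b1_PQ]
    note dp = prime_elem_dvd_mult_iff[OF p(1)] prime_elem_dvd_power_iff[OF p(1)]
    have r: "\<pi> dvd 81 * (3 ^ i * of_int y1) ^ 2 * of_int m ^ 3 + 3 * (3 ^ j * of_int b1) ^ 2 * of_int n"
      using dvd_trans[OF p(2) rel'] by simp
    have 81: "(81 :: eisenstein) = 3 ^ 4" by simp
    have p81: "\<not> \<pi> dvd 81"
      using not3(1)[OF p] p(1) prime_elem_dvd_power unfolding 81 by blast
    have p3: "\<not> \<pi> dvd 3 ^ k" for k
      using not3(1)[OF p] p(1) prime_elem_dvd_power by blast
    show "\<not> \<pi> dvd of_int n"
    proof
      assume n: "\<pi> dvd of_int n"
      then have "\<pi> dvd 81 * (3 ^ i * of_int y1) ^ 2 * of_int m ^ 3"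
        using r by (simp add: dvd_add_left_iff)
      then have "\<pi> dvd of_int m"
        using p81 p3 yb by (auto simp: dp)
      then show False using cop(1) n eis_prime_dvd_not_coprime p(1) by blast
    qed
    then show "\<not> \<pi> dvd of_int m"
    proof (rule contrapos_nn)
      assume "\<pi> dvd of_int m"
      then have "\<pi> dvd 81 * (3 ^ i * of_int y1) ^ 2 * of_int m ^ 3"
        by (simp add: power3_eq_cube)
      then have "\<pi> dvd 3 * (3 ^ j * of_int b1) ^ 2 * of_int n"
        using r by (simp add: dvd_add_right_iff)
      then show "\<pi> dvd of_int n"
        using not3(1)[OF p] p3 yb by (auto simp: dp)
    qed
  qed
  define c where "c = cubic_residue_symbol 3 \<alpha>'"
  define Y where "Y = cubic_residue_symbol (of_int y1) \<alpha>'"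
  define B where "B = cubic_residue_symbol (of_int b1) \<alpha>'"
  define M where "M = cubic_residue_symbol (of_int m) \<alpha>'"
  define L where "L = cubic_residue_symbol (of_int n) \<alpha>'"
  have units: "c \<in> cube_units" "Y \<in> cube_units" "B \<in> cube_units" "M \<in> cube_units" "L \<in> cube_units"
    unfolding c_def Y_def B_def M_def L_def
    using not3(1) notPQ[OF _ _ y1 y1_PQ] notPQ[OF _ _ b1 b1_PQ] not_n
    by (auto intro!: symbol_in_cube_units[OF N])
  \<comment> \<open>The relation modulo \<open>\<alpha>'\<close> is read in symbols: the sign and
    m^3 drop out, and 81 = 3^4 counts like 3, so a factor c cancels and an equation for L
    remains.\<close>
  have "cubic_residue_symbol (3 ^ 4 * (3 ^ i * of_int y1) ^ 2 * of_int m ^ 3) \<alpha>' =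
      cubic_residue_symbol (- 1 * (3 * (3 ^ j * of_int b1) ^ 2 * of_int n)) \<alpha>'"
    by (rule symbol_cong[OF N]) (use rel' in simp)
  then have "c ^ 4 * (c ^ i * Y) ^ 2 * M ^ 3 = c * (c ^ j * B) ^ 2 * L"
    by (simp only: symbol_mult_left[OF N] symbol_power_left[OF N] symbol_minus_1_left[OF N] mult_1_left
        c_def[symmetric] Y_def[symmetric] B_def[symmetric] M_def[symmetric] L_def[symmetric])
  moreover have "c ^ 4 = c" using cube_units_cube[OF units(1)] by (simp add: power_eq_if power3_eq_cube)
  moreover have "M ^ 3 = 1" using cube_units_cube[OF units(4)] .
  ultimately have "c * (c ^ i * Y) ^ 2 = c * ((c ^ j * B) ^ 2 * L)" by (simp add: mult.assoc)
  then have Z: "(c ^ i * Y) ^ 2 = (c ^ j * B) ^ 2 * L" using cube_units_nonzero[OF units(1)] by simp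
  define W where "W = c ^ j * B"
  have "W ^ 3 = 1" unfolding W_def using units by (intro cube_units_cube) simp
  \<comment> \<open>Since W^3 = 1, dividing by W^2 is multiplying by W; this turns y^2/\<beta>^2
    into y^2 \<beta>.\<close>
  then have "L = W ^ 2 * L * W" by (simp add: power2_eq_square power3_eq_cube mult_ac)
  also have "\<dots> = (c ^ i * Y) ^ 2 * (c ^ j * B)" using Z by (simp add: W_def)
  also have "\<dots> = Y ^ 2 * B * c ^ (2 * i + j)"
    by (simp add: power_mult_distrib power_add power_mult[symmetric] mult_ac)
  finally have L: "L = Y ^ 2 * B * c ^ (2 * i + j)" .
  have flip: "cubic_residue_symbol (of_int k) \<alpha>' = cubic_residue_symbol \<alpha> (of_int k) * omega_pow (int s * phi k)"
    if k: "\<not> 3 dvd k" for k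
  proof -
    note Nk = eis_norm_of_int_not_dvd_3[OF k]
    have "cubic_residue_symbol (of_int k) \<alpha>' = cubic_residue_symbol \<alpha>' (of_int k)"
      using reciprocity_of_int[OF N _ k] prim unfolding \<alpha>'_def by simp
    then show ?thesis
      by (simp add: \<alpha>'_def symbol_mult_left[OF Nk] symbol_power_left[OF Nk] symbol_of_int_omega[OF k] omega_pow_power)
  qed
  have "Y = omega_pow (int s * phi y1)" "B = omega_pow (int s * phi b1)"
    unfolding Y_def B_def flip[OF y1] flip[OF b1] \<alpha>_def
    using symbol_theta_form_of_int[OF y1 PQ(1) y1_PQ] symbol_theta_form_of_int[OF b1 PQ(1) b1_PQ] by simp_all
  then have YB: "Y ^ 2 * B = omega_pow (int s * (2 * phi y1 + phi b1))"
    by (simp add: power2_eq_square omega_pow_add[symmetric] algebra_simps)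
  have "cubic_residue_symbol \<alpha> (of_int n) * omega_pow (int s * phi n) = L"
    unfolding L_def flip[OF n3] ..
  then show ?thesis
    unfolding L YB c_def \<alpha>'_def .
qed

text \<open>Here \<alpha> is already primary, so s = 0. By \<open>symbol_3\<close> the symbol of 3
  has exponent (P + Q)(2Q/3), which is 0 modulo 3 if 9 divides Q; otherwise the exponent 2i + j has
  to provide the factor 3.\<close>

lemma flip_symbol_primary:
  fixes P Q n m y1 b1 :: int and i j :: nat
  defines "\<alpha> \<equiv> of_int P + of_int Q * \<theta>"
  assumes PQ: "coprime P Q" "\<not> 3 dvd P" and Q: "3 dvd Q" "9 dvd Q \<or> 3 dvd 2 * i + j"
    and n3: "\<not> 3 dvd n" and y1: "\<not> 3 dvd y1" and b1: "\<not> 3 dvd b1"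
    and rel: "\<alpha> dvd of_int (81 * (3 ^ i * y1) ^ 2 * m ^ 3 + 3 * (3 ^ j * b1) ^ 2 * n)"
    and cop: "coprime n m" "coprime n y1"
    and y1_PQ: "\<And>r. prime r \<Longrightarrow> r dvd y1 \<Longrightarrow> r dvd P \<or> r dvd Q"
    and b1_PQ: "\<And>r. prime r \<Longrightarrow> r dvd b1 \<Longrightarrow> r dvd P \<or> r dvd Q"
  shows "cubic_residue_symbol \<alpha> (of_int n) = 1"
proof -
  obtain k where k: "Q = 3 * k" using Q(1) by auto
  have a: "\<alpha> = Eis (P + Q) (3 * (2 * k))"
    unfolding \<alpha>_def eis_of_int_add_theta k by simp
  have e: "\<not> 3 dvd P + Q" using PQ(2) Q(1) by (simp add: dvd_add_left_iff)
  have prim: "3 dvd eis_snd ((of_int P + of_int Q * \<theta>) * eis_omega ^ 0)" using Q(1) by simp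
  from flip_symbol[OF PQ prim n3 y1 b1 rel[unfolded \<alpha>_def] cop y1_PQ b1_PQ]
  have "cubic_residue_symbol \<alpha> (of_int n) = cubic_residue_symbol 3 \<alpha> ^ (2 * i + j)"
    by (simp add: \<alpha>_def)
  also have "\<dots> = omega_pow (int (2 * i + j) * ((P + Q) * (2 * k)))"
    unfolding a symbol_3[OF e] omega_pow_power ..
  also have "\<dots> = omega_pow 0"
  proof (rule omega_pow_cong)
    have "3 dvd k \<or> 3 dvd int (2 * i + j)"
      using Q(2) unfolding k by presburger
    then show "[int (2 * i + j) * ((P + Q) * (2 * k)) = 0] (mod 3)"
      by (auto simp: cong_0_iff)
  qed
  finally show ?thesis by simp
qed

text \<open>The primary associate is \<alpha>\<omega> if P = Q modulo 3 and \<alpha>\<omega>^2 if P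
  = -Q. In both cases the symbol of 3 has exponent -s (phi P - phi Q), so the whole exponent is s
  times the quantity in the hypothesis on phi, which therefore covers both.\<close>

lemma flip_symbol_nonprimary:
  fixes P Q n m y1 b1 :: int and j :: nat
  defines "\<alpha> \<equiv> of_int P + of_int Q * \<theta>"
  assumes PQ: "coprime P Q" "\<not> 3 dvd P" and Q: "\<not> 3 dvd Q"
    and phi: "3 dvd - phi n + 2 * phi y1 + phi b1 - int j * (phi P - phi Q)"
    and n3: "\<not> 3 dvd n" and y1: "\<not> 3 dvd y1" and b1: "\<not> 3 dvd b1"
    and rel: "\<alpha> dvd of_int (81 * y1 ^ 2 * m ^ 3 + 3 * (3 ^ j * b1) ^ 2 * n)"
    and cop: "coprime n m" "coprime n y1"
    and y1_PQ: "\<And>r. prime r \<Longrightarrow> r dvd y1 \<Longrightarrow> r dvd P \<or> r dvd Q"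
    and b1_PQ: "\<And>r. prime r \<Longrightarrow> r dvd b1 \<Longrightarrow> r dvd P \<or> r dvd Q"
  shows "cubic_residue_symbol \<alpha> (of_int n) = 1"
proof -
  have rel0: "of_int P + of_int Q * \<theta> dvd of_int (81 * (3 ^ 0 * y1) ^ 2 * m ^ 3 + 3 * (3 ^ j * b1) ^ 2 * n)"
    using rel unfolding \<alpha>_def by simp
  have *: "cubic_residue_symbol \<alpha> (of_int n) = 1"
    if prim: "3 dvd eis_snd ((of_int P + of_int Q * \<theta>) * eis_omega ^ s)"
      and c: "cubic_residue_symbol 3 ((of_int P + of_int Q * \<theta>) * eis_omega ^ s) = omega_pow c"
      and c': "3 dvd c + int s * (phi P - phi Q)" for s c
  proof -
    from flip_symbol[OF PQ prim n3 y1 b1 rel0 cop y1_PQ b1_PQ]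
    have "cubic_residue_symbol \<alpha> (of_int n) * omega_pow (int s * phi n) =
        omega_pow (int s * (2 * phi y1 + phi b1) + int j * c)"
      unfolding c \<alpha>_def by (simp add: omega_pow_add omega_pow_power)
    then have "cubic_residue_symbol \<alpha> (of_int n) = omega_pow 0"
    proof (rule omega_pow_solve)
      have "int s * (2 * phi y1 + phi b1) + int j * c - int s * phi n =
        int s * (- phi n + 2 * phi y1 + phi b1 - int j * (phi P - phi Q)) + int j * (c + int s * (phi P - phi Q))"
        by (simp add: algebra_simps)
      then have "3 dvd int s * (2 * phi y1 + phi b1) + int j * c - int s * phi n"
        using phi c' by (metis dvd_add dvd_mult)
      then show "[int s * (2 * phi y1 + phi b1) + int j * c - int s * phi n = 0] (mod 3)"
        by (simp only: cong_0_iff)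
    qed
    then show ?thesis by simp
  qed
  have pp: "P ^ 2 = 3 * phi P + 1" "Q ^ 2 = 3 * phi Q + 1" using phi_eq PQ(2) Q by auto
  have "3 dvd P - Q \<or> 3 dvd P + Q" using PQ(2) Q by presburger
  then show ?thesis
  proof
    assume "3 dvd P - Q"
    then obtain k where k: "P - Q = 3 * k" by auto
    then have P: "P = Q + 3 * k" by simp
    have a: "(of_int P + of_int Q * \<theta>) * eis_omega ^ 1 = Eis (- 2 * Q) (3 * k)"
      unfolding k[symmetric] by (simp add: eis_eq_iff)
    have "3 * (phi P - phi Q) = P ^ 2 - Q ^ 2" using pp by simp
    also have "\<dots> = 3 * (2 * Q * k + 3 * k ^ 2)" unfolding P by (simp add: power2_eq_square algebra_simps)
    finally have d: "phi P - phi Q = 2 * Q * k + 3 * k ^ 2" by simp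
    show ?thesis
    proof (rule *)
      show "3 dvd eis_snd ((of_int P + of_int Q * \<theta>) * eis_omega ^ 1)" unfolding a by simp
      have "\<not> 3 dvd - 2 * Q" using Q by presburger
      then show "cubic_residue_symbol 3 ((of_int P + of_int Q * \<theta>) * eis_omega ^ 1) = omega_pow ((- 2 * Q) * k)"
        unfolding a by (rule symbol_3)
      show "3 dvd - 2 * Q * k + int 1 * (phi P - phi Q)" unfolding d by simp
    qed
  next
    assume "3 dvd P + Q"
    then obtain k where k: "P + Q = 3 * k" by auto
    then have P: "P = 3 * k - Q" by simp
    have a: "(of_int P + of_int Q * \<theta>) * eis_omega ^ 2 = Eis (Q - P) (3 * (- k))"
      using k by (simp add: eis_eq_iff eis_omega_square)
    have "3 * (phi P - phi Q) = P ^ 2 - Q ^ 2" using pp by simp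
    also have "\<dots> = 3 * (3 * k ^ 2 - 2 * Q * k)" unfolding P by (simp add: power2_eq_square algebra_simps)
    finally have d: "phi P - phi Q = 3 * k ^ 2 - 2 * Q * k" by simp
    show ?thesis
    proof (rule *)
      show "3 dvd eis_snd ((of_int P + of_int Q * \<theta>) * eis_omega ^ 2)" unfolding a by simp
      have "\<not> 3 dvd Q - P" using Q k by presburger
      then show "cubic_residue_symbol 3 ((of_int P + of_int Q * \<theta>) * eis_omega ^ 2) = omega_pow ((Q - P) * (- k))"
        unfolding a by (rule symbol_3)
      have "(Q - P) * (- k) + int 2 * (phi P - phi Q) = 3 * (3 * k ^ 2 - 2 * Q * k)"
        unfolding d unfolding P by (simp add: power2_eq_square algebra_simps)
      then show "3 dvd (Q - P) * (- k) + int 2 * (phi P - phi Q)" by simp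
    qed
  qed
qed

section \<open>Triviality of the symbol of \<open>\<tau>\<close> modulo \<open>n\<close>\<close>

text \<open>The data on which the symbol of \<tau> modulo n depends. The prime p and the form have
  disappeared: n = ap survives only through its expression by X and y, and C only through the primes
  that divide it.\<close>

locale cubic_form =
  fixes A \<beta> C D X y m n :: int
  assumes norm: "A ^ 2 - (\<beta> * C) ^ 2 * D = m ^ 3"
    and n: "n = X ^ 2 + 27 * C ^ 2 * D * y ^ 2"
    and cop: "coprime n (3 * m * D * y)"
    and sqf: "squarefree D"
    and cubefree: "\<And>r. prime r \<Longrightarrow> \<not> r ^ 3 dvd gcd A (\<beta> * C)"
    and odd_C: "odd C"
    and dvd_C: "\<And>r. prime r \<Longrightarrow> odd r \<Longrightarrow> r dvd A \<Longrightarrow> r dvd \<beta> * C \<Longrightarrow> \<not> r dvd D \<Longrightarrow> r dvd C"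
    and C_dvd: "\<And>r. prime r \<Longrightarrow> r dvd C \<Longrightarrow> r dvd A"
    and y_nz: "y \<noteq> 0" and m_nz: "m \<noteq> 0"
begin

abbreviation "B \<equiv> \<beta> * C"

lemma C_nz: "C \<noteq> 0" using odd_C by auto

lemma D_nz: "D \<noteq> 0" using sqf by auto

lemma prime_dvd_n:
  assumes r: "prime r" "r dvd n"
  shows "\<not> r dvd 3" "\<not> r dvd m" "\<not> r dvd D" "\<not> r dvd y" "\<not> (r dvd A \<and> r dvd B)" "\<not> r dvd C" "\<not> r dvd X"
proof -
  have nu: "\<not> r dvd 1" using r(1) by auto
  have "\<not> r dvd 3 * m * D * y"
    using cop r coprime_common_divisor nu by blast
  then show *: "\<not> r dvd 3" "\<not> r dvd m" "\<not> r dvd D" "\<not> r dvd y" by auto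
  show **: "\<not> (r dvd A \<and> r dvd B)"
  proof
    assume a: "r dvd A \<and> r dvd B"
    then have "r dvd A ^ 2" "r dvd B ^ 2 * D" by (simp_all add: power2_eq_square)
    then have "r dvd m ^ 3" unfolding norm[symmetric] by (rule dvd_diff)
    then show False using *(2) r(1) prime_dvd_power by blast
  qed
  show C: "\<not> r dvd C" using ** C_dvd[OF r(1)] by auto
  show "\<not> r dvd X"
  proof
    assume "r dvd X"
    then have "r dvd X ^ 2" by (simp add: power2_eq_square)
    then have "r dvd 27 * C ^ 2 * D * y ^ 2" using r(2) unfolding n by (simp add: dvd_add_right_iff)
    moreover have "(27::int) = 3 ^ 3" by simp
    then have "\<not> r dvd 27" using *(1) r(1) prime_dvd_power by metis
    ultimately show False
      using r(1) * C by (auto simp: prime_dvd_mult_iff prime_dvd_power_iff)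
  qed
qed

lemma not_3_dvd_n: "\<not> 3 dvd n"
  using prime_dvd_n(1)[of 3] by auto

lemma coprime_n_I: "(\<And>r. prime r \<Longrightarrow> r dvd n \<Longrightarrow> \<not> r dvd k) \<Longrightarrow> coprime n k"
proof (rule ccontr)
  assume *: "\<And>r. prime r \<Longrightarrow> r dvd n \<Longrightarrow> \<not> r dvd k" and "\<not> coprime n k"
  then have "\<bar>gcd n k\<bar> \<noteq> 1" by (simp add: coprime_iff_gcd_eq_1)
  then obtain r where "prime r" "r dvd gcd n k" using prime_factor_int by blast
  then show False using * by auto
qed

lemma not_3_dvd_X: "\<not> 3 dvd X"
proof
  assume "3 dvd X"
  then have "3 dvd X ^ 2" by (simp add: power2_eq_square)
  moreover have "27 * C ^ 2 * D * y ^ 2 = 3 * (9 * C ^ 2 * D * y ^ 2)" by simp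
  ultimately have "3 dvd n" unfolding n by (metis dvd_add dvd_triv_left)
  then show False using not_3_dvd_n by blast
qed

end

section \<open>Valuations of A and B, and the 3-adic case analysis\<close>

locale cubic_form_nonzero = cubic_form +
  assumes A_nz: "A \<noteq> 0" and \<beta>_nz: "\<beta> \<noteq> 0"
begin

lemmas nz = A_nz \<beta>_nz y_nz m_nz

text \<open>Let a and b be the valuations; cubefreeness gives min a b < 3. If r does not divide D
  and a differs from b, then 3 v(m) = 2 min a b, which is impossible. If r divides D, then 2a and 2b
  + 1 differ and their minimum is divisible by 3, which leaves b = 1 < a.\<close>

lemma multiplicity_A_B:
  assumes r: "prime r" "r dvd A" "r dvd B"
  shows "\<not> r dvd D \<Longrightarrow> multiplicity r A = multiplicity r B \<and> multiplicity r B \<le> 2"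
    "r dvd D \<Longrightarrow> multiplicity r A \<ge> 2 \<and> multiplicity r B = 1"
proof -
  have pe: "prime_elem r" using r(1) by (rule prime_imp_prime_elem)
  have nu: "\<not> r dvd 1" using r(1) by auto
  note md = prime_elem_multiplicity_mult_distrib[OF pe] prime_elem_multiplicity_power_distrib[OF pe]
  define a b where "a = multiplicity r A" and "b = multiplicity r B"
  have B_nz: "B \<noteq> 0" using nz C_nz by simp
  have ab: "a \<ge> 1" "b \<ge> 1"
    using r nz B_nz nu unfolding a_def b_def by (auto intro!: multiplicity_geI)
  have min: "a \<le> 2 \<or> b \<le> 2"
  proof (rule ccontr)
    assume "\<not> ?thesis"
    then have "r ^ 3 dvd A" "r ^ 3 dvd B" unfolding a_def b_def by (auto intro!: multiplicity_dvd')
    then show False using cubefree[OF r(1)] by simp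
  qed
  have 1: "multiplicity r (A ^ 2) = 2 * a" "multiplicity r (B ^ 2 * D) = 2 * b + multiplicity r D"
    "multiplicity r (m ^ 3) = 3 * multiplicity r m"
    unfolding a_def b_def using nz B_nz D_nz by (simp_all add: md del: mult_eq_0_iff)
  have 2: "3 * multiplicity r m = min (2 * a) (2 * b + multiplicity r D)" if "2 * a \<noteq> 2 * b + multiplicity r D"
  proof -
    have "multiplicity r (A ^ 2 + (- (B ^ 2 * D))) = min (multiplicity r (A ^ 2)) (multiplicity r (- (B ^ 2 * D)))"
      using that 1 nz B_nz D_nz by (intro multiplicity_sum_min) auto
    then show ?thesis using 1 norm by simp
  qed
  show "multiplicity r A = multiplicity r B \<and> multiplicity r B \<le> 2" if "\<not> r dvd D"
  proof -
    have "multiplicity r D = 0" using that by (rule not_dvd_imp_multiplicity_0)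
    then have "a = b \<or> (a < b \<and> 3 * multiplicity r m = 2 * a) \<or> (b < a \<and> 3 * multiplicity r m = 2 * b)"
      using 2 by (cases "a = b") (auto simp: min_def)
    then show ?thesis using min ab unfolding a_def[symmetric] b_def[symmetric] by presburger
  qed
  show "multiplicity r A \<ge> 2 \<and> multiplicity r B = 1" if "r dvd D"
  proof -
    have "\<not> r ^ 2 dvd D" using sqf nu unfolding squarefree_def by blast
    then have "multiplicity r D < 2" using D_nz nu multiplicity_lessI by blast
    moreover have "multiplicity r D > 0" using that D_nz prime_multiplicity_gt_zero_iff[OF pe] by blast
    ultimately have D1: "multiplicity r D = 1" by simp
    then have "2 * a \<noteq> 2 * b + multiplicity r D" by presburger
    then have "3 * multiplicity r m = min (2 * a) (2 * b + 1)" using 2 D1 by simp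
    then have "(a \<le> b \<and> 3 * multiplicity r m = 2 * a) \<or> (b < a \<and> 3 * multiplicity r m = 2 * b + 1)"
      by (cases "a \<le> b") (auto simp: min_def)
    then show ?thesis using min ab unfolding a_def[symmetric] b_def[symmetric] by presburger
  qed
qed

text \<open>If 3 divides A and not D, then 3 divides C, which uses up one of the at most two factors
  3 of B. If 3 divides D, then B has only one factor 3.\<close>

lemma multiplicity_3_cases:
  assumes h: "y = h * y'" "\<beta> = h * \<beta>'" "coprime y' \<beta>'" and 3: "3 dvd \<beta>'"
  shows "multiplicity 3 y' = 0"
    "3 dvd A \<Longrightarrow> multiplicity 3 A \<ge> 2 \<and> multiplicity 3 \<beta>' = 1"
proof -
  have pe: "prime_elem (3::int)" and p3: "prime (3::int)" by simp_all
  have "\<not> 3 dvd y'" using h(3) 3 p3 by (meson coprime_common_divisor not_prime_unit)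
  then show "multiplicity 3 y' = 0" by (rule not_dvd_imp_multiplicity_0)
  assume 3: "3 dvd A"
  have "3 dvd B" using h(2) \<open>3 dvd \<beta>'\<close> by simp
  note AB = multiplicity_A_B[OF p3 3 this]
  have nz': "\<beta>' \<noteq> 0" "h \<noteq> 0" using nz h by auto
  have vB: "multiplicity 3 B = multiplicity 3 h + multiplicity 3 \<beta>' + multiplicity 3 C"
    using nz' C_nz by (simp add: h(2) prime_elem_multiplicity_mult_distrib)
  have pos: "multiplicity 3 \<beta>' > 0" using \<open>3 dvd \<beta>'\<close> nz' by (simp add: prime_multiplicity_gt_zero_iff)
  show "multiplicity 3 A \<ge> 2 \<and> multiplicity 3 \<beta>' = 1"
  proof (cases "3 dvd D")
    case True
    then show ?thesis using AB(2) vB pos by linarith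
  next
    case False
    then have "3 dvd C" using dvd_C[OF p3 _ 3 \<open>3 dvd B\<close>] by simp
    then have "multiplicity 3 C > 0" using C_nz by (simp add: prime_multiplicity_gt_zero_iff)
    then show ?thesis using AB(1)[OF False] vB pos by linarith
  qed
qed

text \<open>Otherwise both coordinates have the valuation of g, so v(A) = v(\<beta>') + v(X), while
  v(B) = v(h) + v(\<beta>') + v(C). Then r divides A and B, hence not n, and X is prime to r if r
  divides C, D or y. For r dividing D this gives v(A) = v(\<beta>') <= v(B) = 1, against v(A) >= 2;
  for odd r not dividing D, v(B) > v(A) because r divides C.\<close>

lemma prime_dvd_beta':
  assumes h: "y = h * y'" "\<beta> = h * \<beta>'" "coprime y' \<beta>'"
    and eg: "9 * A * y' = e * g" "- (\<beta>' * X) = f * g"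
    and r: "prime r" "r dvd \<beta>'" "\<not> r dvd 3"
  shows "r dvd e \<or> r dvd f"
proof (rule ccontr)
  assume "\<not> ?thesis"
  then have ef: "\<not> r dvd e" "\<not> r dvd f" by auto
  have pe: "prime_elem r" using r(1) by (rule prime_imp_prime_elem)
  have nu: "\<not> r dvd 1" using r(1) by auto
  note md = prime_elem_multiplicity_mult_distrib[OF pe]
  have nz': "\<beta>' \<noteq> 0" "h \<noteq> 0" "y' \<noteq> 0" using nz h by auto
  have g_nz: "g \<noteq> 0" using eg(1) nz nz' by auto
  have ef_nz: "e \<noteq> 0" using ef by auto
  have f_nz: "f \<noteq> 0" using ef by auto
  then have X_nz: "X \<noteq> 0" using eg(2) g_nz by auto
  let ?v = "multiplicity r"
  have z: "?v e = 0" "?v f = 0" using ef by (simp_all add: not_dvd_imp_multiplicity_0)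
  have "\<not> r dvd y'" using h(3) r nu by (meson coprime_common_divisor)
  then have zy: "?v y' = 0" by (rule not_dvd_imp_multiplicity_0)
  have "(9::int) = 3 ^ 2" by simp
  then have "\<not> r dvd 9" using r prime_dvd_power by metis
  then have z9: "?v 9 = 0" by (rule not_dvd_imp_multiplicity_0)
  have "?v (9 * A * y') = ?v A" using nz nz' by (simp add: md z9 zy)
  moreover have "?v (e * g) = ?v g" using g_nz ef_nz by (simp add: md z)
  moreover have "?v (f * g) = ?v g" using g_nz f_nz by (simp add: md z)
  moreover have "?v (- (\<beta>' * X)) = ?v \<beta>' + ?v X" using nz' X_nz by (simp add: md)
  ultimately have vA: "?v A = ?v \<beta>' + ?v X" using eg by simp
  have pos: "?v \<beta>' > 0" using r(2) nz' prime_multiplicity_gt_zero_iff[OF pe] by blast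
  then have "r dvd A" using vA not_dvd_imp_multiplicity_0[of r A] by fastforce
  moreover have rB: "r dvd B" using r(2) h(2) by simp
  ultimately have rn: "\<not> r dvd n" using prime_dvd_n(5)[OF r(1)] by blast
  note AB = multiplicity_A_B[OF r(1) \<open>r dvd A\<close> rB]
  have vy: "?v y = ?v h" using nz nz' by (simp add: h(1) md zy)
  have vB: "?v B = ?v h + ?v \<beta>' + ?v C" using nz' C_nz by (simp add: h(2) md)
  have vX: "?v X = 0" if "r dvd C \<or> r dvd D \<or> r dvd y"
  proof -
    have "r dvd 27 * C ^ 2 * D * y ^ 2" using that by (auto simp: power2_eq_square)
    then have "\<not> r dvd X ^ 2" using rn unfolding n by (simp add: dvd_add_left_iff)
    then have "\<not> r dvd X" by (auto simp: power2_eq_square)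
    then show ?thesis by (rule not_dvd_imp_multiplicity_0)
  qed
  show False
  proof (cases "r dvd D")
    case True
    then show False using AB(2) vB vA vX by force
  next
    case False
    note AB = AB(1)[OF False]
    show False
    proof (cases "odd r")
      case True
      then have rC: "r dvd C" using dvd_C[OF r(1) _ \<open>r dvd A\<close> rB False] by blast
      then have "?v C > 0" using C_nz prime_multiplicity_gt_zero_iff[OF pe] by blast
      then show False using AB vB vA vX rC by force
    next
      case even: False
      \<comment> \<open>C is odd, so here v(X) = v(y), and both must be 0. Then X, y, C and D are
        all odd and n is even, although r does not divide n.\<close>
      then have r2: "r = 2" using r(1) by (metis primes_dvd_imp_eq two_is_prime_nat prime_int_numeral_eq prime_nat_numeral_eq)
      have "?v C = 0" using odd_C r2 by (simp add: not_dvd_imp_multiplicity_0)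
      then have "?v X = ?v y" using AB vB vA vy by linarith
      moreover have "r dvd y \<longleftrightarrow> ?v y > 0" using nz prime_multiplicity_gt_zero_iff[OF pe] by blast
      ultimately have "odd y" using vX r2 by auto
      moreover from this have "?v X = 0" using \<open>?v X = ?v y\<close> \<open>r dvd y \<longleftrightarrow> ?v y > 0\<close> r2 by auto
      then have "odd X" using prime_elem_multiplicity_eq_zero_iff[OF pe X_nz] r2 by simp
      ultimately have "even n" using odd_C False r2 by (simp add: n)
      then show False using rn r2 by blast
    qed
  qed
qed

text \<open>n equals X^2 modulo 9, on which phi modulo 3 depends, and phi of a square
  doubles.\<close>

lemma phi_n: "3 dvd phi n - 2 * phi X"
proof -
  define t where "t = 9 * C ^ 2 * D * y ^ 2"
  have n': "n = X ^ 2 + 3 * t" by (simp add: n t_def)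
  have "3 * phi n = n ^ 2 - 1" using phi_eq[OF not_3_dvd_n] by simp
  also have "\<dots> = (3 * phi X + 1 + 3 * t) ^ 2 - 1" using phi_eq[OF not_3_dvd_X] n' by simp
  also have "\<dots> = 3 * (2 * phi X + 3 * phi X ^ 2 + 2 * t + 6 * t * phi X + 3 * t ^ 2)"
    by (simp add: power2_eq_square algebra_simps)
  finally have "phi n - 2 * phi X = 3 * (phi X ^ 2 + 2 * t * phi X + t ^ 2) + 2 * t" by simp
  moreover have "3 dvd t" by (simp add: t_def)
  ultimately show ?thesis by simp
qed

text \<open>If 3 divides \<beta>, then A^2 = m^3 modulo 9, and a cube that is 1 modulo 3 is 1 modulo
  9.\<close>

lemma phi_A:
  assumes "\<not> 3 dvd A" "3 dvd \<beta>"
  shows "3 dvd phi A"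
proof -
  obtain k where k: "\<beta> = 3 * k" using assms(2) by auto
  have m3: "A ^ 2 - m ^ 3 = 9 * (k ^ 2 * C ^ 2 * D)"
    using norm unfolding k by (simp add: power2_eq_square algebra_simps)
  have "3 dvd A ^ 2 - m ^ 3" unfolding m3 by simp
  then have "(A ^ 2) mod 3 = m ^ 3 mod 3" by (simp add: mod_eq_dvd_iff)
  then have "m ^ 3 mod 3 = 1" using int_square_mod_3[OF assms(1)] by simp
  moreover have "m mod 3 = 0 \<or> m mod 3 = 1 \<or> m mod 3 = 2" by presburger
  ultimately have "m mod 3 = 1"
    using power_mod[of m 3 3] by auto
  then obtain t where t: "m = 3 * t + 1" by (metis mult_div_mod_eq)
  have "m ^ 3 = 9 * (3 * t ^ 3 + 3 * t ^ 2 + t) + 1"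
    unfolding t by (simp add: power3_eq_cube power2_eq_square algebra_simps)
  then have "3 * phi A = 9 * (k ^ 2 * C ^ 2 * D + (3 * t ^ 3 + 3 * t ^ 2 + t))"
    using m3 phi_eq[OF assms(1)] by simp
  then have "phi A = 3 * (k ^ 2 * C ^ 2 * D + (3 * t ^ 3 + 3 * t ^ 2 + t))" by simp
  then show ?thesis by simp
qed

text \<open>Taking phi of both equations, the unknown phi g cancels in the difference, phi A
  vanishes, and signs are invisible to phi.\<close>

lemma phi_quotients:
  assumes "\<not> 3 dvd A" "3 dvd \<beta>" "\<not> 3 dvd y1" "\<not> 3 dvd b1"
    and "s * g = A * y1" "t * g = - (b1 * X)"
  shows "3 dvd (phi s - phi t) - (phi y1 - phi b1 - phi X)"
proof -
  have "\<not> 3 dvd s * g" "\<not> 3 dvd t * g"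
    unfolding assms(5,6) using assms(1,3,4) not_3_dvd_X by (auto simp: prime_dvd_mult_iff)
  then have n3: "\<not> 3 dvd s" "\<not> 3 dvd g" "\<not> 3 dvd t" by auto
  have "3 dvd phi (A * y1) - (phi s + phi g)" using phi_mult[OF n3(1,2)] assms(5) by simp
  moreover have "3 dvd phi (A * y1) - (phi A + phi y1)" by (rule phi_mult[OF assms(1,3)])
  moreover have "phi (t * g) = phi (b1 * X)" unfolding assms(6) by simp
  then have "3 dvd phi (b1 * X) - (phi t + phi g)" using phi_mult[OF n3(3,2)] by simp
  moreover have "3 dvd phi (b1 * X) - (phi b1 + phi X)" by (rule phi_mult[OF assms(4) not_3_dvd_X])
  moreover have "3 dvd phi A" by (rule phi_A[OF assms(1,2)])
  moreover have "3 dvd (ps - pt) - (py - pb - pX)"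
    if "3 dvd u - (ps + pg)" "3 dvd u - (pA + py)" "3 dvd v - (pt + pg)" "3 dvd v - (pb + pX)" "3 dvd pA"
    for u v ps pt pg pA py pb pX :: int
    using that by presburger
  ultimately show ?thesis by blast
qed

text \<open>The rational factors h and g are prime to n and split off with symbol 1, leaving an
  element with coprime coordinates e and f. The equations \<open>vE\<close> and \<open>vF\<close>
  compare valuations at 3, and together with \<open>j0\<close> they leave few possibilities for i
  and j in each case of divisibility of e and f by 3.\<close>

lemma symbol_form_eq_1_nonzero:
  "cubic_residue_symbol (of_int (9 * A * y) - of_int (\<beta> * X) * \<theta>) (of_int n) = 1"
proof -
  have pe3: "prime_elem (3::int)" and p3: "prime (3::int)" by simp_all
  note md = prime_elem_multiplicity_mult_distrib[OF pe3]
  note n3 = not_3_dvd_n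
  note N = eis_norm_of_int_not_dvd_3[OF n3]
  define h where "h = gcd y \<beta>"
  have "h \<noteq> 0" using nz by (simp add: h_def)
  then obtain y' \<beta>' where h': "y = y' * h" "\<beta> = \<beta>' * h" "coprime y' \<beta>'"
    using gcd_coprime_exists[of y \<beta>] unfolding h_def by blast
  then have h: "y = h * y'" "\<beta> = h * \<beta>'" "coprime y' \<beta>'" by (simp_all add: mult.commute)
  have nz': "y' \<noteq> 0" "\<beta>' \<noteq> 0" using h nz by auto
  define g where "g = gcd (9 * A * y') (- (\<beta>' * X))"
  have g_nz: "g \<noteq> 0" using nz nz' by (simp add: g_def)
  then obtain e f where eg: "9 * A * y' = e * g" "- (\<beta>' * X) = f * g" and ef: "coprime e f"
    using gcd_coprime_exists[of "9 * A * y'" "- (\<beta>' * X)"] unfolding g_def by blast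
  have X_nz: "X \<noteq> 0" using not_3_dvd_X by auto
  have f_nz: "f \<noteq> 0" "e \<noteq> 0" using eg nz nz' X_nz g_nz by auto
  define \<tau> where "\<tau> = (of_int e + of_int f * \<theta> :: eisenstein)"
  have "of_int (9 * A * y) - of_int (\<beta> * X) * \<theta> = of_int h * of_int g * \<tau>"
  proof -
    have "h * (9 * A * y') = h * (e * g)" "h * (- (\<beta>' * X)) = h * (f * g)"
      by (simp_all only: eg)
    then have "9 * A * y = h * g * e" "- (\<beta> * X) = h * g * f"
      using h by (simp_all add: mult_ac)
    then have "of_int (9 * A * y) - of_int (\<beta> * X) * \<theta> = of_int (h * g * e) + of_int (h * g * f) * \<theta>"
      by (metis (no_types, lifting) diff_conv_add_uminus mult_minus_left of_int_minus)
    then show ?thesis by (simp add: \<tau>_def algebra_simps)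
  qed
  moreover have "cubic_residue_symbol (of_int h) (of_int n) = 1"
  proof (rule symbol_of_int_of_int[OF n3])
    show "coprime h n"
      unfolding coprime_commute[of h] using prime_dvd_n(4) h(1) by (intro coprime_n_I) (metis dvd_mult2)
  qed
  moreover have "cubic_residue_symbol (of_int g) (of_int n) = 1"
  proof (rule symbol_of_int_of_int[OF n3])
    have "coprime n g"
    proof (rule coprime_n_I)
      fix r assume r: "prime r" "r dvd n"
      show "\<not> r dvd g"
      proof
        assume "r dvd g"
        then have "r dvd 9 * A * y'" "r dvd \<beta>' * X" unfolding g_def by auto
        moreover have "(9::int) = 3 ^ 2" by simp
        then have "\<not> r dvd 9" using r(1) prime_dvd_n(1)[OF r] prime_dvd_power by metis
        moreover have "\<not> r dvd y'" "\<not> r dvd X" using prime_dvd_n[OF r] h(1) by auto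
        ultimately have "r dvd A" "r dvd B" using r(1) h(2) by (auto simp: prime_dvd_mult_iff)
        then show False using prime_dvd_n(5)[OF r] by blast
      qed
    qed
    then show "coprime g n" by (simp add: coprime_commute)
  qed
  moreover have "cubic_residue_symbol \<tau> (of_int n) = 1"
  proof -
    define i j where "i = multiplicity 3 y'" and "j = multiplicity 3 \<beta>'"
    obtain y1 where y1: "y' = 3 ^ i * y1" "\<not> 3 dvd y1"
      unfolding i_def by (rule multiplicity_decompose'[of y' 3]) (use nz' in auto)
    obtain b1 where b1: "\<beta>' = 3 ^ j * b1" "\<not> 3 dvd b1"
      unfolding j_def by (rule multiplicity_decompose'[of \<beta>' 3]) (use nz' in auto)
    have b1_ef: "r dvd e \<or> r dvd f" if r: "prime r" "r dvd b1" for r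
    proof -
      have "\<not> r dvd 3" using r b1(2) p3 primes_dvd_imp_eq by blast
      then show ?thesis using prime_dvd_beta'[OF h eg r(1)] r(2) b1(1) by simp
    qed
    have y1_ef: "r dvd e \<or> r dvd f" if r: "prime r" "r dvd y1" for r
    proof -
      have ry: "r dvd y'" using r(2) y1(1) by simp
      have "\<not> r dvd \<beta>'" using ry h(3) r(1) by (meson coprime_common_divisor not_prime_unit)
      moreover have "\<not> r dvd X"
      proof
        assume "r dvd X"
        then have "r dvd n" using ry h(1) unfolding n by (simp add: power2_eq_square)
        then show False using prime_dvd_n(7)[OF r(1)] \<open>r dvd X\<close> by blast
      qed
      ultimately have "\<not> r dvd - (\<beta>' * X)" using r(1) by (simp add: prime_dvd_mult_iff)
      then have "\<not> r dvd g" unfolding eg(2) by auto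
      moreover have "r dvd e * g" unfolding eg(1)[symmetric] using ry by simp
      ultimately show ?thesis using r(1) by (simp add: prime_dvd_mult_iff)
    qed
    have rel: "\<tau> dvd of_int (81 * (3 ^ i * y1) ^ 2 * m ^ 3 + 3 * (3 ^ j * b1) ^ 2 * n)"
    proof -
      \<comment> \<open>The norm identity with h^2 cancelled; both sides are g^2 times the norm of
        the reduced element e + f\<theta>.\<close>
      have "81 * y' ^ 2 * m ^ 3 + 3 * \<beta>' ^ 2 * n = (9 * A * y') ^ 2 + 3 * (- (\<beta>' * X)) ^ 2"
        unfolding norm[symmetric] n h(1,2) by (simp add: power2_eq_square algebra_simps)
      also have "\<dots> = (e ^ 2 + 3 * f ^ 2) * g ^ 2"
        unfolding eg by (simp add: power2_eq_square algebra_simps)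
      finally have "81 * (3 ^ i * y1) ^ 2 * m ^ 3 + 3 * (3 ^ j * b1) ^ 2 * n = eis_norm \<tau> * g ^ 2"
        unfolding \<tau>_def eis_norm_theta_form y1(1)[symmetric] b1(1)[symmetric] .
      moreover have "\<tau> dvd of_int (eis_norm \<tau>)" by (metis dvd_triv_left eis_mult_cnj)
      ultimately show ?thesis by simp
    qed
    have cnm: "coprime n m" using coprime_n_I prime_dvd_n(2) by blast
    have cny: "coprime n y1"
      using prime_dvd_n(4) h(1) y1(1) by (intro coprime_n_I) (metis dvd_mult)
    have vE: "2 + multiplicity 3 A + i = multiplicity 3 e + multiplicity 3 g"
    proof -
      have "multiplicity 3 (9 :: int) = 2" using multiplicity_prime_power[OF pe3, of 2] by simp
      then have "multiplicity 3 (9 * A * y') = 2 + multiplicity 3 A + i"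
        using nz nz' unfolding i_def by (simp add: md)
      then show ?thesis using eg(1) f_nz g_nz by (simp add: md)
    qed
    have vF: "j = multiplicity 3 f + multiplicity 3 g"
    proof -
      have "multiplicity 3 (- (\<beta>' * X)) = j"
        using nz' X_nz not_dvd_imp_multiplicity_0[OF not_3_dvd_X] unfolding j_def by (simp add: md)
      then show ?thesis using eg(2) f_nz g_nz by (simp add: md)
    qed
    have j0: "i = 0" "\<not> 3 dvd A \<or> (multiplicity 3 A \<ge> 2 \<and> j = 1)" if "j > 0"
    proof -
      have "3 dvd \<beta>'" using that unfolding j_def by (metis not_dvd_imp_multiplicity_0 less_irrefl)
      then show "i = 0" "\<not> 3 dvd A \<or> (multiplicity 3 A \<ge> 2 \<and> j = 1)"
        using multiplicity_3_cases[OF h] unfolding i_def j_def by blast+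
    qed
    have beta3: "3 dvd \<beta>" if "j > 0"
      using that h(2) unfolding j_def by (metis dvd_mult not_dvd_imp_multiplicity_0 less_irrefl)
    have vA0: "multiplicity 3 A = 0 \<longleftrightarrow> \<not> 3 dvd A"
      using nz by (simp add: prime_elem_multiplicity_eq_zero_iff)
    have v0: "\<not> 3 dvd k \<Longrightarrow> multiplicity 3 k = 0" for k :: int by (rule not_dvd_imp_multiplicity_0)
    have v1: "3 dvd k \<Longrightarrow> k \<noteq> 0 \<Longrightarrow> multiplicity 3 k \<ge> 1" for k :: int
      using prime_multiplicity_gt_zero_iff[OF pe3, of k] by simp
    have v2: "9 dvd k \<or> multiplicity 3 k \<le> 1" for k :: int
      using multiplicity_dvd'[of 2 3 k] by (auto simp: not_le)
    show ?thesis
    proof (cases "3 dvd e")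
      case False
      note e0 = v0[OF False]
      show ?thesis
      proof (cases "3 dvd f")
        case True
        \<comment> \<open>If f has exactly one factor 3, the valuations give j = 3 + v(A) + i, and
          \<open>j0\<close> then forces j = 3 and i = 0, so 2i + j is divisible by 3.\<close>
        have "9 dvd f \<or> 3 dvd 2 * i + j"
        proof -
          have "3 dvd 2 * i + j" if "multiplicity 3 f \<le> 1"
          proof -
            have "multiplicity 3 f = 1" using that v1[OF True f_nz(1)] by simp
            then have "j = 3 + multiplicity 3 A + i" using vE vF e0 by simp
            moreover from this have "i = 0" "multiplicity 3 A = 0" using j0 vA0 by auto
            ultimately show ?thesis by simp
          qed
          then show ?thesis using v2 by blast
        qed
        then show ?thesis
          unfolding \<tau>_def
          using flip_symbol_primary[OF ef False True _ n3 y1(2) b1(2) rel[unfolded \<tau>_def] cnm cny y1_ef b1_ef]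
          by blast
      next
        case f3: False
        have "j = 2 + multiplicity 3 A + i" using vE vF e0 v0[OF f3] by simp
        moreover from this have "i = 0" "\<not> 3 dvd A" using j0 by auto
        ultimately have j2: "j = 2" "i = 0" using vA0 by auto
        have g2: "multiplicity 3 g = 2" using vF j2 v0[OF f3] by simp
        then obtain g1 where g1: "g = 9 * g1" using multiplicity_dvd[of 3 g] by auto
        have "3 dvd (phi e - phi f) - (phi y1 - phi b1 - phi X)"
        proof (rule phi_quotients[OF \<open>\<not> 3 dvd A\<close> _ y1(2) b1(2)])
          show "3 dvd \<beta>" using beta3 j2 by simp
          show "e * g1 = A * y1" using eg(1) unfolding g1 y1(1) j2 by simp
          show "f * g1 = - (b1 * X)" using eg(2) unfolding g1 b1(1) j2 by (simp add: mult.commute)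
        qed
        \<comment> \<open>For j = 2 everything cancels modulo 3 except 3 phi b1.\<close>
        moreover have "3 dvd - pn + 2 * py + pb - 2 * (pe - pf)"
          if "3 dvd (pe - pf) - (py - pb - pX)" "3 dvd pn - 2 * pX" for pe pf py pb pX pn :: int
          using that by presburger
        ultimately have "3 dvd - phi n + 2 * phi y1 + phi b1 - int j * (phi e - phi f)"
          using phi_n unfolding j2 of_nat_numeral by blast
        moreover have "of_int e + of_int f * \<theta> dvd of_int (81 * y1 ^ 2 * m ^ 3 + 3 * (3 ^ j * b1) ^ 2 * n)"
          using rel unfolding \<tau>_def j2 by simp
        ultimately show ?thesis
          unfolding \<tau>_def
          using flip_symbol_nonprimary[OF ef False f3 _ n3 y1(2) b1(2) _ cnm cny y1_ef b1_ef] by blast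
      qed
    next
      case True
      then obtain e' where e': "e = 3 * e'" by auto
      have f3: "\<not> 3 dvd f" using True ef p3 by (meson coprime_common_divisor not_prime_unit)
      have e'_nz: "e' \<noteq> 0" using e' f_nz by auto
      have ve: "multiplicity 3 e = 1 + multiplicity 3 e'"
        unfolding e' using e'_nz by (simp add: md)
      \<comment> \<open>As \<theta>^2 = -3, a factor \<theta> can be taken out of 3e' + f\<theta>;
        it has symbol 1 modulo n, and the remaining element is prime to 3.\<close>
      define \<alpha> where "\<alpha> = (of_int f + of_int (- e') * \<theta> :: eisenstein)"
      have \<tau>\<alpha>: "\<tau> = \<theta> * \<alpha>"
        unfolding \<tau>_def \<alpha>_def e' by (simp add: eis_eq_iff)
      have rel': "\<alpha> dvd of_int (81 * (3 ^ i * y1) ^ 2 * m ^ 3 + 3 * (3 ^ j * b1) ^ 2 * n)"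
        using rel unfolding \<tau>\<alpha> by (rule dvd_mult_right)
      have cop': "coprime f (- e')" using ef unfolding e' by (simp add: coprime_commute)
      have dvd_e': "r dvd f \<or> r dvd - e'" if "prime r" "r dvd e \<or> r dvd f" "\<not> r dvd 3" for r
        using that unfolding e' by (auto simp: prime_dvd_mult_iff)
      have y1_fe: "r dvd f \<or> r dvd - e'" if r: "prime r" "r dvd y1" for r
      proof (rule dvd_e'[OF r(1) y1_ef[OF r]])
        show "\<not> r dvd 3" using r y1(2) p3 primes_dvd_imp_eq by blast
      qed
      have b1_fe: "r dvd f \<or> r dvd - e'" if r: "prime r" "r dvd b1" for r
      proof (rule dvd_e'[OF r(1) b1_ef[OF r]])
        show "\<not> r dvd 3" using r b1(2) p3 primes_dvd_imp_eq by blast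
      qed
      have "cubic_residue_symbol \<alpha> (of_int n) = 1"
      proof (cases "3 dvd e'")
        case True
        \<comment> \<open>If e' has exactly one factor 3, the valuations give j = v(A) + i;
          \<open>j0\<close> admits this only with all three equal to 0.\<close>
        have "9 dvd - e' \<or> 3 dvd 2 * i + j"
        proof -
          have "3 dvd 2 * i + j" if "multiplicity 3 e' \<le> 1"
          proof -
            have "multiplicity 3 e' = 1" using that v1[OF True e'_nz] by simp
            then have "j = multiplicity 3 A + i" using vE vF ve v0[OF f3] by simp
            then have "j = 0" using j0 vA0 by (cases "j = 0") auto
            then show ?thesis using \<open>j = multiplicity 3 A + i\<close> by simp
          qed
          then show ?thesis using v2[of e'] by auto
        qed
        moreover have "3 dvd - e'" using True by simp
        ultimately show ?thesis
          unfolding \<alpha>_def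
          using flip_symbol_primary[OF cop' f3 _ _ n3 y1(2) b1(2) rel'[unfolded \<alpha>_def] cnm cny y1_fe b1_fe]
          by blast
      next
        case e'3: False
        have "j = 1 + multiplicity 3 A + i" using vE vF ve v0[OF f3] v0[OF e'3] by simp
        moreover from this have "i = 0" "\<not> 3 dvd A" using j0 by auto
        ultimately have j1: "j = 1" "i = 0" using vA0 by auto
        have g2: "multiplicity 3 g = 1" using vF j1 v0[OF f3] by simp
        then obtain g1 where g1: "g = 3 * g1" using multiplicity_dvd[of 3 g] by auto
        have "3 dvd (phi e' - phi f) - (phi y1 - phi b1 - phi X)"
        proof (rule phi_quotients[OF \<open>\<not> 3 dvd A\<close> _ y1(2) b1(2)])
          show "3 dvd \<beta>" using beta3 j1 by simp
          show "e' * g1 = A * y1" using eg(1) unfolding g1 y1(1) j1 e' by simp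
          show "f * g1 = - (b1 * X)" using eg(2) unfolding g1 b1(1) j1 by (simp add: mult.commute)
        qed
        \<comment> \<open>For j = 1, with the coordinates exchanged, what remains modulo 3 is 3 (phi
          y1 - phi X).\<close>
        moreover have "3 dvd - pn + 2 * py + pb - 1 * (pf - pe)"
          if "3 dvd (pe - pf) - (py - pb - pX)" "3 dvd pn - 2 * pX" for pe pf py pb pX pn :: int
          using that by presburger
        ultimately have "3 dvd - phi n + 2 * phi y1 + phi b1 - int j * (phi f - phi (- e'))"
          using phi_n unfolding j1 of_nat_1 power2_minus by blast
        moreover have "of_int f + of_int (- e') * \<theta> dvd of_int (81 * y1 ^ 2 * m ^ 3 + 3 * (3 ^ j * b1) ^ 2 * n)"
          using rel' unfolding \<alpha>_def j1 by simp
        moreover have "\<not> 3 dvd - e'" using e'3 by simp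
        ultimately show ?thesis
          unfolding \<alpha>_def
          using flip_symbol_nonprimary[OF cop' f3 _ _ n3 y1(2) b1(2) _ cnm cny y1_fe b1_fe] by blast
      qed
      then show ?thesis
        unfolding \<tau>\<alpha> symbol_mult_left[OF N] symbol_theta_of_int[OF n3] by simp
    qed
  qed
  ultimately show ?thesis by (simp add: symbol_mult_left[OF N])
qed

end

text \<open>The cases A = 0 and \<beta> = 0 are separated because \<open>multiplicity\<close> of 0
  is 0 and valuations then say nothing. There \<tau> is a rational multiple of \<theta> or of 1,
  prime to n.\<close>

theorem (in cubic_form) symbol_form_eq_1:
  "cubic_residue_symbol (of_int (9 * A * y) - of_int (\<beta> * X) * \<theta>) (of_int n) = 1"
proof -
  note N = eis_norm_of_int_not_dvd_3[OF not_3_dvd_n]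
  have 9: "\<not> r dvd 9" if "prime r" "r dvd n" for r
  proof -
    have "(9::int) = 3 ^ 2" by simp
    then show ?thesis using prime_dvd_n(1)[OF that] that(1) prime_dvd_power by metis
  qed
  consider "A = 0" | "\<beta> = 0" | "A \<noteq> 0" "\<beta> \<noteq> 0" by blast
  then show ?thesis
  proof cases
    case 1
    have "coprime n (- (\<beta> * X))"
    proof (rule coprime_n_I)
      fix r assume r: "prime r" "r dvd n"
      show "\<not> r dvd - (\<beta> * X)"
        using prime_dvd_n(5,7)[OF r] 1 r(1) by (auto simp: prime_dvd_mult_iff)
    qed
    then have "cubic_residue_symbol (of_int (- (\<beta> * X))) (of_int n) = 1"
      by (intro symbol_of_int_of_int not_3_dvd_n) (simp add: coprime_commute)
    then have "cubic_residue_symbol (of_int (- (\<beta> * X)) * \<theta>) (of_int n) = 1"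
      unfolding symbol_mult_left[OF N] symbol_theta_of_int[OF not_3_dvd_n] by simp
    then show ?thesis using 1 by simp
  next
    case 2
    have "coprime n (9 * A * y)"
    proof (rule coprime_n_I)
      fix r assume r: "prime r" "r dvd n"
      show "\<not> r dvd 9 * A * y"
        using prime_dvd_n(4,5)[OF r] 9[OF r] 2 r(1) by (auto simp: prime_dvd_mult_iff)
    qed
    then have "cubic_residue_symbol (of_int (9 * A * y)) (of_int n) = 1"
      by (intro symbol_of_int_of_int not_3_dvd_n) (simp add: coprime_commute)
    then show ?thesis using 2 by simp
  next
    case 3
    then interpret cubic_form_nonzero by unfold_locales
    show ?thesis by (rule symbol_form_eq_1_nonzero)
  qed
qed

section \<open>The cubic character of the quadratic irrationality\<close>

lemma prod_primes_dvd:
  fixes k :: int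
  assumes "finite F" "\<And>q. q \<in> F \<Longrightarrow> prime q \<and> q dvd k"
  shows "\<Prod>F dvd k"
  using assms
proof (induction F rule: finite_induct)
  case (insert q F)
  have "coprime q (\<Prod>F)"
  proof (rule prod_coprime_right)
    fix r assume "r \<in> F"
    then show "coprime q r" using insert by (intro primes_coprime) auto
  qed
  then show ?case using insert by (simp add: divides_mult)
qed simp

text \<open>A nonzero gcd makes the set of primes in \<open>C_of\<close> finite; a product over an
  infinite set would default to 1.\<close>

lemma C_of_properties:
  assumes "gcd A B \<noteq> 0"
  shows "odd (C_of D A B)" "C_of D A B dvd B"
    "\<And>r. prime r \<Longrightarrow> odd r \<Longrightarrow> r dvd A \<Longrightarrow> r dvd B \<Longrightarrow> \<not> r dvd D \<Longrightarrow> r dvd C_of D A B"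
    "\<And>r. prime r \<Longrightarrow> r dvd C_of D A B \<Longrightarrow> r dvd A"
proof -
  define F where "F = {q::int. prime q \<and> odd q \<and> q dvd gcd A B \<and> \<not> q dvd D}"
  have C: "C_of D A B = \<Prod>F" by (simp add: C_of_def F_def)
  have "F \<subseteq> {0..\<bar>gcd A B\<bar>}"
    using assms by (auto simp: F_def prime_ge_0_int intro!: dvd_imp_le_int zdvd_imp_le)
  then have fin: "finite F" by (rule finite_subset) simp
  show "odd (C_of D A B)"
    unfolding C using fin by (simp add: even_prod_iff F_def)
  show "C_of D A B dvd B"
    unfolding C using fin by (rule prod_primes_dvd) (auto simp: F_def)
  show "r dvd C_of D A B" if "prime r" "odd r" "r dvd A" "r dvd B" "\<not> r dvd D" for r
    unfolding C using that by (intro dvd_prodI fin) (simp add: F_def)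
  show "r dvd A" if r: "prime r" "r dvd C_of D A B" for r
  proof -
    have "r dvd (\<Prod>q\<in>F. q)" using r(2) unfolding C .
    then have "\<exists>q\<in>F. r dvd q" by (simp only: prime_dvd_prod_iff[OF fin r(1)])
    then obtain q where "q \<in> F" "r dvd q" by blast
    then have "r dvd gcd A B" unfolding F_def using dvd_trans by blast
    then show ?thesis by simp
  qed
qed

lemma (in split_prime) crp_of_int_eq_1_iff:
  "cubic_residue_prime (of_int u) \<rho> = 1 \<longleftrightarrow> [u ^ ((l - 1) div 3) = 1] (mod int l)"
proof -
  have k: "crp_exp \<rho> = (l - 1) div 3" using norm_lam by (simp add: nat_diff_distrib)
  have "cubic_residue_prime (of_int u) \<rho> = 1 \<longleftrightarrow> \<rho> dvd of_int u ^ crp_exp \<rho> - 1"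
    using crp_props(2)[OF lam, of "of_int u"] crp_eqI[OF lam, of 1 "of_int u"] by auto
  also have "\<dots> \<longleftrightarrow> \<rho> dvd of_int (u ^ crp_exp \<rho> - 1)" by simp
  also have "\<dots> \<longleftrightarrow> [u ^ ((l - 1) div 3) = 1] (mod int l)"
    unfolding lam_dvd_of_int_iff k by (simp only: cong_iff_dvd_diff)
  finally show ?thesis .
qed

text \<open>If \<open>X \<equiv> 3Cyt\<theta>\<close> modulo \<open>\<pi>\<close>, then \<open>9Ay - \<beta>X\<theta>\<close> is \<open>9y(A + Bt)\<close> modulo \<open>\<pi>\<close> and
  \<open>9y(A - Bt)\<close> modulo the conjugate prime.\<close>

lemma (in split_prime) symbol_form_split:
  fixes A B C \<beta> X y t m :: int
  assumes B: "\<beta> * C = B" and X: "\<rho> dvd of_int X - of_int (3 * C * y * t) * \<theta>"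
    and m: "int l dvd (A + B * t) * (A - B * t) - m ^ 3"
    and nd: "\<not> int l dvd m" "\<not> int l dvd 3" "\<not> int l dvd y"
  shows "cubic_residue_symbol (of_int (9 * A * y) - of_int (\<beta> * X) * \<theta>) (of_nat l) =
      cubic_residue_prime (of_int (A + B * t)) \<rho> ^ 2"
    "cubic_residue_prime (of_int (A - B * t)) \<rho> = cubic_residue_prime (of_int (A + B * t)) \<rho> ^ 2"
    "cubic_residue_prime (of_int (A + B * t)) \<rho> \<in> cube_units"
proof -
  define \<tau> where "\<tau> = of_int (9 * A * y) - of_int (\<beta> * X) * \<theta>"
  define v w K where "v = cubic_residue_prime (of_int (A + B * t)) \<rho>"
    and "w = cubic_residue_prime (of_int (A - B * t)) \<rho>"
    and "K = cubic_residue_prime (of_int (9 * y)) \<rho>"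
  have nd9: "\<not> int l dvd 9 * y"
  proof -
    have "(9::int) = 3 * 3" by simp
    then show ?thesis using nd prime_l by (metis prime_dvd_mult_iff prime_int_nat_transfer int_nat_eq nat_int of_nat_0_le_iff)
  qed
  have "\<not> int l dvd (A + B * t) * (A - B * t)"
  proof
    assume "int l dvd (A + B * t) * (A - B * t)"
    then have "int l dvd m ^ 3" using dvd_diff_imp_dvd[OF m] by blast
    then show False using nd(1) prime_l by (simp add: prime_dvd_power_iff)
  qed
  then have "\<not> int l dvd A + B * t" "\<not> int l dvd A - B * t" by auto
  then have units: "v \<in> cube_units" "w \<in> cube_units" "K \<in> cube_units"
    unfolding v_def w_def K_def using nd9 by (auto intro!: crp_in_cube_units[OF lam] simp only: lam_dvd_of_int_iff)
  \<comment> \<open>The product is the symbol of the norm of u modulo the prime, and that norm is a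
    cube.\<close>
  have "v * w = cubic_residue_prime (of_int m ^ 3) \<rho>"
    unfolding v_def w_def crp_mult[OF lam, symmetric]
  proof (rule crp_cong[OF lam])
    have "\<rho> dvd of_int ((A + B * t) * (A - B * t) - m ^ 3)" using m unfolding lam_dvd_of_int_iff .
    then show "\<rho> dvd of_int (A + B * t) * of_int (A - B * t) - of_int m ^ 3" by simp
  qed
  also have "\<dots> = cubic_residue_prime (of_int m) \<rho> ^ 3"
    by (simp add: crp_mult[OF lam] power3_eq_cube)
  also have "\<dots> = 1"
    using nd(1) by (intro cube_units_cube crp_in_cube_units[OF lam]) (simp add: lam_dvd_of_int_iff)
  finally have vw: "w = v ^ 2" using cube_units_mult_eq_1_iff units by blast
  have dt: "\<rho> dvd of_int (\<beta> * X) * \<theta> + of_int (9 * B * y * t)"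
  proof -
    have "of_int (\<beta> * X) * \<theta> + of_int (9 * B * y * t) =
        (of_int X - of_int (3 * C * y * t) * \<theta>) * (of_int \<beta> * \<theta>)"
      unfolding B[symmetric] by (simp add: eis_eq_iff algebra_simps)
    then show ?thesis using X by simp
  qed
  have "cubic_residue_prime \<tau> \<rho> = cubic_residue_prime (of_int (9 * y) * of_int (A + B * t)) \<rho>"
  proof (rule crp_cong[OF lam])
    have "\<tau> - of_int (9 * y) * of_int (A + B * t) = - (of_int (\<beta> * X) * \<theta> + of_int (9 * B * y * t))"
      by (simp add: \<tau>_def algebra_simps)
    then show "\<rho> dvd \<tau> - of_int (9 * y) * of_int (A + B * t)" using dt by (simp only: dvd_minus_iff)
  qed
  then have 1: "cubic_residue_prime \<tau> \<rho> = K * v" by (simp only: crp_mult[OF lam] K_def v_def)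
  have "cubic_residue_prime (eis_cnj \<tau>) \<rho> = cubic_residue_prime (of_int (9 * y) * of_int (A - B * t)) \<rho>"
  proof (rule crp_cong[OF lam])
    have "eis_cnj \<tau> - of_int (9 * y) * of_int (A - B * t) = of_int (\<beta> * X) * \<theta> + of_int (9 * B * y * t)"
      by (simp add: \<tau>_def eis_omega_square algebra_simps)
    then show "\<rho> dvd eis_cnj \<tau> - of_int (9 * y) * of_int (A - B * t)" using dt by simp
  qed
  then have 2: "cubic_residue_prime (eis_cnj \<tau>) \<rho> = K * w" by (simp only: crp_mult[OF lam] K_def w_def)
  \<comment> \<open>The factor 9y occurs at \<rho> and conjugated at the conjugate prime, so K
    cancels; w = v^2 then leaves v^2.\<close>
  have "cubic_residue_symbol \<tau> (of_nat l) = (K * eis_cnj K) * v * eis_cnj w"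
    unfolding symbol_split[OF lam lam_mult_cnj] 1 2 by (simp add: mult_ac)
  also have "\<dots> = v ^ 3 * v ^ 2"
    unfolding vw cube_units_mult_cnj[OF units(3)] using units
    by (simp add: cube_units_cnj power2_eq_square power3_eq_cube)
  also have "\<dots> = v ^ 2" using cube_units_cube[OF units(1)] by simp
  finally show "cubic_residue_symbol (of_int (9 * A * y) - of_int (\<beta> * X) * \<theta>) (of_nat l) =
      cubic_residue_prime (of_int (A + B * t)) \<rho> ^ 2"
    unfolding \<tau>_def v_def .
  show "cubic_residue_prime (of_int (A - B * t)) \<rho> = cubic_residue_prime (of_int (A + B * t)) \<rho> ^ 2"
    using vw by (simp add: v_def w_def)
  show "cubic_residue_prime (of_int (A + B * t)) \<rho> \<in> cube_units"
    using units(1) by (simp add: v_def)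
qed

theorem theorem1p1:
  fixes D A B C a b c x y :: int and p :: nat
  assumes "D > 1" and "squarefree D"
    and "(A, B) \<in> S_set D"
    and "C = C_of D A B"
    and "(a, b, c) \<in> primitive_forms (- 27 * C\<^sup>2 * D)"
    and "prime p" and "[p = 1] (mod 3)"
    and "int p = a * x\<^sup>2 + 2 * b * x * y + c * y\<^sup>2"
    and "gcd (a * int p) (3 * quad_norm D A B * D * y) = 1"
  shows "(\<exists>s::int. [s\<^sup>2 = D] (mod int p)) \<and>
    (\<forall>s::int. [s\<^sup>2 = D] (mod int p) \<longrightarrow>
      ([(A + B * s) ^ ((p - 1) div 3) = 1] (mod int p) \<longleftrightarrow>
       cubic_residue_symbol (of_int (9 * A) - of_int (B div C * b) * (1 + 2 * eis_omega)) (of_int a) = 1))"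
proof -
  define X where "X = a * x + b * y"
  define n where "n = a * int p"
  define \<beta> where "\<beta> = B div C"
  obtain m where m: "A\<^sup>2 - B\<^sup>2 * D = m ^ 3"
    using assms(3) by (auto simp: S_set_def quad_norm_def)
  have cubefree: "\<not> r ^ 3 dvd gcd A B" if "prime r" for r :: int
    using assms(3) that unfolding S_set_def by blast
  have g_nz: "gcd A B \<noteq> 0"
  proof
    assume "gcd A B = 0"
    then have "(2::int) ^ 3 dvd gcd A B" by (simp only: dvd_0_right)
    then show False using cubefree[of 2] by simp
  qed
  note Cprops = C_of_properties[OF g_nz, where D = D, folded assms(4)]
  have \<beta>C: "\<beta> * C = B" using Cprops(2) by (simp add: \<beta>_def)
  have disc: "b\<^sup>2 - a * c = - 27 * C\<^sup>2 * D" and a_pos: "a > 0"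
    using assms(5) by (auto simp: primitive_forms_def)
  have n_eq: "n = X ^ 2 + 27 * C ^ 2 * D * y ^ 2"
  proof -
    have "n = X ^ 2 - (b\<^sup>2 - a * c) * y ^ 2"
      unfolding n_def X_def assms(8) by (simp add: power2_eq_square algebra_simps)
    then show ?thesis unfolding disc by simp
  qed
  have pp: "prime (int p)" using assms(6) by simp
  have cop3: "coprime n (3 * m ^ 3 * D * y)"
    using assms(9) m unfolding n_def quad_norm_def by (simp add: coprime_iff_gcd_eq_1)
  have cop: "coprime n (3 * m * D * y)"
    using cop3 by simp
  \<comment> \<open>As n is not a unit, it is not coprime to 0, so neither y nor m can be 0.\<close>
  have "\<not> n dvd 1"
    unfolding n_def using pp not_prime_unit dvd_mult_right by blast
  then have nz: "y \<noteq> 0" "m \<noteq> 0" using cop by auto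
  interpret form: cubic_form A \<beta> C D X y m n
    by unfold_locales
      (use m n_eq cop assms(2) cubefree Cprops nz in \<open>simp_all add: \<beta>C\<close>)
  have pn: "int p dvd n" by (simp add: n_def)
  note p_not = form.prime_dvd_n[OF pp pn]
  obtain \<pi> where \<pi>: "prime_elem \<pi>" "eis_norm \<pi> = int p" "\<not> \<pi> dvd 3"
    using eis_ex_split_prime[OF assms(6,7)] by blast
  interpret split_prime \<pi> p
    by unfold_locales (use \<pi> assms(6) in auto)
  have a3: "\<not> 3 dvd a" using form.not_3_dvd_n by (auto simp: n_def)
  note Na = eis_norm_of_int_not_dvd_3[OF a3]
  define \<sigma> \<tau> where "\<sigma> = (of_int (9 * A) - of_int (\<beta> * b) * \<theta> :: eisenstein)"
    and "\<tau> = (of_int (9 * A * y) - of_int (\<beta> * X) * \<theta> :: eisenstein)"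
  have "cubic_residue_symbol \<tau> (of_int a) = cubic_residue_symbol (of_int y * \<sigma>) (of_int a)"
  proof (rule symbol_cong[OF Na])
    have "\<tau> - of_int y * \<sigma> = of_int a * (- of_int (\<beta> * x) * \<theta>)"
      by (simp add: \<tau>_def \<sigma>_def X_def algebra_simps)
    then show "of_int a dvd \<tau> - of_int y * \<sigma>" by simp
  qed
  also have "\<dots> = cubic_residue_symbol \<sigma> (of_int a)"
  proof -
    have "coprime a y" using cop unfolding n_def by simp
    then show ?thesis
      using symbol_of_int_of_int[OF a3, of y] by (simp add: symbol_mult_left[OF Na] coprime_commute)
  qed
  finally have \<sigma>\<tau>: "cubic_residue_symbol \<tau> (of_int a) = cubic_residue_symbol \<sigma> (of_int a)" .
  have "(of_int a :: eisenstein) \<noteq> 0" "(of_nat p :: eisenstein) \<noteq> 0"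
    using a_pos l_pos by (auto simp: eis_eq_iff)
  \<comment> \<open>The trivial symbol modulo n = ap factors into the two symbols to be compared, so
    one is 1 exactly when the other is.\<close>
  then have prod: "cubic_residue_symbol \<sigma> (of_int a) * cubic_residue_symbol \<tau> (of_nat p) = 1"
    using form.symbol_form_eq_1 \<sigma>\<tau> unfolding \<tau>_def[symmetric] n_def by (simp add: symbol_mult_right)
  have main: "[(A + B * s) ^ ((p - 1) div 3) = 1] (mod int p) \<longleftrightarrow> cubic_residue_symbol \<sigma> (of_int a) = 1"
    if s: "[s\<^sup>2 = D] (mod int p)" for s
  proof -
    obtain k where k: "s\<^sup>2 - D = int p * k"
      using s by (auto simp: cong_iff_dvd_diff)
    have norm_s: "int p dvd (A + B * t) * (A - B * t) - m ^ 3" if "t\<^sup>2 = s\<^sup>2" for t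
    proof -
      have "(A + B * t) * (A - B * t) - m ^ 3 = - B\<^sup>2 * (t\<^sup>2 - D)"
        unfolding m[symmetric] by (simp add: power2_eq_square algebra_simps)
      then show ?thesis unfolding that k by simp
    qed
    \<comment> \<open>The product is X^2 + 27 C^2 y^2 s^2, which equals n modulo p. So either s or
      -s can serve as t in \<open>symbol_form_split\<close>.\<close>
    have "\<pi> dvd (of_int X - of_int (3 * C * y * s) * \<theta>) * (of_int X - of_int (3 * C * y * (- s)) * \<theta>)"
    proof -
      have "(of_int X - of_int (3 * C * y * s) * \<theta>) * (of_int X - of_int (3 * C * y * (- s)) * \<theta>) =
          (of_int (X\<^sup>2 + 27 * C\<^sup>2 * y\<^sup>2 * s\<^sup>2) :: eisenstein)"
        by (simp add: eis_eq_iff power2_eq_square algebra_simps)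
      moreover have "X\<^sup>2 + 27 * C\<^sup>2 * y\<^sup>2 * s\<^sup>2 = n + 27 * C\<^sup>2 * y\<^sup>2 * (s\<^sup>2 - D)"
        unfolding n_eq by (simp add: algebra_simps)
      then have "int p dvd X\<^sup>2 + 27 * C\<^sup>2 * y\<^sup>2 * s\<^sup>2" using pn k by simp
      ultimately show ?thesis by (simp only: lam_dvd_of_int_iff)
    qed
    then consider "\<pi> dvd of_int X - of_int (3 * C * y * s) * \<theta>" | "\<pi> dvd of_int X - of_int (3 * C * y * (- s)) * \<theta>"
      using \<pi>(1) prime_elem_dvd_multD by blast
    then have "cubic_residue_symbol \<tau> (of_nat p) = 1 \<longleftrightarrow> cubic_residue_prime (of_int (A + B * s)) \<pi> = 1"
    proof cases
      case 1
      show ?thesis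
        using symbol_form_split[OF \<beta>C 1 norm_s p_not(2,1,4)] cube_units_square_eq_1_iff
        unfolding \<tau>_def by simp
    next
      case 2
      \<comment> \<open>The opposite root exchanges A + Bs and A - Bs, whose symbols are squares of
        one another, so the condition to be 1 is unchanged.\<close>
      have sq: "(- s)\<^sup>2 = s\<^sup>2" by simp
      note f = symbol_form_split[OF \<beta>C 2 norm_s[OF sq] p_not(2,1,4)]
      have "A + B * (- s) = A - B * s" "A - B * (- s) = A + B * s" by simp_all
      then show ?thesis
        using f(1,2) unfolding \<tau>_def by simp
    qed
    moreover have "cubic_residue_symbol \<sigma> (of_int a) = 1 \<longleftrightarrow> cubic_residue_symbol \<tau> (of_nat p) = 1"
      using prod by auto
    ultimately show ?thesis by (simp only: crp_of_int_eq_1_iff)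
  qed
  have ex: "\<exists>s::int. [s\<^sup>2 = D] (mod int p)"
  proof -
    have "\<pi> dvd of_nat p" using lam_mult_cnj by (metis dvd_triv_left)
    then obtain z where z: "\<pi> dvd eis_omega - of_int z"
      using eis_split_omega[OF \<pi>(1) assms(6,7)] by blast
    \<comment> \<open>The rational image of \<theta> = 1 + 2\<omega>, hence a square root of -3
      modulo p.\<close>
    define w where "w = 1 + 2 * z"
    have "\<pi> dvd 2 * (eis_omega - of_int z) * (- \<theta> - of_int w)" using z by (intro dvd_mult2 dvd_mult)
    also have "2 * (eis_omega - of_int z) * (- \<theta> - of_int w) = (of_int (w\<^sup>2 + 3) :: eisenstein)"
      by (simp add: eis_eq_iff w_def power2_eq_square algebra_simps)
    finally have w: "int p dvd w\<^sup>2 + 3" by (simp only: lam_dvd_of_int_iff)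
    have "\<not> int p dvd w"
    proof
      assume "int p dvd w"
      then have "int p dvd w\<^sup>2" by (simp add: power2_eq_square)
      then have "int p dvd 3" using w by (simp add: dvd_add_right_iff)
      then show False using p_not(1) by blast
    qed
    define k where "k = 3 * C * y * w"
    have "\<not> int p dvd k"
      unfolding k_def using p_not \<open>\<not> int p dvd w\<close> pp by (simp add: prime_dvd_mult_iff)
    then have "coprime k (int p)" using pp prime_imp_coprime coprime_commute by blast
    then obtain i where i: "[k * i = 1] (mod int p)" using cong_solve_coprime_int by blast
    \<comment> \<open>s is X/(3Cyw) modulo p. Its square is -X^2/(27 C^2 y^2), which is D because p
      divides n.\<close>
    define s where "s = X * i"
    have "[(k * i)\<^sup>2 * X\<^sup>2 = 1\<^sup>2 * X\<^sup>2] (mod int p)"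
      using i by (intro cong_mult cong_pow) auto
    then have 1: "int p dvd k\<^sup>2 * s\<^sup>2 - X\<^sup>2"
      by (simp add: s_def cong_iff_dvd_diff power_mult_distrib mult_ac)
    have 2: "int p dvd 9 * C\<^sup>2 * y\<^sup>2 * s\<^sup>2 * (w\<^sup>2 + 3)" using w by simp
    have "int p dvd (k\<^sup>2 * s\<^sup>2 - X\<^sup>2) + n - 9 * C\<^sup>2 * y\<^sup>2 * s\<^sup>2 * (w\<^sup>2 + 3)"
      by (rule dvd_diff[OF dvd_add[OF 1 pn] 2])
    also have "\<dots> = - (3 ^ 3 * C\<^sup>2 * y\<^sup>2) * (s\<^sup>2 - D)"
      unfolding n_eq k_def by (simp add: power2_eq_square algebra_simps)
    finally have "int p dvd (3 ^ 3 * C\<^sup>2 * y\<^sup>2) * (s\<^sup>2 - D)" by simp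
    moreover have "\<not> int p dvd 3 ^ 3 * C\<^sup>2 * y\<^sup>2"
      using p_not pp by (auto simp only: prime_dvd_mult_iff dest!: prime_dvd_power[OF pp])
    ultimately have "int p dvd s\<^sup>2 - D" using pp by (simp only: prime_dvd_mult_iff) blast
    then show ?thesis by (auto simp: cong_iff_dvd_diff)
  qed
  show ?thesis
    using ex main unfolding \<sigma>_def \<beta>_def by blast
qed

end
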